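(* Let $\mathscr{V}$ be a topological category over $\mathsf{Set}$, with topological functor $|-| : \mathscr{V} \to \mathsf{Set}$, equipped with a symmetric monoidal structure $(\otimes, I)$ such that $|-|$ is strict symmetric monoidal with respect to the cartesian structure on $\mathsf{Set}$, and let $\mathcal{S}$ be a set. Let $\Sigma$ be a $\mathscr{V}$-enriched $\mathcal{S}$-sorted signature with underlying classical $\mathcal{S}$-sorted signature $|\Sigma|$, and let $X$ be an object of $\mathscr{V}^{\mathcal{S}}$. Then the carrier object $U^\Sigma F^\Sigma X \in \mathrm{ob}\,\mathscr{V}^{\mathcal{S}}$ of the free $\Sigma$-algebra $F^\Sigma X$ on $X$ is the infimum, in the fibre of $\mathscr{V}^{\mathcal{S}}$ over the $\mathcal{S}$-sorted set $U^{|\Sigma|} F^{|\Sigma|}|X| = \mathsf{Term}_{|\Sigma|}(|X|)$, of all the elements that are $\Sigma$-compatible with $X$: $$U^\Sigma F^\Sigma X = \bigwedge\left\{B \in \mathsf{Fib}\left(\mathsf{Term}_{|\Sigma|}(|X|)\right) \mid B \text{ is } \Sigma\text{-compatible with } X\right\}.$$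
   Context: Topological categories. A concrete category over a category $\mathscr{X}$ is a category $\mathscr{V}$ with a faithful functor $|-| : \mathscr{V} \to \mathscr{X}$; an $\mathscr{X}$-morphism $f : |V| \to |W|$ is $\mathscr{V}$-admissible if it lifts (uniquely) to a morphism $V \to W$. The fibre $\mathsf{Fib}(X)$ of an object $X$ of $\mathscr{X}$ is the preordered class of objects $V$ with $|V| = X$, where $V \leq V'$ iff $1_X$ is an admissible morphism $V \to V'$; $\mathscr{V}$ is amnestic if all fibres are partially ordered. A (possibly large) source $(f_i : V \to V_i)_{i}$ is initial if for all $W$ and $f : |W| \to |V|$, $f$ is admissible iff all $f_i \circ f$ are. $\mathscr{V}$ is topological over $\mathscr{X}$ if it is amnestic and every (possibly large) structured source $(f_i : X \to |V_i|)_i$ has an initial lift: an object $V$ with $|V| = X$, each $f_i$ admissible $V \to V_i$, and $(f_i : V \to V_i)_i$ initial. Then every fibre is a (possibly large) complete lattice. The category $\mathscr{V}^{\mathcal{S}}$ is topological over $\mathsf{Set}^{\mathcal{S}}$ via $|(V_S)_{S}| = (|V_S|)_{S}$, with fibres ordered componentwise. One has $|X \otimes Y| = |X| \times |Y|$, $|X \times Y| = |X| \times |Y|$, and $|I|$ is a singleton. $\mathcal{S}^*$ is the set of finite sequences of elements of $\mathcal{S}$. Signatures. A $\mathscr{V}$-enriched $\mathcal{S}$-sorted signature is a set $\Sigma$ of operation symbols, each equipped with a type $((S_1, \ldots, S_n), S, P)$: input sorts $(S_1,\ldots,S_n) \in \mathcal{S}^*$, output sort $S \in \mathcal{S}$,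 parameter object $P \in \mathrm{ob}\,\mathscr{V}$. A $\Sigma$-algebra is an object $A = (A_S)_{S}$ of $\mathscr{V}^{\mathcal{S}}$ with, for each $\sigma \in \Sigma$ of type $((S_1, \ldots, S_n), S, P)$, a $\mathscr{V}$-morphism $\sigma^A : P \otimes (A_{S_1} \times \cdots \times A_{S_n}) \to A_S$. A morphism $f : A \to B$ of $\Sigma$-algebras is a morphism of $\mathscr{V}^{\mathcal{S}}$ with $f_S \circ \sigma^A = \sigma^B \circ (1_P \otimes (f_{S_1} \times \cdots \times f_{S_n}))$ for all $\sigma$. $U^\Sigma : \Sigma\text{-}\mathsf{Alg} \to \mathscr{V}^{\mathcal{S}}$ is the forgetful functor. A classical $\mathcal{S}$-sorted signature is the case $\mathscr{V} = \mathsf{Set}$ (cartesian) with all parameters equal to the one-point set. Underlying classical signature. $|\Sigma|$ has an operation symbol $\sigma_p$ with input sorts $(S_1,\ldots,S_n)$ and output sort $S$ for each $\sigma \in \Sigma$ of type $((S_1,\ldots,S_n),S,P)$ and each $p \in |P|$. Each $\Sigma$-algebra $A$ has an underlying $|\Sigma|$-algebra $|A|$ with carrier $(|A_S|)_S$ and $\sigma_p^{|A|} = \sigma^A(p, -)$; this gives a functor $|-|^\Sigma : \Sigma\text{-}\mathsf{Alg} \to |\Sigma|\text{-}\mathsf{Alg}$. Classical free algebras. For an $\mathcal{S}$-sorted set $Y$, $\mathsf{Term}_{|\Sigma|}(Y)$ is the $\mathcal{S}$-sorted set of ground terms with constants from $Y$: $Y_S \subseteq \mathsf{Term}_{|\Sigma|}(Y)_S$,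 and for each $\tau \in |\Sigma|$ with input sorts $(S_1, \ldots, S_n)$, output sort $S$, and $t_i \in \mathsf{Term}_{|\Sigma|}(Y)_{S_i}$, one has $\tau(t_1, \ldots, t_n) \in \mathsf{Term}_{|\Sigma|}(Y)_S$. With the evident operations it is the free $|\Sigma|$-algebra $F^{|\Sigma|} Y$. $F^\Sigma$ denotes the left adjoint of $U^\Sigma$ (which exists), chosen so that the adjunction $F^\Sigma \dashv U^\Sigma$ strictly lifts $F^{|\Sigma|} \dashv U^{|\Sigma|}$; in particular the underlying $|\Sigma|$-algebra of $F^\Sigma X$ is $F^{|\Sigma|}|X|$, so $U^\Sigma F^\Sigma X$ lies in the fibre over $\mathsf{Term}_{|\Sigma|}(|X|)$, and the unit has as underlying function the inclusion $|X| \hookrightarrow \mathsf{Term}_{|\Sigma|}(|X|)$. Compatibility. An object $B$ of $\mathscr{V}^{\mathcal{S}}$ in the fibre over $\mathsf{Term}_{|\Sigma|}(|X|)$ is $\Sigma$-compatible with $X$ if: (1) the $\mathcal{S}$-sorted inclusion $|X| \to \mathsf{Term}_{|\Sigma|}(|X|) = |B|$ is an admissible morphism $X \to B$ of $\mathscr{V}^{\mathcal{S}}$; and (2) for each $\sigma \in \Sigma$ of type $((S_1, \ldots, S_n), S, P)$, the function $\widehat{\sigma} : |P| \times \mathsf{Term}_{|\Sigma|}(|X|)_{S_1} \times \cdots \times \mathsf{Term}_{|\Sigma|}(|X|)_{S_n} \to \mathsf{Term}_{|\Sigma|}(|X|)_S$, $(p, t_1, \ldots, t_n) \mapsto \sigma_p(t_1,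 \ldots, t_n)$, is an admissible morphism $P \otimes (B_{S_1} \times \cdots \times B_{S_n}) \to B_S$ of $\mathscr{V}$. *)

theory Defs
  imports "HOL-Algebra.Order"
begin

section \<open>Categories and functors\<close>

record ('o, 'm) cat =
  Ob :: "'o set"
  Arr :: "'m set"
  Dom :: "'m \<Rightarrow> 'o"
  Cod :: "'m \<Rightarrow> 'o"
  Ident :: "'o \<Rightarrow> 'm"
  Comp :: "'m \<Rightarrow> 'm \<Rightarrow> 'm"  (infixr \<open>\<cdot>\<index>\<close> 70)

definition Hom :: "('o, 'm, 'x) cat_scheme \<Rightarrow> 'o \<Rightarrow> 'o \<Rightarrow> 'm set" where
  "Hom C X Y = {f \<in> Arr C. Dom C f = X \<and> Cod C f = Y}"

locale category =
  fixes C :: "('o, 'm, 'x) cat_scheme" (structure)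
  assumes dom_ob: "f \<in> Arr C \<Longrightarrow> Dom C f \<in> Ob C"
    and cod_ob: "f \<in> Arr C \<Longrightarrow> Cod C f \<in> Ob C"
    and ident_hom: "X \<in> Ob C \<Longrightarrow> Ident C X \<in> Hom C X X"
    and comp_hom: "\<lbrakk>f \<in> Hom C X Y; g \<in> Hom C Y Z\<rbrakk> \<Longrightarrow> g \<cdot> f \<in> Hom C X Z"
    and comp_ident: "f \<in> Hom C X Y \<Longrightarrow> f \<cdot> Ident C X = f"
    and ident_comp: "f \<in> Hom C X Y \<Longrightarrow> Ident C Y \<cdot> f = f"
    and comp_assoc: "\<lbrakk>f \<in> Hom C W X; g \<in> Hom C X Y; h \<in> Hom C Y Z\<rbrakk>
        \<Longrightarrow> (h \<cdot> g) \<cdot> f = h \<cdot> (g \<cdot> f)"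

definition iso_in :: "('o, 'm, 'x) cat_scheme \<Rightarrow> 'o \<Rightarrow> 'o \<Rightarrow> 'm \<Rightarrow> bool" where
  "iso_in C X Y f \<longleftrightarrow> f \<in> Hom C X Y \<and>
     (\<exists>g \<in> Hom C Y X. g \<cdot>\<^bsub>C\<^esub> f = Ident C X \<and> f \<cdot>\<^bsub>C\<^esub> g = Ident C Y)"

record ('o, 'm, 'p, 'n) func =
  FOb :: "'o \<Rightarrow> 'p"
  FArr :: "'m \<Rightarrow> 'n"

definition is_functor ::
    "('o, 'm, 'x) cat_scheme \<Rightarrow> ('p, 'n, 'y) cat_scheme \<Rightarrow> ('o, 'm, 'p, 'n) func \<Rightarrow> bool" where
  "is_functor C D F \<longleftrightarrow>
     (\<forall>X \<in> Ob C. FOb F X \<in> Ob D) \<and>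
     (\<forall>X \<in> Ob C. \<forall>Y \<in> Ob C. \<forall>f \<in> Hom C X Y. FArr F f \<in> Hom D (FOb F X) (FOb F Y)) \<and>
     (\<forall>X \<in> Ob C. FArr F (Ident C X) = Ident D (FOb F X)) \<and>
     (\<forall>X \<in> Ob C. \<forall>Y \<in> Ob C. \<forall>Z \<in> Ob C. \<forall>f \<in> Hom C X Y. \<forall>g \<in> Hom C Y Z.
        FArr F (g \<cdot>\<^bsub>C\<^esub> f) = FArr F g \<cdot>\<^bsub>D\<^esub> FArr F f)"

definition faithful :: "('o, 'm, 'x) cat_scheme \<Rightarrow> ('o, 'm, 'p, 'n) func \<Rightarrow> bool" where
  "faithful C F \<longleftrightarrow>
     (\<forall>X \<in> Ob C. \<forall>Y \<in> Ob C. \<forall>f \<in> Hom C X Y. \<forall>g \<in> Hom C X Y. FArr F f = FArr F g \<longrightarrow> f = g)"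

definition id_func :: "('o, 'm, 'o, 'm) func" where
  "id_func = \<lparr>FOb = (\<lambda>X. X), FArr = (\<lambda>f. f)\<rparr>"

text \<open>\<open>F\<close> is left adjoint to \<open>G\<close> with unit \<open>\<eta>\<close>.\<close>

definition left_adjoint ::
    "('o, 'm, 'x) cat_scheme \<Rightarrow> ('p, 'n, 'y) cat_scheme \<Rightarrow>
     ('o, 'm, 'p, 'n) func \<Rightarrow> ('p, 'n, 'o, 'm) func \<Rightarrow> ('o \<Rightarrow> 'm) \<Rightarrow> bool" where
  "left_adjoint C D F G \<eta> \<longleftrightarrow>
     is_functor C D F \<and> is_functor D C G \<and>
     (\<forall>X \<in> Ob C. \<eta> X \<in> Hom C X (FOb G (FOb F X))) \<and>
     (\<forall>X \<in> Ob C. \<forall>Y \<in> Ob C. \<forall>f \<in> Hom C X Y.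
        FArr G (FArr F f) \<cdot>\<^bsub>C\<^esub> \<eta> X = \<eta> Y \<cdot>\<^bsub>C\<^esub> f) \<and>
     (\<forall>X \<in> Ob C. \<forall>A \<in> Ob D. \<forall>f \<in> Hom C X (FOb G A).
        \<exists>!h. h \<in> Hom D (FOb F X) A \<and> FArr G h \<cdot>\<^bsub>C\<^esub> \<eta> X = f)"

text \<open>The adjunction \<open>(F, G, \<eta>)\<close> strictly lifts \<open>(F', G', \<eta>')\<close> along the functors
  \<open>P : C \<rightarrow> C'\<close> and \<open>Q : D \<rightarrow> D'\<close>; compatibility with the counits follows from
  compatibility with the units.\<close>

definition strictly_lifts ::
    "('o, 'm, 'x) cat_scheme \<Rightarrow> ('p, 'n, 'y) cat_scheme \<Rightarrow>
     ('o, 'm, 'o1, 'm1) func \<Rightarrow> ('p, 'n, 'p1, 'n1) func \<Rightarrow>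
     ('o, 'm, 'p, 'n) func \<Rightarrow> ('p, 'n, 'o, 'm) func \<Rightarrow> ('o \<Rightarrow> 'm) \<Rightarrow>
     ('o1, 'm1, 'p1, 'n1) func \<Rightarrow> ('p1, 'n1, 'o1, 'm1) func \<Rightarrow> ('o1 \<Rightarrow> 'm1) \<Rightarrow> bool" where
  "strictly_lifts C D P Q F G \<eta> F' G' \<eta>' \<longleftrightarrow>
     (\<forall>X \<in> Ob C. FOb Q (FOb F X) = FOb F' (FOb P X)) \<and>
     (\<forall>f \<in> Arr C. FArr Q (FArr F f) = FArr F' (FArr P f)) \<and>
     (\<forall>A \<in> Ob D. FOb P (FOb G A) = FOb G' (FOb Q A)) \<and>
     (\<forall>h \<in> Arr D. FArr P (FArr G h) = FArr G' (FArr Q h)) \<and>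
     (\<forall>X \<in> Ob C. FArr P (\<eta> X) = \<eta>' (FOb P X))"

text \<open>Families are indexed by a set \<open>S\<close> of a type and are extensional (\<open>undefined\<close> off \<open>S\<close>).\<close>

definition power_cat :: "'s set \<Rightarrow> ('o, 'm, 'x) cat_scheme \<Rightarrow> ('s \<Rightarrow> 'o, 's \<Rightarrow> 'm) cat" where
  "power_cat S C =
    \<lparr>Ob = (\<Pi>\<^sub>E s\<in>S. Ob C), Arr = (\<Pi>\<^sub>E s\<in>S. Arr C),
     Dom = (\<lambda>f. \<lambda>s\<in>S. Dom C (f s)), Cod = (\<lambda>f. \<lambda>s\<in>S. Cod C (f s)),
     Ident = (\<lambda>X. \<lambda>s\<in>S. Ident C (X s)), Comp = (\<lambda>g f. \<lambda>s\<in>S. g s \<cdot>\<^bsub>C\<^esub> f s)\<rparr>"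

definition power_func ::
    "'s set \<Rightarrow> ('o, 'm, 'p, 'n) func \<Rightarrow> ('s \<Rightarrow> 'o, 's \<Rightarrow> 'm, 's \<Rightarrow> 'p, 's \<Rightarrow> 'n) func" where
  "power_func S F = \<lparr>FOb = (\<lambda>X. \<lambda>s\<in>S. FOb F (X s)), FArr = (\<lambda>f. \<lambda>s\<in>S. FArr F (f s))\<rparr>"

definition is_product ::
    "('o, 'm, 'x) cat_scheme \<Rightarrow> 'o list \<Rightarrow> 'o \<Rightarrow> (nat \<Rightarrow> 'm) \<Rightarrow> bool" where
  "is_product C Ys X \<pi> \<longleftrightarrow> X \<in> Ob C \<and>
     (\<forall>i < length Ys. \<pi> i \<in> Hom C X (Ys ! i)) \<and>
     (\<forall>Z \<in> Ob C. \<forall>f. (\<forall>i < length Ys. f i \<in> Hom C Z (Ys ! i)) \<longrightarrow>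
        (\<exists>!h. h \<in> Hom C Z X \<and> (\<forall>i < length Ys. \<pi> i \<cdot>\<^bsub>C\<^esub> h = f i)))"


section \<open>Concrete and topological categories\<close>

definition concrete ::
    "('o, 'm, 'x) cat_scheme \<Rightarrow> ('p, 'n, 'y) cat_scheme \<Rightarrow> ('o, 'm, 'p, 'n) func \<Rightarrow> bool" where
  "concrete C D U \<longleftrightarrow> category C \<and> category D \<and> is_functor C D U \<and> faithful C U"

definition admissible ::
    "('o, 'm, 'x) cat_scheme \<Rightarrow> ('o, 'm, 'p, 'n) func \<Rightarrow> 'o \<Rightarrow> 'o \<Rightarrow> 'n \<Rightarrow> bool" where
  "admissible C U V W f \<longleftrightarrow> (\<exists>m \<in> Hom C V W. FArr U m = f)"

definition Fib ::
    "('o, 'm, 'x) cat_scheme \<Rightarrow> ('p, 'n, 'y) cat_scheme \<Rightarrow> ('o, 'm, 'p, 'n) func \<Rightarrow> 'p \<Rightarrow>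
     'o gorder" where
  "Fib C D U X =
    \<lparr>carrier = {V \<in> Ob C. FOb U V = X}, eq = (=),
     le = (\<lambda>V V'. admissible C U V V' (Ident D X))\<rparr>"

definition amnestic ::
    "('o, 'm, 'x) cat_scheme \<Rightarrow> ('p, 'n, 'y) cat_scheme \<Rightarrow> ('o, 'm, 'p, 'n) func \<Rightarrow> bool" where
  "amnestic C D U \<longleftrightarrow> (\<forall>X \<in> Ob D. partial_order (Fib C D U X))"

text \<open>A source is given by the set of its legs, each leg being a pair of a codomain object
  and an arrow of the base category. Being an initial lift depends only on this set, so sources
  indexed by arbitrary classes are covered.\<close>

definition structured_source ::
    "('o, 'm, 'x) cat_scheme \<Rightarrow> ('p, 'n, 'y) cat_scheme \<Rightarrow> ('o, 'm, 'p, 'n) func \<Rightarrow>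
     'p \<Rightarrow> ('o \<times> 'n) set \<Rightarrow> bool" where
  "structured_source C D U X G \<longleftrightarrow> (\<forall>(W, f) \<in> G. W \<in> Ob C \<and> f \<in> Hom D X (FOb U W))"

definition initial ::
    "('o, 'm, 'x) cat_scheme \<Rightarrow> ('p, 'n, 'y) cat_scheme \<Rightarrow> ('o, 'm, 'p, 'n) func \<Rightarrow>
     'o \<Rightarrow> ('o \<times> 'n) set \<Rightarrow> bool" where
  "initial C D U V G \<longleftrightarrow>
     (\<forall>W \<in> Ob C. \<forall>f \<in> Hom D (FOb U W) (FOb U V).
        admissible C U W V f \<longleftrightarrow> (\<forall>(V', f') \<in> G. admissible C U W V' (f' \<cdot>\<^bsub>D\<^esub> f)))"

definition initial_lift ::
    "('o, 'm, 'x) cat_scheme \<Rightarrow> ('p, 'n, 'y) cat_scheme \<Rightarrow> ('o, 'm, 'p, 'n) func \<Rightarrow>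
     'p \<Rightarrow> ('o \<times> 'n) set \<Rightarrow> 'o \<Rightarrow> bool" where
  "initial_lift C D U X G V \<longleftrightarrow>
     V \<in> Ob C \<and> FOb U V = X \<and> (\<forall>(V', f') \<in> G. admissible C U V V' f') \<and> initial C D U V G"

definition topological ::
    "('o, 'm, 'x) cat_scheme \<Rightarrow> ('p, 'n, 'y) cat_scheme \<Rightarrow> ('o, 'm, 'p, 'n) func \<Rightarrow> bool" where
  "topological C D U \<longleftrightarrow>
     concrete C D U \<and> amnestic C D U \<and>
     (\<forall>X \<in> Ob D. \<forall>G. structured_source C D U X G \<longrightarrow> (\<exists>V. initial_lift C D U X G V))"


section \<open>Symmetric monoidal categories\<close>

record ('o, 'm) moncat = "('o, 'm) cat" +
  TensOb :: "'o \<Rightarrow> 'o \<Rightarrow> 'o"  (infixr \<open>\<boxtimes>\<index>\<close> 75)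
  TensArr :: "'m \<Rightarrow> 'm \<Rightarrow> 'm"  (infixr \<open>\<otimes>\<index>\<close> 75)
  TUnit :: "'o"
  Assoc :: "'o \<Rightarrow> 'o \<Rightarrow> 'o \<Rightarrow> 'm"
  LUnit :: "'o \<Rightarrow> 'm"
  RUnit :: "'o \<Rightarrow> 'm"
  Sym :: "'o \<Rightarrow> 'o \<Rightarrow> 'm"

locale symmetric_monoidal = category C
  for C :: "('o, 'm, 'x) moncat_scheme" (structure) +
  assumes tens_ob: "\<lbrakk>X \<in> Ob C; Y \<in> Ob C\<rbrakk> \<Longrightarrow> X \<boxtimes> Y \<in> Ob C"
    and tens_hom: "\<lbrakk>f \<in> Hom C X X'; g \<in> Hom C Y Y'\<rbrakk> \<Longrightarrow> f \<otimes> g \<in> Hom C (X \<boxtimes> Y) (X' \<boxtimes> Y')"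
    and tens_ident: "\<lbrakk>X \<in> Ob C; Y \<in> Ob C\<rbrakk> \<Longrightarrow> Ident C X \<otimes> Ident C Y = Ident C (X \<boxtimes> Y)"
    and tens_comp: "\<lbrakk>f \<in> Hom C X X'; f' \<in> Hom C X' X''; g \<in> Hom C Y Y'; g' \<in> Hom C Y' Y''\<rbrakk>
        \<Longrightarrow> (f' \<cdot> f) \<otimes> (g' \<cdot> g) = (f' \<otimes> g') \<cdot> (f \<otimes> g)"
    and unit_ob: "TUnit C \<in> Ob C"
    and assoc_iso: "\<lbrakk>X \<in> Ob C; Y \<in> Ob C; Z \<in> Ob C\<rbrakk>
        \<Longrightarrow> iso_in C ((X \<boxtimes> Y) \<boxtimes> Z) (X \<boxtimes> (Y \<boxtimes> Z)) (Assoc C X Y Z)"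
    and assoc_natural: "\<lbrakk>f \<in> Hom C X X'; g \<in> Hom C Y Y'; h \<in> Hom C Z Z'\<rbrakk>
        \<Longrightarrow> Assoc C X' Y' Z' \<cdot> ((f \<otimes> g) \<otimes> h) = (f \<otimes> (g \<otimes> h)) \<cdot> Assoc C X Y Z"
    and lunit_iso: "X \<in> Ob C \<Longrightarrow> iso_in C (TUnit C \<boxtimes> X) X (LUnit C X)"
    and lunit_natural: "f \<in> Hom C X X'
        \<Longrightarrow> LUnit C X' \<cdot> (Ident C (TUnit C) \<otimes> f) = f \<cdot> LUnit C X"
    and runit_iso: "X \<in> Ob C \<Longrightarrow> iso_in C (X \<boxtimes> TUnit C) X (RUnit C X)"
    and runit_natural: "f \<in> Hom C X X'
        \<Longrightarrow> RUnit C X' \<cdot> (f \<otimes> Ident C (TUnit C)) = f \<cdot> RUnit C X"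
    and sym_hom: "\<lbrakk>X \<in> Ob C; Y \<in> Ob C\<rbrakk> \<Longrightarrow> Sym C X Y \<in> Hom C (X \<boxtimes> Y) (Y \<boxtimes> X)"
    and sym_natural: "\<lbrakk>f \<in> Hom C X X'; g \<in> Hom C Y Y'\<rbrakk>
        \<Longrightarrow> Sym C X' Y' \<cdot> (f \<otimes> g) = (g \<otimes> f) \<cdot> Sym C X Y"
    and sym_sym: "\<lbrakk>X \<in> Ob C; Y \<in> Ob C\<rbrakk> \<Longrightarrow> Sym C Y X \<cdot> Sym C X Y = Ident C (X \<boxtimes> Y)"
    and pentagon: "\<lbrakk>W \<in> Ob C; X \<in> Ob C; Y \<in> Ob C; Z \<in> Ob C\<rbrakk>
        \<Longrightarrow> Assoc C W X (Y \<boxtimes> Z) \<cdot> Assoc C (W \<boxtimes> X) Y Z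
          = (Ident C W \<otimes> Assoc C X Y Z) \<cdot> Assoc C W (X \<boxtimes> Y) Z \<cdot> (Assoc C W X Y \<otimes> Ident C Z)"
    and triangle: "\<lbrakk>X \<in> Ob C; Y \<in> Ob C\<rbrakk>
        \<Longrightarrow> (Ident C X \<otimes> LUnit C Y) \<cdot> Assoc C X (TUnit C) Y = RUnit C X \<otimes> Ident C Y"
    and hexagon: "\<lbrakk>X \<in> Ob C; Y \<in> Ob C; Z \<in> Ob C\<rbrakk>
        \<Longrightarrow> Assoc C Y Z X \<cdot> Sym C X (Y \<boxtimes> Z) \<cdot> Assoc C X Y Z
          = (Ident C Y \<otimes> Sym C X Z) \<cdot> Assoc C Y X Z \<cdot> (Sym C X Y \<otimes> Ident C Z)"

definition strict_symmetric_monoidal_func ::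
    "('o, 'm, 'x) moncat_scheme \<Rightarrow> ('p, 'n, 'y) moncat_scheme \<Rightarrow> ('o, 'm, 'p, 'n) func \<Rightarrow> bool" where
  "strict_symmetric_monoidal_func C D F \<longleftrightarrow>
     is_functor C D F \<and>
     (\<forall>X \<in> Ob C. \<forall>Y \<in> Ob C. FOb F (X \<boxtimes>\<^bsub>C\<^esub> Y) = FOb F X \<boxtimes>\<^bsub>D\<^esub> FOb F Y) \<and>
     (\<forall>f \<in> Arr C. \<forall>g \<in> Arr C. FArr F (f \<otimes>\<^bsub>C\<^esub> g) = FArr F f \<otimes>\<^bsub>D\<^esub> FArr F g) \<and>
     FOb F (TUnit C) = TUnit D \<and>
     (\<forall>X \<in> Ob C. \<forall>Y \<in> Ob C. \<forall>Z \<in> Ob C.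
        FArr F (Assoc C X Y Z) = Assoc D (FOb F X) (FOb F Y) (FOb F Z)) \<and>
     (\<forall>X \<in> Ob C. FArr F (LUnit C X) = LUnit D (FOb F X)) \<and>
     (\<forall>X \<in> Ob C. FArr F (RUnit C X) = RUnit D (FOb F X)) \<and>
     (\<forall>X \<in> Ob C. \<forall>Y \<in> Ob C. FArr F (Sym C X Y) = Sym D (FOb F X) (FOb F Y))"


section \<open>The category of sets\<close>

text \<open>A type of the following class plays the role of the class of all sets: the objects of the
  category of sets are the small collections of elements of the type. For a Grothendieck universe
  (or a model of ZFC) take for the type its elements, for the small collections the extensions
  of its elements, for \<open>upair\<close> the usual ordered pair and for \<open>unil\<close> the empty set. Closure under
  power sets is not required, so that instances such as the countable sets are allowed too.\<close>

class set_universe =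
  fixes small :: "'a set \<Rightarrow> bool"
    and upair :: "'a \<Rightarrow> 'a \<Rightarrow> 'a"
    and unil :: "'a"
  assumes upair_inject: "upair a b = upair c d \<Longrightarrow> a = c \<and> b = d"
    and unil_upair: "unil \<noteq> upair a b"
    and small_subset: "\<lbrakk>small A; B \<subseteq> A\<rbrakk> \<Longrightarrow> small B"
    and small_image: "small A \<Longrightarrow> small (f ` A)"
    and small_UN: "\<lbrakk>small A; \<And>a. a \<in> A \<Longrightarrow> small (F a)\<rbrakk> \<Longrightarrow> small (\<Union>a\<in>A. F a)"
    and small_infinite: "\<exists>A. small A \<and> infinite A"

definition ufst :: "'u::set_universe \<Rightarrow> 'u" where
  "ufst z = (THE x. \<exists>y. z = upair x y)"

definition usnd :: "'u::set_universe \<Rightarrow> 'u" where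
  "usnd z = (THE y. \<exists>x. z = upair x y)"

fun utuple :: "'u::set_universe list \<Rightarrow> 'u" where
  "utuple [] = unil"
| "utuple (x # xs) = upair x (utuple xs)"

definition uprod :: "'u::set_universe set \<Rightarrow> 'u set \<Rightarrow> 'u set" where
  "uprod A B = {upair x y | x y. x \<in> A \<and> y \<in> B}"

definition utuples :: "'u::set_universe set list \<Rightarrow> 'u set" where
  "utuples As = {utuple xs | xs. list_all2 (\<in>) xs As}"

text \<open>Maps of sets are triples of domain, extensional function and codomain.\<close>

type_synonym 'u setmap = "'u set \<times> ('u \<Rightarrow> 'u) \<times> 'u set"

definition setmap :: "'u set \<Rightarrow> ('u \<Rightarrow> 'u) \<Rightarrow> 'u set \<Rightarrow> 'u setmap" where
  "setmap A f B = (A, restrict f A, B)"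

definition mapfun :: "'u setmap \<Rightarrow> 'u \<Rightarrow> 'u" where
  "mapfun = (\<lambda>(A, f, B). f)"

text \<open>The category of sets with its cartesian symmetric monoidal structure.\<close>

definition SetC :: "('u::set_universe set, 'u setmap) moncat" where
  "SetC =
    \<lparr>Ob = {A. small A},
     Arr = {(A, f, B). small A \<and> small B \<and> f \<in> A \<rightarrow>\<^sub>E B},
     Dom = (\<lambda>(A, f, B). A),
     Cod = (\<lambda>(A, f, B). B),
     Ident = (\<lambda>A. setmap A (\<lambda>x. x) A),
     Comp = (\<lambda>(B', g, C) (A, f, B). setmap A (\<lambda>x. g (f x)) C),
     TensOb = uprod,
     TensArr = (\<lambda>(A, f, A') (B, g, B').
        setmap (uprod A B) (\<lambda>z. upair (f (ufst z)) (g (usnd z))) (uprod A' B')),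
     TUnit = {unil},
     Assoc = (\<lambda>A B C. setmap (uprod (uprod A B) C)
        (\<lambda>z. upair (ufst (ufst z)) (upair (usnd (ufst z)) (usnd z))) (uprod A (uprod B C))),
     LUnit = (\<lambda>A. setmap (uprod {unil} A) usnd A),
     RUnit = (\<lambda>A. setmap (uprod A {unil}) ufst A),
     Sym = (\<lambda>A B. setmap (uprod A B) (\<lambda>z. upair (usnd z) (ufst z)) (uprod B A))\<rparr>"

definition uproj :: "'u::set_universe set list \<Rightarrow> nat \<Rightarrow> 'u setmap" where
  "uproj As i = setmap (utuples As) (\<lambda>z. inv utuple z ! i) (As ! i)"


section \<open>Finite products in a category over sets\<close>

text \<open>The categorical product of \<open>Xs\<close>, chosen so that its underlying set is the set of tuples
  and its projections lie over the projections of tuples. By amnesticity this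
  determines the product uniquely, and such a product exists in any topological category.\<close>

definition prod_ob ::
    "('v, 'm, 'x) cat_scheme \<Rightarrow> ('v, 'm, 'u::set_universe set, 'u setmap) func \<Rightarrow> 'v list \<Rightarrow> 'v" where
  "prod_ob V U Xs = (THE X. FOb U X = utuples (map (FOb U) Xs) \<and>
     (\<exists>\<pi>. is_product V Xs X \<pi> \<and>
        (\<forall>i < length Xs. FArr U (\<pi> i) = uproj (map (FOb U) Xs) i)))"

definition prod_proj ::
    "('v, 'm, 'x) cat_scheme \<Rightarrow> ('v, 'm, 'u::set_universe set, 'u setmap) func \<Rightarrow> 'v list \<Rightarrow>
     nat \<Rightarrow> 'm" where
  "prod_proj V U Xs i = (THE p. p \<in> Hom V (prod_ob V U Xs) (Xs ! i) \<and>
     FArr U p = uproj (map (FOb U) Xs) i)"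

definition prod_arr ::
    "('v, 'm, 'x) cat_scheme \<Rightarrow> ('v, 'm, 'u::set_universe set, 'u setmap) func \<Rightarrow> 'm list \<Rightarrow> 'm" where
  "prod_arr V U fs = (THE h.
     h \<in> Hom V (prod_ob V U (map (Dom V) fs)) (prod_ob V U (map (Cod V) fs)) \<and>
     (\<forall>i < length fs. prod_proj V U (map (Cod V) fs) i \<cdot>\<^bsub>V\<^esub> h
        = fs ! i \<cdot>\<^bsub>V\<^esub> prod_proj V U (map (Dom V) fs) i))"


section \<open>Enriched signatures and their algebras\<close>

record ('s, 'v, 'u) signature =
  Syms :: "'u set"
  Ins :: "'u \<Rightarrow> 's list"
  Out :: "'u \<Rightarrow> 's"
  Par :: "'u \<Rightarrow> 'v"

definition is_signature ::
    "('v, 'm, 'x) cat_scheme \<Rightarrow> 's set \<Rightarrow> ('s, 'v, 'u::set_universe) signature \<Rightarrow> bool" where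
  "is_signature V S Sg \<longleftrightarrow> small (Syms Sg) \<and>
     (\<forall>\<sigma> \<in> Syms Sg. set (Ins Sg \<sigma>) \<subseteq> S \<and> Out Sg \<sigma> \<in> S \<and> Par Sg \<sigma> \<in> Ob V)"

record ('s, 'v, 'm, 'u) algebra =
  Car :: "'s \<Rightarrow> 'v"
  Opn :: "'u \<Rightarrow> 'm"

definition op_dom ::
    "('v, 'm, 'x) moncat_scheme \<Rightarrow> ('v, 'm, 'u::set_universe set, 'u setmap) func \<Rightarrow>
     ('s, 'v, 'u) signature \<Rightarrow> ('s \<Rightarrow> 'v) \<Rightarrow> 'u \<Rightarrow> 'v" where
  "op_dom V U Sg B \<sigma> = Par Sg \<sigma> \<boxtimes>\<^bsub>V\<^esub> prod_ob V U (map B (Ins Sg \<sigma>))"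

definition is_algebra ::
    "('v, 'm, 'x) moncat_scheme \<Rightarrow> ('v, 'm, 'u::set_universe set, 'u setmap) func \<Rightarrow> 's set \<Rightarrow>
     ('s, 'v, 'u) signature \<Rightarrow> ('s, 'v, 'm, 'u) algebra \<Rightarrow> bool" where
  "is_algebra V U S Sg A \<longleftrightarrow> Car A \<in> Ob (power_cat S V) \<and>
     Opn A \<in> (\<Pi>\<^sub>E \<sigma>\<in>Syms Sg. Hom V (op_dom V U Sg (Car A) \<sigma>) (Car A (Out Sg \<sigma>)))"

definition is_algebra_hom ::
    "('v, 'm, 'x) moncat_scheme \<Rightarrow> ('v, 'm, 'u::set_universe set, 'u setmap) func \<Rightarrow> 's set \<Rightarrow>
     ('s, 'v, 'u) signature \<Rightarrow> ('s, 'v, 'm, 'u) algebra \<Rightarrow> ('s \<Rightarrow> 'm) \<Rightarrow>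
     ('s, 'v, 'm, 'u) algebra \<Rightarrow> bool" where
  "is_algebra_hom V U S Sg A f B \<longleftrightarrow>
     f \<in> Hom (power_cat S V) (Car A) (Car B) \<and>
     (\<forall>\<sigma> \<in> Syms Sg. f (Out Sg \<sigma>) \<cdot>\<^bsub>V\<^esub> Opn A \<sigma>
        = Opn B \<sigma> \<cdot>\<^bsub>V\<^esub> (Ident V (Par Sg \<sigma>) \<otimes>\<^bsub>V\<^esub> prod_arr V U (map f (Ins Sg \<sigma>))))"

type_synonym ('s, 'v, 'm, 'u) algebra_arr =
  "('s, 'v, 'm, 'u) algebra \<times> ('s \<Rightarrow> 'm) \<times> ('s, 'v, 'm, 'u) algebra"

definition alg_cat ::
    "('v, 'm, 'x) moncat_scheme \<Rightarrow> ('v, 'm, 'u::set_universe set, 'u setmap) func \<Rightarrow> 's set \<Rightarrow>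
     ('s, 'v, 'u) signature \<Rightarrow> (('s, 'v, 'm, 'u) algebra, ('s, 'v, 'm, 'u) algebra_arr) cat" where
  "alg_cat V U S Sg =
    \<lparr>Ob = {A. is_algebra V U S Sg A},
     Arr = {(A, f, B). is_algebra V U S Sg A \<and> is_algebra V U S Sg B \<and> is_algebra_hom V U S Sg A f B},
     Dom = (\<lambda>(A, f, B). A),
     Cod = (\<lambda>(A, f, B). B),
     Ident = (\<lambda>A. (A, Ident (power_cat S V) (Car A), A)),
     Comp = (\<lambda>(B', g, C) (A, f, B). (A, g \<cdot>\<^bsub>power_cat S V\<^esub> f, C))\<rparr>"

definition alg_forget ::
    "(('s, 'v, 'm, 'u) algebra, ('s, 'v, 'm, 'u) algebra_arr, 's \<Rightarrow> 'v, 's \<Rightarrow> 'm) func" where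
  "alg_forget = \<lparr>FOb = Car, FArr = (\<lambda>(A, f, B). f)\<rparr>"


section \<open>The underlying classical signature and classical free algebras\<close>

text \<open>Classical signatures and algebras are enriched ones over \<^term>\<open>SetC\<close> (with
  \<^term>\<open>id_func\<close> as underlying-set functor) all of whose parameters are the one-point set
  \<^term>\<open>{unil}\<close>. The operation symbol \<open>\<sigma>\<^sub>p\<close> is the pair of \<open>\<sigma>\<close> and \<open>p\<close>.\<close>

definition und_sig ::
    "('v, 'm, 'u::set_universe set, 'u setmap) func \<Rightarrow> ('s, 'v, 'u) signature \<Rightarrow>
     ('s, 'u set, 'u) signature" where
  "und_sig U Sg =
    \<lparr>Syms = {upair \<sigma> p | \<sigma> p. \<sigma> \<in> Syms Sg \<and> p \<in> FOb U (Par Sg \<sigma>)},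
     Ins = (\<lambda>\<tau>. Ins Sg (ufst \<tau>)), Out = (\<lambda>\<tau>. Out Sg (ufst \<tau>)), Par = (\<lambda>\<tau>. {unil})\<rparr>"

abbreviation classical_alg_cat ::
    "'s set \<Rightarrow> ('s, 'u::set_universe set, 'u) signature \<Rightarrow>
     (('s, 'u set, 'u setmap, 'u) algebra, ('s, 'u set, 'u setmap, 'u) algebra_arr) cat" where
  "classical_alg_cat S Sg \<equiv> alg_cat SetC id_func S Sg"

definition und_alg ::
    "('v, 'm, 'u::set_universe set, 'u setmap) func \<Rightarrow> 's set \<Rightarrow> ('s, 'v, 'u) signature \<Rightarrow>
     ('s, 'v, 'm, 'u) algebra \<Rightarrow> ('s, 'u set, 'u setmap, 'u) algebra" where
  "und_alg U S Sg A =
    \<lparr>Car = FOb (power_func S U) (Car A),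
     Opn = (\<lambda>\<tau>\<in>Syms (und_sig U Sg).
        setmap (uprod {unil} (utuples (map (\<lambda>s. FOb U (Car A s)) (Ins Sg (ufst \<tau>)))))
          (\<lambda>z. mapfun (FArr U (Opn A (ufst \<tau>))) (upair (usnd \<tau>) (usnd z)))
          (FOb U (Car A (Out Sg (ufst \<tau>)))))\<rparr>"

definition und_alg_func ::
    "('v, 'm, 'u::set_universe set, 'u setmap) func \<Rightarrow> 's set \<Rightarrow> ('s, 'v, 'u) signature \<Rightarrow>
     (('s, 'v, 'm, 'u) algebra, ('s, 'v, 'm, 'u) algebra_arr,
      ('s, 'u set, 'u setmap, 'u) algebra, ('s, 'u set, 'u setmap, 'u) algebra_arr) func" where
  "und_alg_func U S Sg =
    \<lparr>FOb = und_alg U S Sg,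
     FArr = (\<lambda>(A, f, B). (und_alg U S Sg A, FArr (power_func S U) f, und_alg U S Sg B))\<rparr>"

text \<open>Terms are coded as elements of the universe: constants \<open>x\<close> from \<open>Y\<close> as \<open>tvar x\<close>, which
  keeps them apart from compound terms.\<close>

definition tvar :: "'u::set_universe \<Rightarrow> 'u" where
  "tvar x = upair unil x"

definition tapp :: "'u::set_universe \<Rightarrow> 'u \<Rightarrow> 'u" where
  "tapp \<tau> t = upair \<tau> t"

inductive is_term ::
    "('s, 'u::set_universe set, 'u) signature \<Rightarrow> ('s \<Rightarrow> 'u set) \<Rightarrow> 's \<Rightarrow> 'u \<Rightarrow> bool"
  for Sg Y where
  var: "x \<in> Y s \<Longrightarrow> is_term Sg Y s (tvar x)"
| app: "\<lbrakk>\<tau> \<in> Syms Sg; list_all2 (is_term Sg Y) (Ins Sg \<tau>) ts\<rbrakk>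
        \<Longrightarrow> is_term Sg Y (Out Sg \<tau>) (tapp \<tau> (utuple ts))"

definition Terms ::
    "'s set \<Rightarrow> ('s, 'u::set_universe set, 'u) signature \<Rightarrow> ('s \<Rightarrow> 'u set) \<Rightarrow> 's \<Rightarrow> 'u set" where
  "Terms S Sg Y = (\<lambda>s\<in>S. {t. is_term Sg Y s t})"

definition term_alg ::
    "'s set \<Rightarrow> ('s, 'u::set_universe set, 'u) signature \<Rightarrow> ('s \<Rightarrow> 'u set) \<Rightarrow>
     ('s, 'u set, 'u setmap, 'u) algebra" where
  "term_alg S Sg Y =
    \<lparr>Car = Terms S Sg Y,
     Opn = (\<lambda>\<tau>\<in>Syms Sg. setmap (uprod {unil} (utuples (map (Terms S Sg Y) (Ins Sg \<tau>))))
        (\<lambda>z. tapp \<tau> (usnd z)) (Terms S Sg Y (Out Sg \<tau>)))\<rparr>"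

definition term_incl ::
    "'s set \<Rightarrow> ('s, 'u::set_universe set, 'u) signature \<Rightarrow> ('s \<Rightarrow> 'u set) \<Rightarrow> 's \<Rightarrow> 'u setmap" where
  "term_incl S Sg Y = (\<lambda>s\<in>S. setmap (Y s) tvar (Terms S Sg Y s))"

definition term_func ::
    "'s set \<Rightarrow> ('s, 'u::set_universe set, 'u) signature \<Rightarrow>
     ('s \<Rightarrow> 'u set, 's \<Rightarrow> 'u setmap,
      ('s, 'u set, 'u setmap, 'u) algebra, ('s, 'u set, 'u setmap, 'u) algebra_arr) func" where
  "term_func S Sg =
    \<lparr>FOb = term_alg S Sg,
     FArr = (\<lambda>g. THE h.
        h \<in> Hom (classical_alg_cat S Sg)
              (term_alg S Sg (Dom (power_cat S SetC) g)) (term_alg S Sg (Cod (power_cat S SetC) g)) \<and>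
        FArr alg_forget h \<cdot>\<^bsub>power_cat S SetC\<^esub> term_incl S Sg (Dom (power_cat S SetC) g)
          = term_incl S Sg (Cod (power_cat S SetC) g) \<cdot>\<^bsub>power_cat S SetC\<^esub> g)\<rparr>"


section \<open>Free enriched algebras\<close>

definition is_free_adjunction ::
    "('v, 'm, 'x) moncat_scheme \<Rightarrow> ('v, 'm, 'u::set_universe set, 'u setmap) func \<Rightarrow> 's set \<Rightarrow>
     ('s, 'v, 'u) signature \<Rightarrow>
     ('s \<Rightarrow> 'v, 's \<Rightarrow> 'm, ('s, 'v, 'm, 'u) algebra, ('s, 'v, 'm, 'u) algebra_arr) func \<Rightarrow>
     (('s \<Rightarrow> 'v) \<Rightarrow> ('s \<Rightarrow> 'm)) \<Rightarrow> bool" where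
  "is_free_adjunction V U S Sg F \<eta> \<longleftrightarrow>
     left_adjoint (power_cat S V) (alg_cat V U S Sg) F alg_forget \<eta> \<and>
     strictly_lifts (power_cat S V) (alg_cat V U S Sg) (power_func S U) (und_alg_func U S Sg)
       F alg_forget \<eta>
       (term_func S (und_sig U Sg)) alg_forget (term_incl S (und_sig U Sg))"

text \<open>Amnesticity makes the choice unique on objects.\<close>

definition free_func ::
    "('v, 'm, 'x) moncat_scheme \<Rightarrow> ('v, 'm, 'u::set_universe set, 'u setmap) func \<Rightarrow> 's set \<Rightarrow>
     ('s, 'v, 'u) signature \<Rightarrow>
     ('s \<Rightarrow> 'v, 's \<Rightarrow> 'm, ('s, 'v, 'm, 'u) algebra, ('s, 'v, 'm, 'u) algebra_arr) func" where
  "free_func V U S Sg = (SOME F. \<exists>\<eta>. is_free_adjunction V U S Sg F \<eta>)"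


section \<open>Compatibility\<close>

definition Term_Fib ::
    "('v, 'm, 'x) moncat_scheme \<Rightarrow> ('v, 'm, 'u::set_universe set, 'u setmap) func \<Rightarrow> 's set \<Rightarrow>
     ('s, 'v, 'u) signature \<Rightarrow> ('s \<Rightarrow> 'v) \<Rightarrow> ('s \<Rightarrow> 'v) gorder" where
  "Term_Fib V U S Sg X =
     Fib (power_cat S V) (power_cat S SetC) (power_func S U)
       (Terms S (und_sig U Sg) (FOb (power_func S U) X))"

definition op_hat ::
    "('v, 'm, 'u::set_universe set, 'u setmap) func \<Rightarrow> 's set \<Rightarrow> ('s, 'v, 'u) signature \<Rightarrow>
     ('s \<Rightarrow> 'u set) \<Rightarrow> 'u \<Rightarrow> 'u setmap" where
  "op_hat U S Sg Y \<sigma> =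
     (let T = Terms S (und_sig U Sg) Y
      in setmap (uprod (FOb U (Par Sg \<sigma>)) (utuples (map T (Ins Sg \<sigma>))))
           (\<lambda>z. tapp (upair \<sigma> (ufst z)) (usnd z)) (T (Out Sg \<sigma>)))"

definition compatible ::
    "('v, 'm, 'x) moncat_scheme \<Rightarrow> ('v, 'm, 'u::set_universe set, 'u setmap) func \<Rightarrow> 's set \<Rightarrow>
     ('s, 'v, 'u) signature \<Rightarrow> ('s \<Rightarrow> 'v) \<Rightarrow> ('s \<Rightarrow> 'v) \<Rightarrow> bool" where
  "compatible V U S Sg X B \<longleftrightarrow>
     B \<in> carrier (Term_Fib V U S Sg X) \<and>
     admissible (power_cat S V) (power_func S U) X B
       (term_incl S (und_sig U Sg) (FOb (power_func S U) X)) \<and>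
     (\<forall>\<sigma> \<in> Syms Sg. admissible V U (op_dom V U Sg B \<sigma>) (B (Out Sg \<sigma>))
        (op_hat U S Sg (FOb (power_func S U) X) \<sigma>))"

end

(*
  An algebra on the set of terms whose operations are the term-forming ones is the same thing
  as an object B of the fibre satisfying condition (2) of compatibility, and condition (1) turns
  the inclusion of variables into a morphism X -> B. Hence the carrier of the free algebra is
  compatible, and the universal property gives, for each compatible B, a homomorphism from the
  free algebra to B extending the inclusion; its underlying map is the identity because terms
  form the free classical algebra. So the free carrier is the least compatible object.

  Since free_func is a choice, a strictly lifted adjunction has to be shown to exist. All maps
  "evaluate terms in A along f : X -> A" form a large structured source on the set of terms;
  its initial lift is compatible with X, and the resulting algebra is free.
*)

theory Submission
  imports Defs
begin

section \<open>Small sets and coded tuples\<close>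

text \<open>The source of evaluations has legs for every algebra and every map from \<open>X\<close>
  into it, so nothing bounds its size. Its lift is compatible with \<open>X\<close> for one reason:
  forming a compound term and evaluating it in \<open>A\<close> has the same result as evaluating
  the arguments and applying the operation of \<open>A\<close>, and the second way is a composite of
  arrows of \<open>V\<close>. Initiality then makes term formation itself admissible. Equations
  between arrows are checked on elements, because \<open>U\<close> is faithful and maps of sets are
  extensional. For this, the products and product arrows, which are given by definite descriptions,
  have to be shown to act on tuples as expected. The classical side gets no theory of its own: sets
  over themselves are an instance of the enriched setting, so one set of facts on homomorphisms
  serves \<open>V\<close> and \<open>SetC\<close>. Terms are coded inside the universe, so recursion
  over them and the smallness of the sets of terms need arguments of their own.\<close>

lemma upair_eq_iff [simp]: "upair a b = upair c d \<longleftrightarrow> a = c \<and> b = d"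
  using upair_inject by blast

lemma upair_neq_unil [simp]: "unil \<noteq> upair a b" "upair a b \<noteq> unil"
  using unil_upair by metis+

lemma ufst_upair [simp]: "ufst (upair a b) = a"
  by (auto simp: ufst_def)

lemma usnd_upair [simp]: "usnd (upair a b) = b"
  by (auto simp: usnd_def)

lemma utuple_eq_iff [simp]: "utuple xs = utuple ys \<longleftrightarrow> xs = ys"
proof (induction xs arbitrary: ys)
  case Nil
  then show ?case by (cases ys) auto
next
  case (Cons x xs)
  then show ?case by (cases ys) auto
qed

lemma inv_utuple [simp]: "inv utuple (utuple xs) = xs"
  by (rule inv_f_f) (simp add: inj_def)

lemma upair_in_uprod [simp]: "upair x y \<in> uprod A B \<longleftrightarrow> x \<in> A \<and> y \<in> B"
  by (auto simp: uprod_def)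

lemma uprodE: "z \<in> uprod A B \<Longrightarrow> (\<And>x y. z = upair x y \<Longrightarrow> x \<in> A \<Longrightarrow> y \<in> B \<Longrightarrow> P) \<Longrightarrow> P"
  by (auto simp: uprod_def)

lemma utuple_in_utuples [simp]: "utuple xs \<in> utuples As \<longleftrightarrow> list_all2 (\<in>) xs As"
  by (auto simp: utuples_def)

lemma utuplesE: "z \<in> utuples As \<Longrightarrow> (\<And>xs. z = utuple xs \<Longrightarrow> list_all2 (\<in>) xs As \<Longrightarrow> P) \<Longrightarrow> P"
  by (auto simp: utuples_def)

lemma small_empty [simp]: "small {}"
  using small_infinite small_subset by blast

lemma small_singleton [simp]: "small {a}"
proof -
  obtain A :: "'a set" where A: "small A" "infinite A"
    using small_infinite by blast
  then have "(\<lambda>_. a) ` A = {a}" by (auto simp: image_constant_conv)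
  then show ?thesis using small_image[OF A(1)] by metis
qed

text \<open>\<open>small_UN\<close> takes its index set from the universe itself. An infinite small
  set contains a copy of the naturals, and this copy is small and can serve as index set. Binary
  unions and the stages of the construction of terms are unions of this kind.\<close>

lemma small_countable_UN:
  assumes "\<And>n::nat. small (F n)"
  shows "small (\<Union>n. F n)"
proof -
  obtain A :: "'a set" where A: "small A" "infinite A"
    using small_infinite by blast
  obtain e :: "nat \<Rightarrow> 'a" where e: "inj e" "range e \<subseteq> A"
    using A(2) infinite_countable_subset by blast
  have "(\<Union>n. F n) = (\<Union>a\<in>range e. F (inv e a))"
    using e(1) by auto
  moreover have "small (range e)"
    using A(1) e(2) small_subset by blast
  ultimately show ?thesis
    using small_UN[of "range e" "\<lambda>a. F (inv e a)"] assms by metis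
qed

lemma small_Un:
  assumes "small A" "small B"
  shows "small (A \<union> B)"
proof -
  have "small (\<Union>n::nat. if n = 0 then A else B)"
    by (rule small_countable_UN) (simp add: assms)
  moreover have "A \<union> B \<subseteq> (\<Union>n::nat. if n = 0 then A else B)"
    by (auto split: if_splits)
  ultimately show ?thesis
    using small_subset by blast
qed

lemma small_uprod:
  assumes "small A" "small B"
  shows "small (uprod A B)"
proof -
  have "uprod A B = (\<Union>a\<in>A. upair a ` B)"
    by (auto simp: uprod_def)
  then show ?thesis
    using assms small_UN small_image by metis
qed

lemma utuples_Nil [simp]: "utuples [] = {unil}"
  by (auto simp: utuples_def)

lemma utuples_Cons: "utuples (A # As) = uprod A (utuples As)"
  by (force simp: utuples_def uprod_def list_all2_Cons2)

lemma small_utuples: "(\<And>A. A \<in> set As \<Longrightarrow> small A) \<Longrightarrow> small (utuples As)"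
  by (induction As) (auto simp: utuples_Cons small_uprod)


section \<open>The category of sets, elementwise\<close>

lemma HomD:
  assumes "f \<in> Hom C X Y"
  shows "f \<in> Arr C" "Dom C f = X" "Cod C f = Y"
  using assms by (auto simp: Hom_def)

lemma Hom_SetC_iff:
  "f \<in> Hom SetC A B \<longleftrightarrow> small A \<and> small B \<and> (\<exists>g \<in> A \<rightarrow>\<^sub>E B. f = (A, g, B))"
  by (auto simp: Hom_def SetC_def)

lemma Ob_SetC [simp]: "A \<in> Ob SetC \<longleftrightarrow> small A"
  by (simp add: SetC_def)

lemma setmap_in_Hom:
  "\<lbrakk>small A; small B; \<And>x. x \<in> A \<Longrightarrow> f x \<in> B\<rbrakk> \<Longrightarrow> setmap A f B \<in> Hom SetC A B"
  by (auto simp: Hom_SetC_iff setmap_def)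

lemma mapfun_setmap [simp]: "x \<in> A \<Longrightarrow> mapfun (setmap A f B) x = f x"
  by (simp add: mapfun_def setmap_def)

lemma mapfun_in: "\<lbrakk>f \<in> Hom SetC A B; x \<in> A\<rbrakk> \<Longrightarrow> mapfun f x \<in> B"
  by (auto simp: Hom_SetC_iff mapfun_def)

text \<open>A map is stored with its domain, its codomain and an extensional function, so parallel
  maps can differ only at elements of the domain.\<close>

lemma Hom_SetC_eqI:
  "\<lbrakk>f \<in> Hom SetC A B; g \<in> Hom SetC A B; \<And>x. x \<in> A \<Longrightarrow> mapfun f x = mapfun g x\<rbrakk> \<Longrightarrow> f = g"
  by (auto simp: Hom_SetC_iff mapfun_def intro: PiE_ext)

lemma Comp_SetC [simp]: "(B', g, C) \<cdot>\<^bsub>SetC\<^esub> (A, f, B) = setmap A (\<lambda>x. g (f x)) C"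
  by (simp add: SetC_def)

lemma TensArr_SetC [simp]:
  "(A, f, A') \<otimes>\<^bsub>SetC\<^esub> (B, g, B')
    = setmap (uprod A B) (\<lambda>z. upair (f (ufst z)) (g (usnd z))) (uprod A' B')"
  by (simp add: SetC_def)

lemma mapfun_Comp [simp]:
  "\<lbrakk>f \<in> Hom SetC A B; x \<in> A\<rbrakk> \<Longrightarrow> mapfun (g \<cdot>\<^bsub>SetC\<^esub> f) x = mapfun g (mapfun f x)"
  by (cases g) (auto simp: Hom_SetC_iff mapfun_def setmap_def)

lemma mapfun_Ident [simp]: "x \<in> A \<Longrightarrow> mapfun (Ident SetC A) x = x"
  by (simp add: SetC_def)

lemma TensOb_SetC [simp]: "A \<boxtimes>\<^bsub>SetC\<^esub> B = uprod A B"
  by (simp add: SetC_def)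

lemma mapfun_TensArr [simp]:
  "\<lbrakk>f \<in> Hom SetC A A'; g \<in> Hom SetC B B'; x \<in> A; y \<in> B\<rbrakk>
    \<Longrightarrow> mapfun (f \<otimes>\<^bsub>SetC\<^esub> g) (upair x y) = upair (mapfun f x) (mapfun g y)"
  by (auto simp: Hom_SetC_iff mapfun_def setmap_def)

lemma TensArr_SetC_in_Hom:
  assumes "f \<in> Hom SetC A A'" "g \<in> Hom SetC B B'"
  shows "f \<otimes>\<^bsub>SetC\<^esub> g \<in> Hom SetC (uprod A B) (uprod A' B')"
proof -
  obtain f' g' where "f = (A, f', A')" "g = (B, g', B')" "f' \<in> A \<rightarrow> A'" "g' \<in> B \<rightarrow> B'"
      "small A" "small A'" "small B" "small B'"
    using assms by (auto simp: Hom_SetC_iff)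
  then show ?thesis
    by (auto intro!: setmap_in_Hom small_uprod elim!: uprodE)
qed

lemma category_SetC: "category SetC"
proof
  fix f :: "'a setmap" assume "f \<in> Arr SetC"
  then show "Dom SetC f \<in> Ob SetC" "Cod SetC f \<in> Ob SetC"
    by (auto simp: SetC_def)
next
  fix A :: "'a set" assume "A \<in> Ob SetC"
  then show "Ident SetC A \<in> Hom SetC A A"
    by (auto simp: SetC_def setmap_def Hom_def)
next
  fix A B C :: "'a set" and f g
  assume "f \<in> Hom SetC A B" "g \<in> Hom SetC B C"
  then show "g \<cdot>\<^bsub>SetC\<^esub> f \<in> Hom SetC A C"
    by (auto simp: SetC_def setmap_def Hom_def)
next
  fix A B :: "'a set" and f
  assume "f \<in> Hom SetC A B"
  then show "f \<cdot>\<^bsub>SetC\<^esub> Ident SetC A = f" "Ident SetC B \<cdot>\<^bsub>SetC\<^esub> f = f"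
    by (auto simp: SetC_def setmap_def Hom_def fun_eq_iff PiE_def extensional_def Pi_def restrict_def)
next
  fix A B C D :: "'a set" and f g h
  assume "f \<in> Hom SetC A B" "g \<in> Hom SetC B C" "h \<in> Hom SetC C D"
  then show "(h \<cdot>\<^bsub>SetC\<^esub> g) \<cdot>\<^bsub>SetC\<^esub> f = h \<cdot>\<^bsub>SetC\<^esub> g \<cdot>\<^bsub>SetC\<^esub> f"
    by (auto simp: SetC_def setmap_def Hom_def fun_eq_iff PiE_def extensional_def Pi_def restrict_def)
qed

lemma uproj_in_Hom:
  assumes "\<And>A. A \<in> set As \<Longrightarrow> small A" "i < length As"
  shows "uproj As i \<in> Hom SetC (utuples As) (As ! i)"
  unfolding uproj_def
  by (rule setmap_in_Hom) (use assms in \<open>auto simp: small_utuples list_all2_conv_all_nth elim!: utuplesE\<close>)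

lemma mapfun_uproj [simp]: "list_all2 (\<in>) xs As \<Longrightarrow> mapfun (uproj As i) (utuple xs) = xs ! i"
  by (simp add: uproj_def)

text \<open>Phrased through \<open>uproj\<close> so that it applies to values of arrows into a
  product of which only the composites with the projections are known.\<close>

lemma utuples_eqI:
  assumes "z \<in> utuples As" "z' \<in> utuples As"
    and "\<And>i. i < length As \<Longrightarrow> mapfun (uproj As i) z = mapfun (uproj As i) z'"
  shows "z = z'"
  using assms by (auto elim!: utuplesE simp: list_all2_conv_all_nth intro!: nth_equalityI)


section \<open>Powers of categories\<close>

lemma Ob_power_cat: "X \<in> Ob (power_cat S C) \<longleftrightarrow> X \<in> extensional S \<and> (\<forall>s\<in>S. X s \<in> Ob C)"
  by (auto simp: power_cat_def PiE_iff)

text \<open>\<open>Dom\<close> and \<open>Cod\<close> of a family are restricted to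
  \<open>S\<close>, so only extensional families can be the ends of an arrow. This is what the two
  assumptions account for.\<close>

lemma Hom_power_cat:
  assumes "X \<in> extensional S" "Y \<in> extensional S"
  shows "f \<in> Hom (power_cat S C) X Y \<longleftrightarrow> f \<in> extensional S \<and> (\<forall>s\<in>S. f s \<in> Hom C (X s) (Y s))"
  using assms by (auto simp: power_cat_def PiE_iff Hom_def intro!: extensionalityI[of _ S])

lemma Comp_power_cat [simp]: "s \<in> S \<Longrightarrow> (g \<cdot>\<^bsub>power_cat S C\<^esub> f) s = g s \<cdot>\<^bsub>C\<^esub> f s"
  and Comp_power_cat_extensional [simp]: "g \<cdot>\<^bsub>power_cat S C\<^esub> f \<in> extensional S"
  and Ident_power_cat [simp]: "s \<in> S \<Longrightarrow> Ident (power_cat S C) X s = Ident C (X s)"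
  and Ident_power_cat_extensional [simp]: "Ident (power_cat S C) X \<in> extensional S"
  by (simp_all add: power_cat_def)

lemma power_func_simps [simp]:
  "s \<in> S \<Longrightarrow> FOb (power_func S F) X s = FOb F (X s)"
  "s \<in> S \<Longrightarrow> FArr (power_func S F) f s = FArr F (f s)"
  "FOb (power_func S F) X \<in> extensional S"
  "FArr (power_func S F) f \<in> extensional S"
  by (simp_all add: power_func_def)

lemma Hom_power_cat_extensional:
  "f \<in> Hom (power_cat S C) X Y \<Longrightarrow> f \<in> extensional S \<and> X \<in> extensional S \<and> Y \<in> extensional S"
  by (auto simp: power_cat_def Hom_def PiE_iff)

lemma Hom_power_catD:
  "\<lbrakk>f \<in> Hom (power_cat S C) X Y; s \<in> S\<rbrakk> \<Longrightarrow> f s \<in> Hom C (X s) (Y s)"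
  by (auto simp: power_cat_def Hom_def)

lemma category_power_cat:
  assumes "category C"
  shows "category (power_cat S C)"
proof -
  interpret category C by fact
  note [simp] = Hom_power_cat Ob_power_cat
  show ?thesis
  proof
    fix f assume "f \<in> Arr (power_cat S C)"
    then show "Dom (power_cat S C) f \<in> Ob (power_cat S C)" "Cod (power_cat S C) f \<in> Ob (power_cat S C)"
      by (auto simp: power_cat_def dom_ob cod_ob PiE_iff)
  next
    fix X assume "X \<in> Ob (power_cat S C)"
    then show "Ident (power_cat S C) X \<in> Hom (power_cat S C) X X"
      by (auto simp: ident_hom)
  next
    fix X Y Z f g
    assume "f \<in> Hom (power_cat S C) X Y" "g \<in> Hom (power_cat S C) Y Z"
    moreover from this have "X \<in> extensional S" "Y \<in> extensional S" "Z \<in> extensional S"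
      by (blast dest: Hom_power_cat_extensional)+
    ultimately show "g \<cdot>\<^bsub>power_cat S C\<^esub> f \<in> Hom (power_cat S C) X Z"
      by (auto intro: comp_hom)
  next
    fix X Y f
    assume f: "f \<in> Hom (power_cat S C) X Y"
    then have "f \<in> extensional S"
      by (blast dest: Hom_power_cat_extensional)
    with f show "f \<cdot>\<^bsub>power_cat S C\<^esub> Ident (power_cat S C) X = f"
        "Ident (power_cat S C) Y \<cdot>\<^bsub>power_cat S C\<^esub> f = f"
      by (auto intro!: extensionalityI[of _ S] dest: Hom_power_catD simp: comp_ident ident_comp)
  next
    fix W X Y Z f g h
    assume "f \<in> Hom (power_cat S C) W X" "g \<in> Hom (power_cat S C) X Y" "h \<in> Hom (power_cat S C) Y Z"
    then show "(h \<cdot>\<^bsub>power_cat S C\<^esub> g) \<cdot>\<^bsub>power_cat S C\<^esub> f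
        = h \<cdot>\<^bsub>power_cat S C\<^esub> g \<cdot>\<^bsub>power_cat S C\<^esub> f"
      by (auto intro!: extensionalityI[of _ S] comp_assoc dest: Hom_power_catD)
  qed
qed

text \<open>The ends of an arrow of a category are objects, which discharges the conditions on
  objects under which \<open>is_functor\<close> is stated.\<close>

lemma is_functorD:
  assumes "is_functor C D F"
  shows "X \<in> Ob C \<Longrightarrow> FOb F X \<in> Ob D"
    and "\<lbrakk>category C; f \<in> Hom C X Y\<rbrakk> \<Longrightarrow> FArr F f \<in> Hom D (FOb F X) (FOb F Y)"
    and "X \<in> Ob C \<Longrightarrow> FArr F (Ident C X) = Ident D (FOb F X)"
    and "\<lbrakk>category C; f \<in> Hom C X Y; g \<in> Hom C Y Z\<rbrakk>
      \<Longrightarrow> FArr F (g \<cdot>\<^bsub>C\<^esub> f) = FArr F g \<cdot>\<^bsub>D\<^esub> FArr F f"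
proof -
  have ob: "X \<in> Ob C \<and> Y \<in> Ob C" if "category C" "f \<in> Hom C X Y" for f X Y
    using that category.dom_ob category.cod_ob by (fastforce simp: Hom_def)
  show "X \<in> Ob C \<Longrightarrow> FOb F X \<in> Ob D" "X \<in> Ob C \<Longrightarrow> FArr F (Ident C X) = Ident D (FOb F X)"
    using assms by (auto simp: is_functor_def)
  show "\<lbrakk>category C; f \<in> Hom C X Y\<rbrakk> \<Longrightarrow> FArr F f \<in> Hom D (FOb F X) (FOb F Y)"
    using assms ob by (simp add: is_functor_def)
  show "\<lbrakk>category C; f \<in> Hom C X Y; g \<in> Hom C Y Z\<rbrakk>
      \<Longrightarrow> FArr F (g \<cdot>\<^bsub>C\<^esub> f) = FArr F g \<cdot>\<^bsub>D\<^esub> FArr F f"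
    using assms ob unfolding is_functor_def by metis
qed

lemma (in category) Hom_ob:
  assumes "f \<in> Hom C X Y"
  shows "X \<in> Ob C" "Y \<in> Ob C"
  using assms dom_ob cod_ob by (auto simp: Hom_def)


section \<open>Adjunctions from universal arrows\<close>

text \<open>On arrows, the value at \<open>f\<close> is forced to be the unique \<open>h\<close>
  with \<open>FArr G h\<close> after \<open>\<eta>\<close> equal to \<open>\<eta>\<close> after
  \<open>f\<close>, and functoriality follows from this uniqueness. The object part
  \<open>Fo\<close> is kept literally, since strict lifting later asks for equality of objects, not
  for isomorphism.\<close>

lemma left_adjoint_from_universal:
  assumes C: "category C" and D: "category D" and G: "is_functor D C G"
    and Fo: "\<And>X. X \<in> Ob C \<Longrightarrow> Fo X \<in> Ob D"
    and unit: "\<And>X. X \<in> Ob C \<Longrightarrow> \<eta> X \<in> Hom C X (FOb G (Fo X))"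
    and universal: "\<And>X A f. \<lbrakk>X \<in> Ob C; A \<in> Ob D; f \<in> Hom C X (FOb G A)\<rbrakk>
      \<Longrightarrow> \<exists>!h. h \<in> Hom D (Fo X) A \<and> FArr G h \<cdot>\<^bsub>C\<^esub> \<eta> X = f"
  shows "\<exists>F. FOb F = Fo \<and> left_adjoint C D F G \<eta>"
proof -
  interpret C: category C by fact
  interpret D: category D by fact
  define Fa where "Fa f = (THE h. h \<in> Hom D (Fo (Dom C f)) (Fo (Cod C f)) \<and>
      FArr G h \<cdot>\<^bsub>C\<^esub> \<eta> (Dom C f) = \<eta> (Cod C f) \<cdot>\<^bsub>C\<^esub> f)" for f
  define F where "F = \<lparr>FOb = Fo, FArr = Fa\<rparr>"
  have ex1: "\<exists>!h. h \<in> Hom D (Fo X) (Fo Y) \<and> FArr G h \<cdot>\<^bsub>C\<^esub> \<eta> X = \<eta> Y \<cdot>\<^bsub>C\<^esub> f"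
    if "f \<in> Hom C X Y" for f X Y
    using that C.Hom_ob[OF that] by (intro universal Fo C.comp_hom[OF that unit]) auto
  have Fa: "Fa f \<in> Hom D (Fo X) (Fo Y)" "FArr G (Fa f) \<cdot>\<^bsub>C\<^esub> \<eta> X = \<eta> Y \<cdot>\<^bsub>C\<^esub> f"
    if "f \<in> Hom C X Y" for f X Y
    using theI'[OF ex1[OF that]] that by (auto simp: Fa_def Hom_def)
  \<comment> \<open>Preservation of identities and of composites both reduce to this: the expected
    arrow satisfies the equation that characterizes \<open>Fa\<close>.\<close>
  have Fa_eq: "Fa f = h"
    if "f \<in> Hom C X Y" "h \<in> Hom D (Fo X) (Fo Y)" "FArr G h \<cdot>\<^bsub>C\<^esub> \<eta> X = \<eta> Y \<cdot>\<^bsub>C\<^esub> f" for f h X Y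
    using ex1[OF that(1)] Fa[OF that(1)] that(2,3) by blast
  have "Fa (Ident C X) = Ident D (Fo X)" if "X \<in> Ob C" for X
  proof (rule Fa_eq)
    show "FArr G (Ident D (Fo X)) \<cdot>\<^bsub>C\<^esub> \<eta> X = \<eta> X \<cdot>\<^bsub>C\<^esub> Ident C X"
      using that unit[OF that] by (simp add: is_functorD[OF G] Fo C.comp_ident C.ident_comp)
  qed (use that in \<open>auto intro: C.ident_hom D.ident_hom Fo\<close>)
  moreover have "Fa (g \<cdot>\<^bsub>C\<^esub> f) = Fa g \<cdot>\<^bsub>D\<^esub> Fa f" if f: "f \<in> Hom C X Y" and g: "g \<in> Hom C Y Z" for f g X Y Z
  proof (rule Fa_eq)
    have X: "X \<in> Ob C" "Y \<in> Ob C" "Z \<in> Ob C"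
      using C.Hom_ob f g by blast+
    have Gf: "FArr G (Fa f) \<in> Hom C (FOb G (Fo X)) (FOb G (Fo Y))"
      and Gg: "FArr G (Fa g) \<in> Hom C (FOb G (Fo Y)) (FOb G (Fo Z))"
      using Fa(1)[OF f] Fa(1)[OF g] is_functorD(2)[OF G D] by blast+
    have "FArr G (Fa g \<cdot>\<^bsub>D\<^esub> Fa f) \<cdot>\<^bsub>C\<^esub> \<eta> X = FArr G (Fa g) \<cdot>\<^bsub>C\<^esub> FArr G (Fa f) \<cdot>\<^bsub>C\<^esub> \<eta> X"
      using is_functorD(4)[OF G D Fa(1)[OF f] Fa(1)[OF g]] C.comp_assoc[OF unit[OF X(1)] Gf Gg] by simp
    also have "\<dots> = (FArr G (Fa g) \<cdot>\<^bsub>C\<^esub> \<eta> Y) \<cdot>\<^bsub>C\<^esub> f"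
      using Fa(2)[OF f] C.comp_assoc[OF f unit[OF X(2)] Gg] by simp
    also have "\<dots> = \<eta> Z \<cdot>\<^bsub>C\<^esub> g \<cdot>\<^bsub>C\<^esub> f"
      using Fa(2)[OF g] C.comp_assoc[OF f g unit[OF X(3)]] by simp
    finally show "FArr G (Fa g \<cdot>\<^bsub>D\<^esub> Fa f) \<cdot>\<^bsub>C\<^esub> \<eta> X = \<eta> Z \<cdot>\<^bsub>C\<^esub> g \<cdot>\<^bsub>C\<^esub> f" .
  qed (use f g Fa(1) in \<open>auto intro: C.comp_hom D.comp_hom\<close>)
  ultimately have "is_functor C D F"
    using Fo Fa(1) by (auto simp: is_functor_def F_def)
  then have "left_adjoint C D F G \<eta>"
    unfolding left_adjoint_def using G unit Fa(2) universal by (simp add: F_def)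
  then show ?thesis
    by (intro exI[of _ F]) (simp add: F_def)
qed


section \<open>Topological categories over sets\<close>

locale topological_over_sets =
  fixes V :: "('v, 'm, 'x) cat_scheme"
    and U :: "('v, 'm, 'u::set_universe set, 'u setmap) func"
  assumes topological: "topological V SetC U"
begin

sublocale category V
  using topological by (simp add: topological_def concrete_def)

lemma is_functor: "is_functor V SetC U"
  using topological by (simp add: topological_def concrete_def)

abbreviation val :: "'m \<Rightarrow> 'u \<Rightarrow> 'u" where
  "val m \<equiv> mapfun (FArr U m)"

lemma U_hom: "m \<in> Hom V A B \<Longrightarrow> FArr U m \<in> Hom SetC (FOb U A) (FOb U B)"
  using is_functorD(2)[OF is_functor] category_axioms by blast

lemma small_U: "A \<in> Ob V \<Longrightarrow> small (FOb U A)"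
  using is_functorD(1)[OF is_functor] by simp

lemma val_in: "\<lbrakk>m \<in> Hom V A B; x \<in> FOb U A\<rbrakk> \<Longrightarrow> val m x \<in> FOb U B"
  using mapfun_in U_hom by blast

lemma val_comp: "\<lbrakk>m \<in> Hom V A B; n \<in> Hom V B C; x \<in> FOb U A\<rbrakk> \<Longrightarrow> val (n \<cdot>\<^bsub>V\<^esub> m) x = val n (val m x)"
  using is_functorD(4)[OF is_functor category_axioms] U_hom mapfun_Comp by metis

lemma val_ident: "\<lbrakk>A \<in> Ob V; x \<in> FOb U A\<rbrakk> \<Longrightarrow> val (Ident V A) x = x"
  using is_functorD(3)[OF is_functor] by simp

text \<open>Faithfulness of \<open>U\<close> combined with extensionality of maps. Through it,
  equations in \<open>V\<close> become equations between elements.\<close>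

lemma hom_eqI:
  assumes "m \<in> Hom V A B" "n \<in> Hom V A B" "\<And>x. x \<in> FOb U A \<Longrightarrow> val m x = val n x"
  shows "m = n"
proof -
  have "FArr U m = FArr U n"
    by (rule Hom_SetC_eqI[OF U_hom U_hom]) (use assms in auto)
  moreover have "faithful V U"
    using topological by (simp add: topological_def concrete_def)
  ultimately show ?thesis
    using assms(1,2) Hom_ob[OF assms(1)] unfolding faithful_def by blast
qed

text \<open>Amnesticity, freed from the order record \<open>Fib\<close>. It is what makes an object
  of \<open>V\<close> unique once its underlying set and a universal property are
  prescribed.\<close>

lemma fibre_antisym:
  assumes m: "m \<in> Hom V A B" "FArr U m = Ident SetC X" and n: "n \<in> Hom V B A" "FArr U n = Ident SetC X"
    and X: "FOb U A = X" "FOb U B = X"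
  shows "A = B"
proof -
  have "X \<in> Ob SetC"
    using is_functorD(1)[OF is_functor] Hom_ob(1)[OF m(1)] X by auto
  then interpret partial_order "Fib V SetC U X"
    using topological by (simp add: topological_def amnestic_def)
  show ?thesis
    by (rule le_antisym) (use assms Hom_ob in \<open>auto simp: Fib_def admissible_def\<close>)
qed

text \<open>Of the equivalence in \<open>initial\<close> this keeps the direction that produces
  arrows into the lift; the other one is composition with the legs. Admissibility of a composite is
  expressed by the values of a lifted arrow, so that no composites in \<open>SetC\<close> have to be
  formed when the lemma is applied.\<close>

lemma initial_lift_exists:
  assumes "small X" "\<And>W f. (W, f) \<in> G \<Longrightarrow> W \<in> Ob V \<and> f \<in> Hom SetC X (FOb U W)"
  obtains A where "A \<in> Ob V" "FOb U A = X"
    and "\<forall>(W, f) \<in> G. \<exists>m \<in> Hom V A W. FArr U m = f"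
    and "\<forall>Z \<in> Ob V. \<forall>f \<in> Hom SetC (FOb U Z) X.
      (\<forall>(W, g) \<in> G. \<exists>m \<in> Hom V Z W. \<forall>z \<in> FOb U Z. val m z = mapfun g (mapfun f z))
      \<longrightarrow> (\<exists>m \<in> Hom V Z A. FArr U m = f)"
proof -
  have G: "structured_source V SetC U X G"
    using assms by (auto simp: structured_source_def)
  then obtain A where A: "initial_lift V SetC U X G A"
    using topological assms(1) by (fastforce simp: topological_def)
  have "\<exists>m \<in> Hom V Z A. FArr U m = f"
    if Z: "Z \<in> Ob V" and f: "f \<in> Hom SetC (FOb U Z) X"
      and ex: "\<And>W g. (W, g) \<in> G \<Longrightarrow> \<exists>m \<in> Hom V Z W. \<forall>z \<in> FOb U Z. val m z = mapfun g (mapfun f z)"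
    for Z f
  proof -
    have "admissible V U Z W (g \<cdot>\<^bsub>SetC\<^esub> f)" if g: "(W, g) \<in> G" for W g
    proof -
      obtain m where m: "m \<in> Hom V Z W" "\<forall>z \<in> FOb U Z. val m z = mapfun g (mapfun f z)"
        using ex[OF g] by blast
      have "g \<cdot>\<^bsub>SetC\<^esub> f \<in> Hom SetC (FOb U Z) (FOb U W)"
        using category.comp_hom[OF category_SetC f] assms(2)[OF g] by blast
      then have "FArr U m = g \<cdot>\<^bsub>SetC\<^esub> f"
        by (rule Hom_SetC_eqI[OF U_hom[OF m(1)]]) (use m(2) f in simp)
      then show ?thesis
        using m(1) by (auto simp: admissible_def)
    qed
    then have "admissible V U Z A f"
      using A Z f by (auto simp: initial_lift_def initial_def)
    then show ?thesis
      by (simp add: admissible_def)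
  qed
  then have "\<forall>Z \<in> Ob V. \<forall>f \<in> Hom SetC (FOb U Z) X.
      (\<forall>(W, g) \<in> G. \<exists>m \<in> Hom V Z W. \<forall>z \<in> FOb U Z. val m z = mapfun g (mapfun f z))
      \<longrightarrow> (\<exists>m \<in> Hom V Z A. FArr U m = f)"
    by blast
  moreover have "A \<in> Ob V" "FOb U A = X" "\<forall>(W, f) \<in> G. \<exists>m \<in> Hom V A W. FArr U m = f"
    using A unfolding initial_lift_def admissible_def by simp_all
  ultimately show ?thesis
    using that by blast
qed

section \<open>Finite products and their arrows on tuples\<close>

text \<open>The product is the initial lift of the source of tuple projections: initiality supplies
  the mediating arrow, and uniqueness holds because a tuple is determined by its entries.\<close>

lemma product_exists:
  assumes Xs: "set Xs \<subseteq> Ob V"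
  shows "\<exists>A. FOb U A = utuples (map (FOb U) Xs) \<and>
    (\<exists>\<pi>. is_product V Xs A \<pi> \<and> (\<forall>i < length Xs. FArr U (\<pi> i) = uproj (map (FOb U) Xs) i))"
proof -
  let ?As = "map (FOb U) Xs"
  define G where "G = {(Xs ! i, uproj ?As i) | i. i < length Xs}"
  have Xi: "Xs ! i \<in> Ob V" if "i < length Xs" for i
    using Xs that by auto
  have small: "small B" if "B \<in> set ?As" for B
    using that Xs small_U by auto
  have proj: "uproj ?As i \<in> Hom SetC (utuples ?As) (FOb U (Xs ! i))" if "i < length Xs" for i
    using uproj_in_Hom[of ?As i] small that by simp
  have "small (utuples ?As)"
    using small small_utuples by blast
  moreover have "W \<in> Ob V \<and> f \<in> Hom SetC (utuples ?As) (FOb U W)" if "(W, f) \<in> G" for W f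
    using that proj Xi by (auto simp: G_def)
  ultimately obtain A where A: "A \<in> Ob V" "FOb U A = utuples ?As"
      "\<forall>(W, f) \<in> G. \<exists>m \<in> Hom V A W. FArr U m = f"
      "\<forall>Z \<in> Ob V. \<forall>f \<in> Hom SetC (FOb U Z) (utuples ?As).
        (\<forall>(W, g) \<in> G. \<exists>m \<in> Hom V Z W. \<forall>z \<in> FOb U Z. val m z = mapfun g (mapfun f z))
        \<longrightarrow> (\<exists>m \<in> Hom V Z A. FArr U m = f)"
    by (rule initial_lift_exists)
  have "\<exists>m \<in> Hom V A (Xs ! i). FArr U m = uproj ?As i" if "i < length Xs" for i
    using bspec[OF A(3), of "(Xs ! i, uproj ?As i)"] that by (auto simp: G_def)
  then obtain \<pi> where \<pi>: "\<And>i. i < length Xs \<Longrightarrow> \<pi> i \<in> Hom V A (Xs ! i)"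
      "\<And>i. i < length Xs \<Longrightarrow> FArr U (\<pi> i) = uproj ?As i"
    by metis
  have "\<exists>!h. h \<in> Hom V Z A \<and> (\<forall>i < length Xs. \<pi> i \<cdot>\<^bsub>V\<^esub> h = f i)"
    if Z: "Z \<in> Ob V" and f: "\<forall>i < length Xs. f i \<in> Hom V Z (Xs ! i)" for Z f
  proof -
    \<comment> \<open>The only function compatible with all projections: it collects the values of
      the given arrows in a tuple.\<close>
    define t where "t = (\<lambda>z. utuple (map (\<lambda>i. val (f i) z) [0..<length Xs]))"
    have t: "t z \<in> utuples ?As" if "z \<in> FOb U Z" for z
      using f that val_in unfolding t_def by (auto simp: list_all2_conv_all_nth)
    have "setmap (FOb U Z) t (utuples ?As) \<in> Hom SetC (FOb U Z) (utuples ?As)"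
      using t Z small_U \<open>small (utuples ?As)\<close> by (auto intro: setmap_in_Hom)
    moreover have "\<exists>m \<in> Hom V Z W. \<forall>z \<in> FOb U Z. val m z
        = mapfun g (mapfun (setmap (FOb U Z) t (utuples ?As)) z)"
      if g: "(W, g) \<in> G" for W g
    proof -
      obtain i where i: "i < length Xs" "W = Xs ! i" "g = uproj ?As i"
        using g by (auto simp: G_def)
      have "mapfun (uproj ?As i) (t z) = val (f i) z" if "z \<in> FOb U Z" for z
        using t[OF that] i unfolding t_def by simp
      then show ?thesis
        using i f by auto
    qed
    ultimately obtain h where h: "h \<in> Hom V Z A" "FArr U h = setmap (FOb U Z) t (utuples ?As)"
      using A(4) Z by blast
    have "\<pi> i \<cdot>\<^bsub>V\<^esub> h = f i" if i: "i < length Xs" for i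
    proof (rule hom_eqI)
      fix z assume z: "z \<in> FOb U Z"
      then show "val (\<pi> i \<cdot>\<^bsub>V\<^esub> h) z = val (f i) z"
        using t[OF z] i h \<pi> by (simp add: val_comp[OF h(1) \<pi>(1)[OF i]]) (simp add: t_def)
    qed (use i h \<pi> f in \<open>auto intro: comp_hom\<close>)
    moreover have "h' = h" if h': "h' \<in> Hom V Z A" "\<forall>i < length Xs. \<pi> i \<cdot>\<^bsub>V\<^esub> h' = f i" for h'
    proof (rule hom_eqI[OF h'(1) h(1)])
      fix z assume z: "z \<in> FOb U Z"
      show "val h' z = val h z"
      proof (rule utuples_eqI)
        show "val h' z \<in> utuples ?As" "val h z \<in> utuples ?As"
          using val_in h'(1) h(1) z A(2) by auto
        fix i assume "i < length ?As"
        then have i: "i < length Xs" by simp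
        then have "val (\<pi> i) (val h' z) = val (\<pi> i) (val h z)"
          using val_comp[OF h'(1) \<pi>(1)[OF i] z] val_comp[OF h(1) \<pi>(1)[OF i] z] h'(2)
            \<open>\<And>i. i < length Xs \<Longrightarrow> \<pi> i \<cdot>\<^bsub>V\<^esub> h = f i\<close>[OF i] by auto
        then show "mapfun (uproj ?As i) (val h' z) = mapfun (uproj ?As i) (val h z)"
          by (simp add: \<pi>(2)[OF i])
      qed
    qed
    ultimately show ?thesis
      using h(1) by blast
  qed
  then have "is_product V Xs A \<pi>"
    using A(1) \<pi>(1) by (simp add: is_product_def)
  then show ?thesis
    using A(2) \<pi>(2) by blast
qed

text \<open>The mediating arrow between two products that lie over the same tuple projections
  preserves every entry of a tuple, hence lies over the identity. Applied in both directions, it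
  puts each of the two objects below the other in the fibre.\<close>

lemma product_le:
  assumes A: "FOb U A = utuples (map (FOb U) Xs)" "is_product V Xs A \<pi>"
      "\<forall>i < length Xs. FArr U (\<pi> i) = uproj (map (FOb U) Xs) i"
    and B: "FOb U B = utuples (map (FOb U) Xs)" "is_product V Xs B \<rho>"
      "\<forall>i < length Xs. FArr U (\<rho> i) = uproj (map (FOb U) Xs) i"
  shows "\<exists>m \<in> Hom V A B. FArr U m = Ident SetC (FOb U A)"
proof -
  have hom: "\<pi> i \<in> Hom V A (Xs ! i)" "\<rho> i \<in> Hom V B (Xs ! i)" if "i < length Xs" for i
    using that A(2) B(2) by (auto simp: is_product_def)
  obtain m where m: "m \<in> Hom V A B" "\<forall>i < length Xs. \<rho> i \<cdot>\<^bsub>V\<^esub> m = \<pi> i"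
    using B(2) hom(1) A(2) unfolding is_product_def by metis
  have "A \<in> Ob V"
    using A(2) by (simp add: is_product_def)
  have "FArr U m = FArr U (Ident V A)"
  proof (rule Hom_SetC_eqI)
    show "FArr U m \<in> Hom SetC (FOb U A) (FOb U A)"
      using U_hom[OF m(1)] A(1) B(1) by simp
    show "FArr U (Ident V A) \<in> Hom SetC (FOb U A) (FOb U A)"
      using U_hom ident_hom \<open>A \<in> Ob V\<close> by blast
    fix z assume z: "z \<in> FOb U A"
    have "val m z = z"
    proof (rule utuples_eqI)
      show "val m z \<in> utuples (map (FOb U) Xs)" "z \<in> utuples (map (FOb U) Xs)"
        using val_in[OF m(1) z] z A(1) B(1) by auto
      fix i assume "i < length (map (FOb U) Xs)"
      then have i: "i < length Xs" by simp
      then have "val (\<rho> i) (val m z) = val (\<pi> i) z"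
        using val_comp[OF m(1) hom(2)[OF i] z] m(2) by auto
      then show "mapfun (uproj (map (FOb U) Xs) i) (val m z) = mapfun (uproj (map (FOb U) Xs) i) z"
        using A(3) B(3) i by simp
    qed
    then show "val m z = val (Ident V A) z"
      using z \<open>A \<in> Ob V\<close> by (simp add: val_ident)
  qed
  then show ?thesis
    using m(1) \<open>A \<in> Ob V\<close> is_functorD(3)[OF is_functor] by auto
qed

text \<open>Gives meaning to the \<open>THE\<close> in the definition: existence is an initial lift,
  uniqueness is amnesticity.\<close>

lemma prod_ob:
  assumes "set Xs \<subseteq> Ob V"
  shows "FOb U (prod_ob V U Xs) = utuples (map (FOb U) Xs) \<and>
    (\<exists>\<pi>. is_product V Xs (prod_ob V U Xs) \<pi> \<and>
      (\<forall>i < length Xs. FArr U (\<pi> i) = uproj (map (FOb U) Xs) i))"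
  unfolding prod_ob_def
proof (rule theI')
  show "\<exists>!A. FOb U A = utuples (map (FOb U) Xs) \<and>
    (\<exists>\<pi>. is_product V Xs A \<pi> \<and> (\<forall>i < length Xs. FArr U (\<pi> i) = uproj (map (FOb U) Xs) i))"
  proof (rule ex_ex1I)
    fix A B
    assume "FOb U A = utuples (map (FOb U) Xs) \<and>
        (\<exists>\<pi>. is_product V Xs A \<pi> \<and> (\<forall>i < length Xs. FArr U (\<pi> i) = uproj (map (FOb U) Xs) i))"
      and "FOb U B = utuples (map (FOb U) Xs) \<and>
        (\<exists>\<pi>. is_product V Xs B \<pi> \<and> (\<forall>i < length Xs. FArr U (\<pi> i) = uproj (map (FOb U) Xs) i))"
    moreover from this have "\<exists>m \<in> Hom V A B. FArr U m = Ident SetC (FOb U A)"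
        "\<exists>m \<in> Hom V B A. FArr U m = Ident SetC (FOb U B)"
      using product_le[of A Xs _ B] product_le[of B Xs _ A] by blast+
    ultimately show "A = B"
      using fibre_antisym by metis
  qed (rule product_exists[OF assms])
qed

lemma prod_ob_in_Ob: "set Xs \<subseteq> Ob V \<Longrightarrow> prod_ob V U Xs \<in> Ob V"
  using prod_ob by (fastforce simp: is_product_def)

lemma U_prod_ob: "set Xs \<subseteq> Ob V \<Longrightarrow> FOb U (prod_ob V U Xs) = utuples (map (FOb U) Xs)"
  using prod_ob by blast

lemma prod_proj:
  assumes Xs: "set Xs \<subseteq> Ob V" and i: "i < length Xs"
  shows "prod_proj V U Xs i \<in> Hom V (prod_ob V U Xs) (Xs ! i) \<and>
    FArr U (prod_proj V U Xs i) = uproj (map (FOb U) Xs) i"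
  unfolding prod_proj_def
proof (rule theI')
  obtain p where "p \<in> Hom V (prod_ob V U Xs) (Xs ! i)" "FArr U p = uproj (map (FOb U) Xs) i"
    using prod_ob[OF Xs] i by (auto simp: is_product_def)
  then show "\<exists>!p. p \<in> Hom V (prod_ob V U Xs) (Xs ! i) \<and> FArr U p = uproj (map (FOb U) Xs) i"
    by (metis hom_eqI)
qed

text \<open>By faithfulness, the described projections are those of any product structure that lies
  over the tuple projections.\<close>

lemma is_product_prod_ob:
  assumes Xs: "set Xs \<subseteq> Ob V"
  shows "is_product V Xs (prod_ob V U Xs) (prod_proj V U Xs)"
proof -
  obtain \<pi> where \<pi>: "is_product V Xs (prod_ob V U Xs) \<pi>"
      "\<forall>i < length Xs. FArr U (\<pi> i) = uproj (map (FOb U) Xs) i"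
    using prod_ob[OF Xs] by blast
  have "\<pi> i = prod_proj V U Xs i" if i: "i < length Xs" for i
    by (rule hom_eqI[of _ "prod_ob V U Xs" "Xs ! i"])
      (use \<pi> prod_proj[OF Xs i] i in \<open>auto simp: is_product_def\<close>)
  with \<pi>(1) show ?thesis
    by (simp add: is_product_def)
qed

text \<open>The universal property of the codomain makes the description \<open>prod_arr\<close>
  unique; comparing entries then shows that it acts on tuples componentwise.\<close>

lemma prod_arr:
  assumes fs: "set fs \<subseteq> Arr V"
  shows "prod_arr V U fs \<in> Hom V (prod_ob V U (map (Dom V) fs)) (prod_ob V U (map (Cod V) fs))"
      (is "?thesis1")
    and "list_all2 (\<lambda>x f. x \<in> FOb U (Dom V f)) xs fs
      \<Longrightarrow> val (prod_arr V U fs) (utuple xs) = utuple (map2 val fs xs)"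
proof -
  let ?Xs = "map (Dom V) fs" and ?Ys = "map (Cod V) fs"
  have Xs: "set ?Xs \<subseteq> Ob V" "set ?Ys \<subseteq> Ob V"
    using fs dom_ob cod_ob by auto
  have fi: "fs ! i \<in> Hom V (?Xs ! i) (?Ys ! i)" if "i < length fs" for i
    using that fs by (auto simp: Hom_def)
  have legs: "fs ! i \<cdot>\<^bsub>V\<^esub> prod_proj V U ?Xs i \<in> Hom V (prod_ob V U ?Xs) (?Ys ! i)"
    if "i < length fs" for i
    using fi[OF that] prod_proj[OF Xs(1)] that by (auto intro: comp_hom)
  have "\<exists>!h. h \<in> Hom V (prod_ob V U ?Xs) (prod_ob V U ?Ys) \<and>
     (\<forall>i < length fs. prod_proj V U ?Ys i \<cdot>\<^bsub>V\<^esub> h = fs ! i \<cdot>\<^bsub>V\<^esub> prod_proj V U ?Xs i)"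
    using is_product_prod_ob[OF Xs(2)] legs prod_ob_in_Ob[OF Xs(1)] by (simp add: is_product_def)
  from theI'[OF this]
  have h: "prod_arr V U fs \<in> Hom V (prod_ob V U ?Xs) (prod_ob V U ?Ys)"
    and tri: "\<And>i. i < length fs \<Longrightarrow> prod_proj V U ?Ys i \<cdot>\<^bsub>V\<^esub> prod_arr V U fs
      = fs ! i \<cdot>\<^bsub>V\<^esub> prod_proj V U ?Xs i"
    unfolding prod_arr_def by blast+
  show ?thesis1 by (fact h)
  assume xs: "list_all2 (\<lambda>x f. x \<in> FOb U (Dom V f)) xs fs"
  then have xs': "utuple xs \<in> FOb U (prod_ob V U ?Xs)"
    using U_prod_ob[OF Xs(1)] by (auto simp: list_all2_conv_all_nth)
  have len: "length xs = length fs"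
    using xs list_all2_lengthD by blast
  show "val (prod_arr V U fs) (utuple xs) = utuple (map2 val fs xs)"
  proof (rule utuples_eqI)
    show "val (prod_arr V U fs) (utuple xs) \<in> utuples (map (FOb U) ?Ys)"
      using val_in[OF h xs'] U_prod_ob[OF Xs(2)] by simp
    show mem: "utuple (map2 val fs xs) \<in> utuples (map (FOb U) ?Ys)"
      using xs val_in[OF fi] by (auto simp: list_all2_conv_all_nth)
    fix i assume "i < length (map (FOb U) ?Ys)"
    then have i: "i < length fs" by simp
    have P: "prod_proj V U ?Xs i \<in> Hom V (prod_ob V U ?Xs) (?Xs ! i)"
        "FArr U (prod_proj V U ?Xs i) = uproj (map (FOb U) ?Xs) i"
        "prod_proj V U ?Ys i \<in> Hom V (prod_ob V U ?Ys) (?Ys ! i)"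
        "FArr U (prod_proj V U ?Ys i) = uproj (map (FOb U) ?Ys) i"
      using prod_proj[OF Xs(1)] prod_proj[OF Xs(2)] i by simp_all
    have "val (prod_proj V U ?Ys i) (val (prod_arr V U fs) (utuple xs))
        = val (fs ! i) (val (prod_proj V U ?Xs i) (utuple xs))"
      using val_comp[OF h P(3) xs'] val_comp[OF P(1) fi[OF i] xs'] tri[OF i] by simp
    also have "\<dots> = val (fs ! i) (xs ! i)"
      using P(2) xs' U_prod_ob[OF Xs(1)] by simp
    finally show "mapfun (uproj (map (FOb U) ?Ys) i) (val (prod_arr V U fs) (utuple xs))
        = mapfun (uproj (map (FOb U) ?Ys) i) (utuple (map2 val fs xs))"
      using P(4) mem i len by simp
  qed
qed

end


section \<open>Evaluation of terms\<close>

lemma list_all2_mem_map: "list_all2 (\<in>) ts (map F ss) \<longleftrightarrow> list_all2 (\<lambda>s t. t \<in> F s) ss ts"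
  by (auto simp: list_all2_conv_all_nth)

lemma in_Terms [simp]: "s \<in> S \<Longrightarrow> t \<in> Terms S Sg Y s \<longleftrightarrow> is_term Sg Y s t"
  by (simp add: Terms_def)

lemma list_all2_in_Terms:
  "set ss \<subseteq> S \<Longrightarrow> list_all2 (\<lambda>s t. t \<in> Terms S Sg Y s) ss ts \<longleftrightarrow> list_all2 (is_term Sg Y) ss ts"
  by (auto simp: list_all2_conv_all_nth subset_iff)

lemma tvar_eq_iff [simp]: "tvar x = tvar y \<longleftrightarrow> x = y"
  by (simp add: tvar_def)

lemma tapp_eq_iff [simp]: "tapp \<tau> t = tapp \<tau>' t' \<longleftrightarrow> \<tau> = \<tau>' \<and> t = t'"
  by (simp add: tapp_def)

text \<open>The graph of the evaluation of terms. Terms are elements of the universe rather than of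
  a datatype, so the function is obtained from a graph that is shown to be functional and total. The
  arguments are treated by index because sorts, terms and values form three parallel lists.\<close>

inductive evaluates ::
    "('s, 'u::set_universe set, 'u) signature \<Rightarrow> ('s \<Rightarrow> 'u set) \<Rightarrow> ('s \<Rightarrow> 'u \<Rightarrow> 'u) \<Rightarrow>
     ('u \<Rightarrow> 'u list \<Rightarrow> 'u) \<Rightarrow> 's \<Rightarrow> 'u \<Rightarrow> 'u \<Rightarrow> bool"
  for Sg Y f opn where
  var: "x \<in> Y s \<Longrightarrow> evaluates Sg Y f opn s (tvar x) (f s x)"
| app: "\<lbrakk>\<tau> \<in> Syms Sg; length ts = length (Ins Sg \<tau>); length vs = length (Ins Sg \<tau>);
         \<And>i. i < length (Ins Sg \<tau>) \<Longrightarrow> evaluates Sg Y f opn (Ins Sg \<tau> ! i) (ts ! i) (vs ! i)\<rbrakk>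
        \<Longrightarrow> evaluates Sg Y f opn (Out Sg \<tau>) (tapp \<tau> (utuple ts)) (opn \<tau> vs)"

text \<open>Variables are coded as pairs with first component \<open>unil\<close> and compound terms
  as pairs with a symbol in front. The assumption on \<open>unil\<close> keeps the two rules from
  applying to the same element; within each rule the coding is injective.\<close>

lemma evaluates_functional:
  assumes "unil \<notin> Syms Sg" "evaluates Sg Y f opn s t v" "evaluates Sg Y f opn s t w"
  shows "w = v"
  using assms(2,3)
proof (induction arbitrary: w rule: evaluates.induct)
  case (var x s)
  from var.prems show ?case
    by cases (use assms(1) in \<open>auto simp: tvar_def tapp_def\<close>)
next
  case (app \<tau> ts vs)
  from app.prems show ?case
  proof cases
    case (var x)
    then show ?thesis
      using assms(1) app.hyps(1) by (auto simp: tvar_def tapp_def)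
  next
    case (app \<tau>' ts' vs')
    then have "vs' ! i = vs ! i" if "i < length (Ins Sg \<tau>)" for i
      using app.IH that by auto
    then have "vs' = vs"
      using app \<open>length vs = _\<close> by (intro nth_equalityI) auto
    then show ?thesis
      using app by simp
  qed
qed

lemma evaluates_total: "is_term Sg Y s t \<Longrightarrow> \<exists>v. evaluates Sg Y f opn s t v"
proof (induction rule: is_term.induct)
  case (var x s)
  then show ?case
    by (intro exI[of _ "f s x"] evaluates.var)
next
  case (app \<tau> ts)
  then have "\<forall>i < length (Ins Sg \<tau>). \<exists>v. evaluates Sg Y f opn (Ins Sg \<tau> ! i) (ts ! i) v"
      and len: "length ts = length (Ins Sg \<tau>)"
    by (simp_all add: list_all2_conv_all_nth)
  then obtain v where "\<forall>i < length (Ins Sg \<tau>). evaluates Sg Y f opn (Ins Sg \<tau> ! i) (ts ! i) (v i)"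
    by metis
  then have "evaluates Sg Y f opn (Out Sg \<tau>) (tapp \<tau> (utuple ts))
      (opn \<tau> (map v [0..<length (Ins Sg \<tau>)]))"
    using app.hyps len by (intro evaluates.app) auto
  then show ?case by blast
qed

text \<open>The recursion principle for coded terms: \<open>h\<close> picks the value that the graph
  \<open>evaluates\<close> assigns. Off the terms it is an arbitrary total function.\<close>

lemma term_eval_exists:
  fixes Sg :: "('s, 'u::set_universe set, 'u) signature" and f :: "'s \<Rightarrow> 'u \<Rightarrow> 'u"
  assumes "unil \<notin> Syms Sg"
  obtains h where "\<And>s x. x \<in> Y s \<Longrightarrow> h s (tvar x) = f s x"
    and "\<And>\<tau> ts. \<lbrakk>\<tau> \<in> Syms Sg; list_all2 (is_term Sg Y) (Ins Sg \<tau>) ts\<rbrakk>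
      \<Longrightarrow> h (Out Sg \<tau>) (tapp \<tau> (utuple ts)) = opn \<tau> (map2 h (Ins Sg \<tau>) ts)"
proof
  define h where "h s t = (THE v. evaluates Sg Y f opn s t v)" for s t
  have h_eq: "h s t = v" if "evaluates Sg Y f opn s t v" for s t v
    unfolding h_def by (rule the_equality, rule that, rule evaluates_functional[OF assms that])
  then have h: "evaluates Sg Y f opn s t (h s t)" if "is_term Sg Y s t" for s t
    using evaluates_total[OF that] by metis
  show "h s (tvar x) = f s x" if "x \<in> Y s" for s x
    by (rule h_eq, rule evaluates.var) (fact that)
  show "h (Out Sg \<tau>) (tapp \<tau> (utuple ts)) = opn \<tau> (map2 h (Ins Sg \<tau>) ts)"
    if "\<tau> \<in> Syms Sg" "list_all2 (is_term Sg Y) (Ins Sg \<tau>) ts" for \<tau> ts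
    by (rule h_eq, rule evaluates.app) (use that h in \<open>auto simp: list_all2_conv_all_nth\<close>)
qed

lemma map2_cong_list_all2:
  "\<lbrakk>list_all2 P xs ys; \<And>x y. P x y \<Longrightarrow> x \<in> set xs \<Longrightarrow> f x y = g x y\<rbrakk> \<Longrightarrow> map2 f xs ys = map2 g xs ys"
  by (rule nth_equalityI) (auto simp: list_all2_conv_all_nth)

text \<open>Structural induction, as both functions satisfy the same recursion.
  \<open>is_term\<close> does not mention \<open>S\<close>, so membership of the sort in
  \<open>S\<close> is carried along; it passes to the arguments since input sorts of symbols lie in
  \<open>S\<close>.\<close>

lemma term_eval_unique:
  assumes "is_term Sg Y s t"
    and "\<And>s x. x \<in> Y s \<Longrightarrow> s \<in> S \<Longrightarrow> h s (tvar x) = h' s (tvar x)"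
    and "\<And>\<tau> ts. \<lbrakk>\<tau> \<in> Syms Sg; list_all2 (is_term Sg Y) (Ins Sg \<tau>) ts\<rbrakk>
      \<Longrightarrow> h (Out Sg \<tau>) (tapp \<tau> (utuple ts)) = opn \<tau> (map2 h (Ins Sg \<tau>) ts)"
    and "\<And>\<tau> ts. \<lbrakk>\<tau> \<in> Syms Sg; list_all2 (is_term Sg Y) (Ins Sg \<tau>) ts\<rbrakk>
      \<Longrightarrow> h' (Out Sg \<tau>) (tapp \<tau> (utuple ts)) = opn \<tau> (map2 h' (Ins Sg \<tau>) ts)"
    and "\<And>\<tau>. \<tau> \<in> Syms Sg \<Longrightarrow> set (Ins Sg \<tau>) \<subseteq> S"
    and "s \<in> S"
  shows "h s t = h' s t"
  using assms(1) \<open>s \<in> S\<close>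
proof (induction rule: is_term.induct)
  case (var x s)
  then show ?case using assms(2) by blast
next
  case (app \<tau> ts)
  have ts: "list_all2 (is_term Sg Y) (Ins Sg \<tau>) ts"
    using app.IH by (rule list_all2_mono) blast
  have "map2 h (Ins Sg \<tau>) ts = map2 h' (Ins Sg \<tau>) ts"
    by (rule map2_cong_list_all2[OF app.IH]) (use assms(5)[OF app.hyps(1)] in auto)
  then show ?case
    unfolding assms(3)[OF app.hyps(1) ts] assms(4)[OF app.hyps(1) ts] by (rule arg_cong)
qed

lemma term_eval_in:
  assumes "is_term Sg Y s t"
    and "\<And>s x. x \<in> Y s \<Longrightarrow> s \<in> S \<Longrightarrow> h s (tvar x) \<in> B s"
    and "\<And>\<tau> ts. \<lbrakk>\<tau> \<in> Syms Sg; list_all2 (is_term Sg Y) (Ins Sg \<tau>) ts;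
        list_all2 (\<lambda>s v. v \<in> B s) (Ins Sg \<tau>) (map2 h (Ins Sg \<tau>) ts)\<rbrakk>
      \<Longrightarrow> h (Out Sg \<tau>) (tapp \<tau> (utuple ts)) \<in> B (Out Sg \<tau>)"
    and "\<And>\<tau>. \<tau> \<in> Syms Sg \<Longrightarrow> set (Ins Sg \<tau>) \<subseteq> S"
    and "s \<in> S"
  shows "h s t \<in> B s"
  using assms(1) \<open>s \<in> S\<close>
proof (induction rule: is_term.induct)
  case (var x s)
  then show ?case using assms(2) by blast
next
  case (app \<tau> ts)
  have "list_all2 (is_term Sg Y) (Ins Sg \<tau>) ts"
    using app.IH by (rule list_all2_mono) blast
  moreover have "list_all2 (\<lambda>s v. v \<in> B s) (Ins Sg \<tau>) (map2 h (Ins Sg \<tau>) ts)"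
    using app.IH assms(4)[OF app.hyps(1)] by (auto simp: list_all2_conv_all_nth subset_iff)
  ultimately show ?case
    using assms(3) app.hyps(1) by blast
qed

section \<open>Smallness of the sets of terms\<close>

text \<open>The monotone operator whose least fixed point is the family of terms. Its iterates
  \<open>terms_upto\<close> collect the terms of height below \<open>n\<close>, where variables and
  nullary symbols have height 0.\<close>

definition terms_step ::
    "('s, 'u::set_universe set, 'u) signature \<Rightarrow> ('s \<Rightarrow> 'u set) \<Rightarrow> ('s \<Rightarrow> 'u set) \<Rightarrow> 's \<Rightarrow> 'u set" where
  "terms_step Sg Y T s = tvar ` Y s \<union>
     (\<Union>\<tau>\<in>{\<tau> \<in> Syms Sg. Out Sg \<tau> = s}. tapp \<tau> ` utuples (map T (Ins Sg \<tau>)))"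

primrec terms_upto ::
    "('s, 'u::set_universe set, 'u) signature \<Rightarrow> ('s \<Rightarrow> 'u set) \<Rightarrow> nat \<Rightarrow> 's \<Rightarrow> 'u set" where
  "terms_upto Sg Y 0 = (\<lambda>s. {})"
| "terms_upto Sg Y (Suc n) = terms_step Sg Y (terms_upto Sg Y n)"

lemma terms_step_mono:
  assumes "\<And>s. T s \<subseteq> T' s"
  shows "terms_step Sg Y T s \<subseteq> terms_step Sg Y T' s"
proof -
  have "utuples (map T ss) \<subseteq> utuples (map T' ss)" for ss
    using subsetD[OF assms] by (auto simp: list_all2_conv_all_nth elim!: utuplesE)
  then show ?thesis
    unfolding terms_step_def by blast
qed

lemma terms_upto_Suc: "terms_upto Sg Y n s \<subseteq> terms_upto Sg Y (Suc n) s"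
proof (induction n arbitrary: s)
  case (Suc n)
  then show ?case
    using terms_step_mono[of "terms_upto Sg Y n" "terms_upto Sg Y (Suc n)"] by simp
qed simp

text \<open>Symbols are finitary: the stages at which the arguments of a term appear have a maximum,
  and the term itself appears one stage later. Hence countably many stages suffice.\<close>

lemma is_term_terms_upto: "is_term Sg Y s t \<Longrightarrow> \<exists>n. t \<in> terms_upto Sg Y n s"
proof (induction rule: is_term.induct)
  case (var x s)
  then have "tvar x \<in> terms_upto Sg Y 1 s" by (simp add: terms_step_def)
  then show ?case by blast
next
  case (app \<tau> ts)
  have mono: "m \<le> n \<Longrightarrow> terms_upto Sg Y m s \<subseteq> terms_upto Sg Y n s" for m n s
    by (rule lift_Suc_mono_le[of "\<lambda>n. terms_upto Sg Y n s", OF terms_upto_Suc])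
  have "\<exists>n. list_all2 (\<lambda>s t. t \<in> terms_upto Sg Y n s) ss ts"
    if "list_all2 (\<lambda>s t. \<exists>n. t \<in> terms_upto Sg Y n s) ss ts" for ss ts
    using that
  proof (induction rule: list_all2_induct)
    case (Cons s ss t ts)
    then obtain m n where m: "t \<in> terms_upto Sg Y m s"
        and n: "list_all2 (\<lambda>s t. t \<in> terms_upto Sg Y n s) ss ts"
      by blast
    have "t \<in> terms_upto Sg Y (max m n) s"
      using m subsetD[OF mono[of m "max m n"]] by simp
    moreover have "list_all2 (\<lambda>s t. t \<in> terms_upto Sg Y (max m n) s) ss ts"
      using n by (rule list_all2_mono) (rule subsetD[OF mono[of n "max m n"]], simp_all)
    ultimately show ?case
      by (intro exI[of _ "max m n"]) simp
  qed simp
  moreover have "list_all2 (\<lambda>s t. \<exists>n. t \<in> terms_upto Sg Y n s) (Ins Sg \<tau>) ts"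
    using app.IH by (rule list_all2_mono) blast
  ultimately obtain n where "list_all2 (\<lambda>s t. t \<in> terms_upto Sg Y n s) (Ins Sg \<tau>) ts"
    by blast
  then have "tapp \<tau> (utuple ts) \<in> terms_upto Sg Y (Suc n) (Out Sg \<tau>)"
    using app.hyps by (auto simp: terms_step_def list_all2_mem_map)
  then show ?case by blast
qed

text \<open>The closure properties of \<open>small\<close> concern subsets, images and small unions,
  so the terms are approached from below: each stage is a small union of images of sets of tuples,
  and the stages are countable in number.\<close>

lemma small_Terms:
  assumes Sg: "is_signature C S Sg" and Y: "\<And>s. s \<in> S \<Longrightarrow> small (Y s)" and s: "s \<in> S"
  shows "small (Terms S Sg Y s)"
proof -
  have "small (terms_upto Sg Y n s)" if "s \<in> S" for n s
    using that
  proof (induction n arbitrary: s)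
    case (Suc n)
    have "small {\<tau> \<in> Syms Sg. Out Sg \<tau> = s}"
      using Sg by (auto simp: is_signature_def intro: small_subset)
    moreover have "small (utuples (map (terms_upto Sg Y n) (Ins Sg \<tau>)))" if "\<tau> \<in> Syms Sg" for \<tau>
      using that Sg by (intro small_utuples) (auto simp: is_signature_def intro: Suc.IH)
    ultimately show ?case
      using Suc.prems Y by (auto simp: terms_step_def intro!: small_Un small_UN small_image)
  qed simp
  then have "small (\<Union>n. terms_upto Sg Y n s)"
    using s by (intro small_countable_UN) blast
  moreover have "Terms S Sg Y s \<subseteq> (\<Union>n. terms_upto Sg Y n s)"
    using s is_term_terms_upto by fastforce
  ultimately show ?thesis
    using small_subset by blast
qed


section \<open>Algebras, elementwise\<close>

text \<open>The behaviour of the tensor and of \<open>U\<close> in a form that can be instantiated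
  by a given \<open>V\<close> and equally by \<open>SetC\<close> over itself.\<close>

locale monoidal_topological_over_sets = topological_over_sets V U
  for V :: "('v, 'm, 'x) moncat_scheme"
    and U :: "('v, 'm, 'u::set_universe set, 'u setmap) func" +
  assumes tens_ob: "\<lbrakk>A \<in> Ob V; B \<in> Ob V\<rbrakk> \<Longrightarrow> A \<boxtimes>\<^bsub>V\<^esub> B \<in> Ob V"
    and tens_hom: "\<lbrakk>f \<in> Hom V A A'; g \<in> Hom V B B'\<rbrakk>
      \<Longrightarrow> f \<otimes>\<^bsub>V\<^esub> g \<in> Hom V (A \<boxtimes>\<^bsub>V\<^esub> B) (A' \<boxtimes>\<^bsub>V\<^esub> B')"
    and U_tens_ob: "\<lbrakk>A \<in> Ob V; B \<in> Ob V\<rbrakk> \<Longrightarrow> FOb U (A \<boxtimes>\<^bsub>V\<^esub> B) = uprod (FOb U A) (FOb U B)"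
    and U_tens_arr: "\<lbrakk>f \<in> Arr V; g \<in> Arr V\<rbrakk>
      \<Longrightarrow> FArr U (f \<otimes>\<^bsub>V\<^esub> g) = FArr U f \<otimes>\<^bsub>SetC\<^esub> FArr U g"

locale enriched_signature = monoidal_topological_over_sets V U
  for V :: "('v, 'm, 'x) moncat_scheme"
    and U :: "('v, 'm, 'u::set_universe set, 'u setmap) func" +
  fixes S :: "'s set"
    and Sg :: "('s, 'v, 'u) signature"
  assumes is_signature: "is_signature V S Sg"
begin

abbreviation VS :: "('s \<Rightarrow> 'v, 's \<Rightarrow> 'm) cat" where
  "VS \<equiv> power_cat S V"

abbreviation US :: "('s \<Rightarrow> 'v, 's \<Rightarrow> 'm, 's \<Rightarrow> 'u set, 's \<Rightarrow> 'u setmap) func" where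
  "US \<equiv> power_func S U"

lemma sorts:
  assumes "\<sigma> \<in> Syms Sg"
  shows "set (Ins Sg \<sigma>) \<subseteq> S" "Out Sg \<sigma> \<in> S" "Par Sg \<sigma> \<in> Ob V"
  using assms is_signature by (auto simp: is_signature_def)

lemma Ins_in_Ob:
  assumes "B \<in> Ob VS" "\<sigma> \<in> Syms Sg"
  shows "set (map B (Ins Sg \<sigma>)) \<subseteq> Ob V"
  using assms sorts(1) by (auto simp: Ob_power_cat)

lemma op_dom:
  assumes "B \<in> Ob VS" "\<sigma> \<in> Syms Sg"
  shows "op_dom V U Sg B \<sigma> \<in> Ob V"
    and "FOb U (op_dom V U Sg B \<sigma>)
      = uprod (FOb U (Par Sg \<sigma>)) (utuples (map (\<lambda>s. FOb U (B s)) (Ins Sg \<sigma>)))"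
  using prod_ob_in_Ob[OF Ins_in_Ob[OF assms]] U_prod_ob[OF Ins_in_Ob[OF assms]] sorts(3)[OF assms(2)]
  by (simp_all add: op_dom_def tens_ob U_tens_ob comp_def)

abbreviation args :: "('s \<Rightarrow> 'v) \<Rightarrow> 'u \<Rightarrow> 'u list \<Rightarrow> bool" where
  "args B \<sigma> ts \<equiv> list_all2 (\<lambda>s t. t \<in> FOb U (B s)) (Ins Sg \<sigma>) ts"

lemma upair_in_op_dom:
  assumes "B \<in> Ob VS" "\<sigma> \<in> Syms Sg"
  shows "upair p (utuple ts) \<in> FOb U (op_dom V U Sg B \<sigma>) \<longleftrightarrow> p \<in> FOb U (Par Sg \<sigma>) \<and> args B \<sigma> ts"
  using op_dom(2)[OF assms] by (simp add: list_all2_mem_map)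

lemma op_dom_cases:
  assumes "B \<in> Ob VS" "\<sigma> \<in> Syms Sg" "z \<in> FOb U (op_dom V U Sg B \<sigma>)"
  obtains p ts where "z = upair p (utuple ts)" "p \<in> FOb U (Par Sg \<sigma>)" "args B \<sigma> ts"
  using assms(3) op_dom(2)[OF assms(1,2)] that
  by (auto elim!: uprodE utuplesE simp: list_all2_mem_map)

lemma op_dom_map:
  assumes f: "f \<in> Hom VS A B" and A: "A \<in> Ob VS" and B: "B \<in> Ob VS" and \<sigma>: "\<sigma> \<in> Syms Sg"
  defines "m \<equiv> Ident V (Par Sg \<sigma>) \<otimes>\<^bsub>V\<^esub> prod_arr V U (map f (Ins Sg \<sigma>))"
  shows "m \<in> Hom V (op_dom V U Sg A \<sigma>) (op_dom V U Sg B \<sigma>)"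
    and "\<lbrakk>p \<in> FOb U (Par Sg \<sigma>); args A \<sigma> ts\<rbrakk>
      \<Longrightarrow> val m (upair p (utuple ts)) = upair p (utuple (map2 (\<lambda>s. val (f s)) (Ins Sg \<sigma>) ts))"
proof -
  have f': "f s \<in> Hom V (A s) (B s)" if "s \<in> set (Ins Sg \<sigma>)" for s
    using Hom_power_catD[OF f] sorts(1)[OF \<sigma>] that by blast
  then have Arr: "set (map f (Ins Sg \<sigma>)) \<subseteq> Arr V"
    by (auto simp: Hom_def)
  have dom: "map (Dom V) (map f (Ins Sg \<sigma>)) = map A (Ins Sg \<sigma>)"
    and cod: "map (Cod V) (map f (Ins Sg \<sigma>)) = map B (Ins Sg \<sigma>)"
    using f' by (auto simp: Hom_def)
  have P: "prod_arr V U (map f (Ins Sg \<sigma>))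
      \<in> Hom V (prod_ob V U (map A (Ins Sg \<sigma>))) (prod_ob V U (map B (Ins Sg \<sigma>)))"
    using prod_arr(1)[OF Arr] unfolding dom cod .
  have I: "Ident V (Par Sg \<sigma>) \<in> Hom V (Par Sg \<sigma>) (Par Sg \<sigma>)"
    using ident_hom sorts(3)[OF \<sigma>] by blast
  show "m \<in> Hom V (op_dom V U Sg A \<sigma>) (op_dom V U Sg B \<sigma>)"
    unfolding m_def op_dom_def using tens_hom I P by blast
  assume p: "p \<in> FOb U (Par Sg \<sigma>)" and ts: "args A \<sigma> ts"
  have "list_all2 (\<lambda>x f. x \<in> FOb U (Dom V f)) ts (map f (Ins Sg \<sigma>))"
    using ts f' by (auto simp: list_all2_conv_all_nth Hom_def)
  from prod_arr(2)[OF Arr this]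
  have "val (prod_arr V U (map f (Ins Sg \<sigma>))) (utuple ts)
      = utuple (map2 (\<lambda>s. val (f s)) (Ins Sg \<sigma>) ts)"
    by (simp add: zip_map1 comp_def case_prod_unfold)
  moreover have "utuple ts \<in> FOb U (prod_ob V U (map A (Ins Sg \<sigma>)))"
    using U_prod_ob[OF Ins_in_Ob[OF A \<sigma>]] ts by (auto simp: list_all2_conv_all_nth)
  ultimately show "val m (upair p (utuple ts)) = upair p (utuple (map2 (\<lambda>s. val (f s)) (Ins Sg \<sigma>) ts))"
    unfolding m_def using U_tens_arr[OF HomD(1)[OF I] HomD(1)[OF P]]
      mapfun_TensArr[OF U_hom[OF I] U_hom[OF P] p] val_ident[OF sorts(3)[OF \<sigma>] p] by simp
qed

lemma is_algebraD:
  assumes "is_algebra V U S Sg A"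
  shows "Car A \<in> Ob VS"
    and "\<sigma> \<in> Syms Sg \<Longrightarrow> Opn A \<sigma> \<in> Hom V (op_dom V U Sg (Car A) \<sigma>) (Car A (Out Sg \<sigma>))"
    and "Opn A \<in> extensional (Syms Sg)"
  using assms by (auto simp: is_algebra_def PiE_iff)

lemma Opn_in:
  assumes "is_algebra V U S Sg A" "\<sigma> \<in> Syms Sg" "p \<in> FOb U (Par Sg \<sigma>)" "args (Car A) \<sigma> ts"
  shows "val (Opn A \<sigma>) (upair p (utuple ts)) \<in> FOb U (Car A (Out Sg \<sigma>))"
  using val_in[OF is_algebraD(2)[OF assms(1,2)]] upair_in_op_dom[OF is_algebraD(1)[OF assms(1)] assms(2)]
    assms(3,4) by blast

lemma args_map:
  assumes "f \<in> Hom VS A B" "\<sigma> \<in> Syms Sg" "args A \<sigma> ts"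
  shows "args B \<sigma> (map2 (\<lambda>s. val (f s)) (Ins Sg \<sigma>) ts)"
proof -
  have "val (f s) t \<in> FOb U (B s)" if "s \<in> set (Ins Sg \<sigma>)" "t \<in> FOb U (A s)" for s t
    using val_in[OF Hom_power_catD[OF assms(1)]] sorts(1)[OF assms(2)] that by blast
  then show ?thesis
    using assms(3) by (simp add: list_all2_conv_all_nth)
qed

text \<open>By faithfulness the commuting square may be tested on elements, and every element of the
  domain of an operation is a pair of a parameter and a tuple of arguments. Later homomorphism
  checks go through this form, over \<open>V\<close> as well as over \<open>SetC\<close>.\<close>

lemma is_algebra_hom_iff:
  assumes A: "is_algebra V U S Sg A" and B: "is_algebra V U S Sg B"
  shows "is_algebra_hom V U S Sg A f B \<longleftrightarrow> f \<in> Hom VS (Car A) (Car B) \<and>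
    (\<forall>\<sigma> \<in> Syms Sg. \<forall>p \<in> FOb U (Par Sg \<sigma>). \<forall>ts. args (Car A) \<sigma> ts \<longrightarrow>
      val (f (Out Sg \<sigma>)) (val (Opn A \<sigma>) (upair p (utuple ts)))
        = val (Opn B \<sigma>) (upair p (utuple (map2 (\<lambda>s. val (f s)) (Ins Sg \<sigma>) ts))))"
proof -
  have "f (Out Sg \<sigma>) \<cdot>\<^bsub>V\<^esub> Opn A \<sigma>
        = Opn B \<sigma> \<cdot>\<^bsub>V\<^esub> (Ident V (Par Sg \<sigma>) \<otimes>\<^bsub>V\<^esub> prod_arr V U (map f (Ins Sg \<sigma>))) \<longleftrightarrow>
    (\<forall>p \<in> FOb U (Par Sg \<sigma>). \<forall>ts. args (Car A) \<sigma> ts \<longrightarrow>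
      val (f (Out Sg \<sigma>)) (val (Opn A \<sigma>) (upair p (utuple ts)))
        = val (Opn B \<sigma>) (upair p (utuple (map2 (\<lambda>s. val (f s)) (Ins Sg \<sigma>) ts))))"
    (is "?l = ?r \<longleftrightarrow> ?P")
    if f: "f \<in> Hom VS (Car A) (Car B)" and \<sigma>: "\<sigma> \<in> Syms Sg" for \<sigma>
  proof -
    note obs = is_algebraD(1)[OF A] is_algebraD(1)[OF B]
    note m = op_dom_map[OF f obs \<sigma>]
    note opn = is_algebraD(2)[OF A \<sigma>] is_algebraD(2)[OF B \<sigma>]
    have f': "f (Out Sg \<sigma>) \<in> Hom V (Car A (Out Sg \<sigma>)) (Car B (Out Sg \<sigma>))"
      using Hom_power_catD[OF f] sorts(2)[OF \<sigma>] by blast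
    have vals: "val ?l z = val (f (Out Sg \<sigma>)) (val (Opn A \<sigma>) z)"
        "val ?r z = val (Opn B \<sigma>) (upair p (utuple (map2 (\<lambda>s. val (f s)) (Ins Sg \<sigma>) ts)))"
      if "z = upair p (utuple ts)" "p \<in> FOb U (Par Sg \<sigma>)" "args (Car A) \<sigma> ts" for z p ts
      using that val_comp[OF opn(1) f'] val_comp[OF m(1) opn(2)] m(2) upair_in_op_dom[OF obs(1) \<sigma>]
      by simp_all
    show ?thesis
    proof
      assume "?l = ?r"
      then show ?P using vals by metis
    next
      assume P: ?P
      show "?l = ?r"
      proof (rule hom_eqI)
        show "?l \<in> Hom V (op_dom V U Sg (Car A) \<sigma>) (Car B (Out Sg \<sigma>))"
          "?r \<in> Hom V (op_dom V U Sg (Car A) \<sigma>) (Car B (Out Sg \<sigma>))"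
          using comp_hom opn f' m(1) by blast+
        fix z assume "z \<in> FOb U (op_dom V U Sg (Car A) \<sigma>)"
        then show "val ?l z = val ?r z"
          by (rule op_dom_cases[OF obs(1) \<sigma>]) (use vals P in simp)
      qed
    qed
  qed
  then show ?thesis
    unfolding is_algebra_hom_def by blast
qed

lemma Hom_alg_cat:
  "h \<in> Hom (alg_cat V U S Sg) A B \<longleftrightarrow> is_algebra V U S Sg A \<and> is_algebra V U S Sg B \<and>
    (\<exists>f. h = (A, f, B) \<and> is_algebra_hom V U S Sg A f B)"
  by (auto simp: Hom_def alg_cat_def)

lemma Ob_alg_cat [simp]: "A \<in> Ob (alg_cat V U S Sg) \<longleftrightarrow> is_algebra V U S Sg A"
  by (simp add: alg_cat_def)

lemma Ident_alg_cat [simp]: "Ident (alg_cat V U S Sg) A = (A, Ident VS (Car A), A)"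
  by (simp add: alg_cat_def)

lemma Comp_alg_cat [simp]:
  "(B', g, C) \<cdot>\<^bsub>alg_cat V U S Sg\<^esub> (A, f, B) = (A, g \<cdot>\<^bsub>VS\<^esub> f, C)"
  by (simp add: alg_cat_def)

lemma alg_forget_simps [simp]: "FOb alg_forget = Car" "FArr alg_forget (A, f, B) = f"
  by (simp_all add: alg_forget_def)

lemma category_VS: "category VS"
  using category_axioms by (rule category_power_cat)

sublocale VS: category VS
  by (rule category_VS)

lemma is_algebra_hom_ident:
  assumes A: "is_algebra V U S Sg A"
  shows "is_algebra_hom V U S Sg A (Ident VS (Car A)) A"
proof -
  note obs = is_algebraD(1)[OF A]
  have Ob: "Car A s \<in> Ob V" if "s \<in> S" for s
    using obs that by (simp add: Ob_power_cat)
  have "val (Ident VS (Car A) (Out Sg \<sigma>)) (val (Opn A \<sigma>) (upair p (utuple ts)))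
      = val (Opn A \<sigma>) (upair p (utuple (map2 (\<lambda>s. val (Ident VS (Car A) s)) (Ins Sg \<sigma>) ts)))"
    if \<sigma>: "\<sigma> \<in> Syms Sg" and p: "p \<in> FOb U (Par Sg \<sigma>)" and ts: "args (Car A) \<sigma> ts" for \<sigma> p ts
  proof -
    have "map2 (\<lambda>s. val (Ident VS (Car A) s)) (Ins Sg \<sigma>) ts = map2 (\<lambda>s t. t) (Ins Sg \<sigma>) ts"
      using sorts(1)[OF \<sigma>] by (intro map2_cong_list_all2[OF ts]) (auto simp: val_ident Ob)
    also have "\<dots> = ts"
      using list_all2_lengthD[OF ts] by (intro nth_equalityI) auto
    finally show ?thesis
      using Opn_in[OF A \<sigma> p ts] sorts(2)[OF \<sigma>] by (simp add: val_ident Ob)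
  qed
  then show ?thesis
    using VS.ident_hom[OF obs] by (simp add: is_algebra_hom_iff[OF A A])
qed

lemma is_algebra_hom_comp:
  assumes A: "is_algebra V U S Sg A" and B: "is_algebra V U S Sg B" and C: "is_algebra V U S Sg C"
    and f: "is_algebra_hom V U S Sg A f B" and g: "is_algebra_hom V U S Sg B g C"
  shows "is_algebra_hom V U S Sg A (g \<cdot>\<^bsub>VS\<^esub> f) C"
proof -
  have f': "f \<in> Hom VS (Car A) (Car B)" and g': "g \<in> Hom VS (Car B) (Car C)"
    using f g by (simp_all add: is_algebra_hom_def)
  have vals: "val ((g \<cdot>\<^bsub>VS\<^esub> f) s) t = val (g s) (val (f s) t)" if "s \<in> S" "t \<in> FOb U (Car A s)" for s t
    using val_comp[OF Hom_power_catD[OF f'] Hom_power_catD[OF g']] that by simp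
  have "val ((g \<cdot>\<^bsub>VS\<^esub> f) (Out Sg \<sigma>)) (val (Opn A \<sigma>) (upair p (utuple ts)))
      = val (Opn C \<sigma>) (upair p (utuple (map2 (\<lambda>s. val ((g \<cdot>\<^bsub>VS\<^esub> f) s)) (Ins Sg \<sigma>) ts)))"
    if \<sigma>: "\<sigma> \<in> Syms Sg" and p: "p \<in> FOb U (Par Sg \<sigma>)" and ts: "args (Car A) \<sigma> ts" for \<sigma> p ts
  proof -
    let ?ts = "map2 (\<lambda>s. val (f s)) (Ins Sg \<sigma>) ts"
    have "val ((g \<cdot>\<^bsub>VS\<^esub> f) (Out Sg \<sigma>)) (val (Opn A \<sigma>) (upair p (utuple ts)))
        = val (g (Out Sg \<sigma>)) (val (f (Out Sg \<sigma>)) (val (Opn A \<sigma>) (upair p (utuple ts))))"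
      using vals sorts(2)[OF \<sigma>] Opn_in[OF A \<sigma> p ts] by blast
    also have "\<dots> = val (g (Out Sg \<sigma>)) (val (Opn B \<sigma>) (upair p (utuple ?ts)))"
      using f \<sigma> p ts by (simp add: is_algebra_hom_iff[OF A B])
    also have "\<dots> = val (Opn C \<sigma>) (upair p (utuple (map2 (\<lambda>s. val (g s)) (Ins Sg \<sigma>) ?ts)))"
      using g \<sigma> p args_map[OF f' \<sigma> ts] by (simp add: is_algebra_hom_iff[OF B C])
    also have "map2 (\<lambda>s. val (g s)) (Ins Sg \<sigma>) ?ts = map2 (\<lambda>s. val ((g \<cdot>\<^bsub>VS\<^esub> f) s)) (Ins Sg \<sigma>) ts"
      using ts sorts(1)[OF \<sigma>] vals by (intro nth_equalityI) (auto simp: list_all2_conv_all_nth subset_iff)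
    finally show ?thesis .
  qed
  then show ?thesis
    using VS.comp_hom[OF f' g'] by (simp add: is_algebra_hom_iff[OF A C])
qed

lemma category_alg_cat: "category (alg_cat V U S Sg)"
proof
  fix f assume "f \<in> Arr (alg_cat V U S Sg)"
  then show "Dom (alg_cat V U S Sg) f \<in> Ob (alg_cat V U S Sg)"
      "Cod (alg_cat V U S Sg) f \<in> Ob (alg_cat V U S Sg)"
    by (auto simp: alg_cat_def)
next
  fix A assume "A \<in> Ob (alg_cat V U S Sg)"
  then show "Ident (alg_cat V U S Sg) A \<in> Hom (alg_cat V U S Sg) A A"
    by (simp add: Hom_alg_cat is_algebra_hom_ident)
next
  fix A B C f g
  assume "f \<in> Hom (alg_cat V U S Sg) A B" "g \<in> Hom (alg_cat V U S Sg) B C"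
  then show "g \<cdot>\<^bsub>alg_cat V U S Sg\<^esub> f \<in> Hom (alg_cat V U S Sg) A C"
    by (auto simp: Hom_alg_cat intro: is_algebra_hom_comp)
next
  fix A B f
  assume "f \<in> Hom (alg_cat V U S Sg) A B"
  then show "f \<cdot>\<^bsub>alg_cat V U S Sg\<^esub> Ident (alg_cat V U S Sg) A = f"
      "Ident (alg_cat V U S Sg) B \<cdot>\<^bsub>alg_cat V U S Sg\<^esub> f = f"
    by (auto simp: Hom_alg_cat is_algebra_hom_def VS.comp_ident VS.ident_comp)
next
  fix A B C D f g h
  assume "f \<in> Hom (alg_cat V U S Sg) A B" "g \<in> Hom (alg_cat V U S Sg) B C"
    "h \<in> Hom (alg_cat V U S Sg) C D"
  then show "(h \<cdot>\<^bsub>alg_cat V U S Sg\<^esub> g) \<cdot>\<^bsub>alg_cat V U S Sg\<^esub> f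
      = h \<cdot>\<^bsub>alg_cat V U S Sg\<^esub> g \<cdot>\<^bsub>alg_cat V U S Sg\<^esub> f"
    by (auto simp: Hom_alg_cat is_algebra_hom_def intro: VS.comp_assoc)
qed

lemma is_functor_alg_forget: "is_functor (alg_cat V U S Sg) VS alg_forget"
  unfolding is_functor_def by (auto simp: Hom_alg_cat is_algebra_hom_def is_algebraD(1))

end

section \<open>The underlying classical algebra\<close>

lemma id_func_simps [simp]: "FOb id_func A = A" "FArr id_func f = f"
  by (simp_all add: id_func_def)

text \<open>Over the identity functor every map is admissible, so each fibre has one element and the
  initial lift of a source on \<open>A\<close> is \<open>A\<close> itself.\<close>

lemma topological_SetC: "topological SetC SetC (id_func :: ('u::set_universe set, 'u setmap, 'u set, 'u setmap) func)"
proof -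
  interpret category "SetC :: ('u set, 'u setmap) moncat"
    by (rule category_SetC)
  have "concrete SetC SetC (id_func :: ('u set, 'u setmap, 'u set, 'u setmap) func)"
    by (auto simp: concrete_def category_SetC is_functor_def faithful_def simp del: Ob_SetC)
  moreover have "amnestic SetC SetC (id_func :: ('u set, 'u setmap, 'u set, 'u setmap) func)"
    unfolding amnestic_def
  proof
    fix A :: "'u set" assume "A \<in> Ob SetC"
    then have "Ident SetC A \<in> Hom SetC A A"
      by (rule ident_hom)
    then show "partial_order (Fib SetC SetC id_func A)"
      by unfold_locales (auto simp: Fib_def admissible_def)
  qed
  moreover have "initial_lift SetC SetC id_func A G A"
    if A: "A \<in> Ob SetC" and G: "structured_source SetC SetC id_func A G"
    for A :: "'u set" and G
    using A G comp_hom[of _ _ A]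
    by (fastforce simp: initial_lift_def initial_def structured_source_def admissible_def simp del: Ob_SetC)
  ultimately show ?thesis
    unfolding topological_def by blast
qed

interpretation SetC: monoidal_topological_over_sets SetC id_func
proof
  show "topological SetC SetC (id_func :: ('a set, 'a setmap, 'a set, 'a setmap) func)"
    by (rule topological_SetC)
qed (auto simp: small_uprod intro: TensArr_SetC_in_Hom)

context enriched_signature
begin

abbreviation usig :: "('s, 'u set, 'u) signature" where
  "usig \<equiv> und_sig U Sg"

lemma und_sig_simps [simp]:
  "upair \<sigma> p \<in> Syms usig \<longleftrightarrow> \<sigma> \<in> Syms Sg \<and> p \<in> FOb U (Par Sg \<sigma>)"
  "Ins usig \<tau> = Ins Sg (ufst \<tau>)" "Out usig \<tau> = Out Sg (ufst \<tau>)" "Par usig \<tau> = {unil}"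
  "unil \<notin> Syms usig"
  by (auto simp: und_sig_def)

lemma und_sig_cases:
  assumes "\<tau> \<in> Syms usig"
  obtains \<sigma> p where "\<tau> = upair \<sigma> p" "\<sigma> \<in> Syms Sg" "p \<in> FOb U (Par Sg \<sigma>)"
  using assms by (auto simp: und_sig_def)

lemma is_signature_und_sig: "is_signature SetC S usig"
proof -
  have "Syms usig = (\<Union>\<sigma>\<in>Syms Sg. upair \<sigma> ` FOb U (Par Sg \<sigma>))"
    by (auto simp: und_sig_def)
  moreover have "small \<dots>"
    using is_signature sorts(3) small_U by (intro small_UN small_image) (auto simp: is_signature_def)
  ultimately show ?thesis
    using sorts by (auto simp: is_signature_def elim!: und_sig_cases)
qed

text \<open>Classical algebras are enriched algebras over \<open>SetC\<close>, so everything shown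
  so far becomes available for them under the prefix \<open>C\<close>.\<close>

interpretation C: enriched_signature SetC id_func S usig
  by unfold_locales (rule is_signature_und_sig)

lemma US_in_Ob: "A \<in> Ob VS \<Longrightarrow> FOb US A \<in> Ob (power_cat S SetC)"
  using small_U by (auto simp: Ob_power_cat)

lemma US_hom: "f \<in> Hom VS A B \<Longrightarrow> FArr US f \<in> Hom (power_cat S SetC) (FOb US A) (FOb US B)"
  using U_hom Hom_power_catD[of f S V A B] by (auto simp: Hom_power_cat)

lemma US_comp:
  assumes "f \<in> Hom VS A B" "g \<in> Hom VS B C"
  shows "FArr US (g \<cdot>\<^bsub>VS\<^esub> f) = FArr US g \<cdot>\<^bsub>power_cat S SetC\<^esub> FArr US f"
  using is_functorD(4)[OF is_functor category_axioms Hom_power_catD[OF assms(1)] Hom_power_catD[OF assms(2)]]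
  by (intro extensionalityI[of _ S]) auto

text \<open>Passing to the underlying algebra moves the parameter \<open>p\<close> from the argument
  into the symbol; what stays in the place of the parameter is the point
  \<open>unil\<close>.\<close>

lemma Opn_und_alg:
  assumes "\<sigma> \<in> Syms Sg" "p \<in> FOb U (Par Sg \<sigma>)" "args (Car A) \<sigma> ts"
  shows "mapfun (Opn (und_alg U S Sg A) (upair \<sigma> p)) (upair unil (utuple ts))
    = val (Opn A \<sigma>) (upair p (utuple ts))"
  using assms by (simp add: und_alg_def list_all2_mem_map)

lemma map_US: "\<sigma> \<in> Syms Sg \<Longrightarrow> map (FOb US B) (Ins Sg \<sigma>) = map (\<lambda>s. FOb U (B s)) (Ins Sg \<sigma>)"
  using sorts(1)[of \<sigma>] by (simp add: subset_iff)

lemma args_US: "\<sigma> \<in> Syms Sg \<Longrightarrow> C.args (FOb US B) (upair \<sigma> p) ts \<longleftrightarrow> args B \<sigma> ts"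
  using sorts(1)[of \<sigma>] by (simp add: list_all2_conv_all_nth subset_iff cong: conj_cong)

lemma Car_und_alg [simp]: "Car (und_alg U S Sg A) = FOb US (Car A)"
  by (simp add: und_alg_def)

lemma is_algebra_und_alg:
  assumes A: "is_algebra V U S Sg A"
  shows "is_algebra SetC id_func S usig (und_alg U S Sg A)"
proof -
  have Ob: "Car (und_alg U S Sg A) \<in> Ob (power_cat S SetC)"
    using US_in_Ob is_algebraD(1)[OF A] by simp
  have "Opn (und_alg U S Sg A) \<tau>
      \<in> Hom SetC (op_dom SetC id_func usig (Car (und_alg U S Sg A)) \<tau>) (Car (und_alg U S Sg A) (Out usig \<tau>))"
    if \<tau>: "\<tau> \<in> Syms usig" for \<tau>
  proof -
    obtain \<sigma> p where \<sigma>: "\<tau> = upair \<sigma> p" "\<sigma> \<in> Syms Sg" "p \<in> FOb U (Par Sg \<sigma>)"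
      using \<tau> by (rule und_sig_cases)
    have dom: "op_dom SetC id_func usig (Car (und_alg U S Sg A)) \<tau>
        = uprod {unil} (utuples (map (\<lambda>s. FOb U (Car A s)) (Ins Sg \<sigma>)))"
      using C.op_dom(2)[OF Ob \<tau>] map_US[OF \<sigma>(2)] \<sigma>(1) by (simp add: comp_def)
    have "small (op_dom SetC id_func usig (Car (und_alg U S Sg A)) \<tau>)"
      using C.op_dom(1)[OF Ob \<tau>] by simp
    moreover have "small (FOb U (Car A (Out Sg \<sigma>)))"
      using is_algebraD(1)[OF A] sorts(2)[OF \<sigma>(2)] small_U by (simp add: Ob_power_cat)
    moreover have "val (Opn A \<sigma>) (upair p (usnd z)) \<in> FOb U (Car A (Out Sg \<sigma>))"
      if "z \<in> uprod {unil} (utuples (map (\<lambda>s. FOb U (Car A s)) (Ins Sg \<sigma>)))" for z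
      using that Opn_in[OF A \<sigma>(2,3)] by (auto elim!: uprodE utuplesE simp: list_all2_mem_map)
    ultimately show ?thesis
      unfolding dom using \<sigma> \<tau> sorts(2)[OF \<sigma>(2)] by (simp add: und_alg_def setmap_in_Hom)
  qed
  moreover have "Opn (und_alg U S Sg A) \<in> extensional (Syms usig)"
    by (simp add: und_alg_def)
  ultimately show ?thesis
    using Ob by (auto simp: is_algebra_def PiE_iff)
qed

text \<open>The homomorphism condition for \<open>\<sigma>\<close> at the parameter
  \<open>p\<close>, read on elements, is the condition for the classical symbol
  \<open>upair \<sigma> p\<close>.\<close>

lemma is_algebra_hom_und_alg:
  assumes A: "is_algebra V U S Sg A" and B: "is_algebra V U S Sg B" and f: "is_algebra_hom V U S Sg A f B"
  shows "is_algebra_hom SetC id_func S usig (und_alg U S Sg A) (FArr US f) (und_alg U S Sg B)"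
proof -
  have f': "f \<in> Hom VS (Car A) (Car B)"
    using f by (simp add: is_algebra_hom_def)
  have "mapfun (FArr US f (Out usig \<tau>)) (mapfun (Opn (und_alg U S Sg A) \<tau>) (upair q (utuple ts)))
      = mapfun (Opn (und_alg U S Sg B) \<tau>)
          (upair q (utuple (map2 (\<lambda>s. mapfun (FArr US f s)) (Ins usig \<tau>) ts)))"
    if \<tau>: "\<tau> \<in> Syms usig" and q: "q = unil"
      and ts: "C.args (FOb US (Car A)) \<tau> ts"
    for \<tau> q ts
  proof -
    obtain \<sigma> p where \<sigma>: "\<tau> = upair \<sigma> p" "\<sigma> \<in> Syms Sg" "p \<in> FOb U (Par Sg \<sigma>)"
      using \<tau> by (rule und_sig_cases)
    have ts': "args (Car A) \<sigma> ts"
      using ts args_US[OF \<sigma>(2)] unfolding \<sigma>(1) by blast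
    have map2: "map2 (\<lambda>s. mapfun (FArr US f s)) (Ins usig \<tau>) ts = map2 (\<lambda>s. val (f s)) (Ins Sg \<sigma>) ts"
      unfolding und_sig_simps \<sigma>(1) ufst_upair
      using sorts(1)[OF \<sigma>(2)] by (intro map2_cong_list_all2[OF ts']) auto
    have "val (f (Out Sg \<sigma>)) (val (Opn A \<sigma>) (upair p (utuple ts)))
        = val (Opn B \<sigma>) (upair p (utuple (map2 (\<lambda>s. val (f s)) (Ins Sg \<sigma>) ts)))"
      using f \<sigma>(2,3) ts' unfolding is_algebra_hom_iff[OF A B] by blast
    then show ?thesis
      unfolding map2 unfolding \<sigma>(1) q Opn_und_alg[where A = A, OF \<sigma>(2,3) ts']
        Opn_und_alg[where A = B, OF \<sigma>(2,3) args_map[OF f' \<sigma>(2) ts']]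
      using sorts(2)[OF \<sigma>(2)] by simp
  qed
  then show ?thesis
    using US_hom[OF f']
    by (simp add: C.is_algebra_hom_iff[OF is_algebra_und_alg[OF A] is_algebra_und_alg[OF B]])
qed


section \<open>Term algebras and compatibility\<close>

abbreviation trm :: "('s \<Rightarrow> 'v) \<Rightarrow> 's \<Rightarrow> 'u \<Rightarrow> bool" where
  "trm X \<equiv> is_term usig (FOb US X)"

abbreviation Trm :: "('s \<Rightarrow> 'v) \<Rightarrow> 's \<Rightarrow> 'u set" where
  "Trm X \<equiv> Terms S usig (FOb US X)"

lemma trm_var: "\<lbrakk>s \<in> S; x \<in> FOb U (X s)\<rbrakk> \<Longrightarrow> trm X s (tvar x)"
  by (simp add: is_term.var)

lemma trm_app:
  "\<lbrakk>\<sigma> \<in> Syms Sg; p \<in> FOb U (Par Sg \<sigma>); list_all2 (trm X) (Ins Sg \<sigma>) ts\<rbrakk>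
    \<Longrightarrow> trm X (Out Sg \<sigma>) (tapp (upair \<sigma> p) (utuple ts))"
  using is_term.app[of "upair \<sigma> p" usig "FOb US X" ts] by simp

lemma small_Trm: "\<lbrakk>X \<in> Ob VS; s \<in> S\<rbrakk> \<Longrightarrow> small (Trm X s)"
  using small_Terms[OF is_signature_und_sig] US_in_Ob by (auto simp: Ob_power_cat)

lemma args_trm:
  assumes "FOb US B = Trm X" "\<sigma> \<in> Syms Sg"
  shows "args B \<sigma> ts \<longleftrightarrow> list_all2 (trm X) (Ins Sg \<sigma>) ts"
proof -
  have "FOb U (B s) = Trm X s" if "s \<in> S" for s
    using fun_cong[OF assms(1), of s] that by simp
  then show ?thesis
    using sorts(1)[OF assms(2)] by (auto simp: list_all2_conv_all_nth subset_iff)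
qed

text \<open>\<open>op_hat\<close> is written with the sets of terms, the arrow \<open>m\<close> with
  the sets underlying \<open>B\<close>. The fibre condition identifies these, so the two maps are
  parallel and can be compared on elements. This is condition (2) of compatibility in elementwise
  form.\<close>

lemma FArr_eq_op_hat_iff:
  assumes X: "X \<in> Ob VS" and B: "B \<in> Ob VS" "FOb US B = Trm X" and \<sigma>: "\<sigma> \<in> Syms Sg"
    and m: "m \<in> Hom V (op_dom V U Sg B \<sigma>) (B (Out Sg \<sigma>))"
  shows "FArr U m = op_hat U S Sg (FOb US X) \<sigma> \<longleftrightarrow>
    (\<forall>p \<in> FOb U (Par Sg \<sigma>). \<forall>ts. list_all2 (trm X) (Ins Sg \<sigma>) ts \<longrightarrow>
      val m (upair p (utuple ts)) = tapp (upair \<sigma> p) (utuple ts))"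
proof -
  have fibre: "FOb U (B s) = Trm X s" if "s \<in> S" for s
    using fun_cong[OF B(2), of s] that by simp
  have "map (\<lambda>s. FOb U (B s)) (Ins Sg \<sigma>) = map (Trm X) (Ins Sg \<sigma>)"
    using fibre sorts(1)[OF \<sigma>] by auto
  then have hat: "op_hat U S Sg (FOb US X) \<sigma> = setmap (FOb U (op_dom V U Sg B \<sigma>))
      (\<lambda>z. tapp (upair \<sigma> (ufst z)) (usnd z)) (FOb U (B (Out Sg \<sigma>)))"
    unfolding op_hat_def Let_def op_dom(2)[OF B(1) \<sigma>] fibre[OF sorts(2)[OF \<sigma>]] by (simp only:)
  have "op_hat U S Sg (FOb US X) \<sigma> \<in> Hom SetC (FOb U (op_dom V U Sg B \<sigma>)) (FOb U (B (Out Sg \<sigma>)))"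
    unfolding hat
  proof (rule setmap_in_Hom)
    show "small (FOb U (op_dom V U Sg B \<sigma>))" "small (FOb U (B (Out Sg \<sigma>)))"
      using small_U Hom_ob[OF m] by blast+
    fix z assume "z \<in> FOb U (op_dom V U Sg B \<sigma>)"
    then show "tapp (upair \<sigma> (ufst z)) (usnd z) \<in> FOb U (B (Out Sg \<sigma>))"
      using trm_app[OF \<sigma>] fibre[OF sorts(2)[OF \<sigma>]] sorts(2)[OF \<sigma>] args_trm[OF B(2) \<sigma>]
      by (auto elim!: op_dom_cases[OF B(1) \<sigma>])
  qed
  from Hom_SetC_eqI[OF U_hom[OF m] this]
  have "FArr U m = op_hat U S Sg (FOb US X) \<sigma> \<longleftrightarrow>
    (\<forall>z \<in> FOb U (op_dom V U Sg B \<sigma>). val m z = mapfun (op_hat U S Sg (FOb US X) \<sigma>) z)"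
    by auto
  also have "\<dots> \<longleftrightarrow> (\<forall>z \<in> FOb U (op_dom V U Sg B \<sigma>). val m z = tapp (upair \<sigma> (ufst z)) (usnd z))"
    unfolding hat by simp
  also have "\<dots> \<longleftrightarrow> (\<forall>p \<in> FOb U (Par Sg \<sigma>). \<forall>ts. list_all2 (trm X) (Ins Sg \<sigma>) ts \<longrightarrow>
      val m (upair p (utuple ts)) = tapp (upair \<sigma> p) (utuple ts))"
    using upair_in_op_dom[OF B(1) \<sigma>] args_trm[OF B(2) \<sigma>]
    by (auto elim!: op_dom_cases[OF B(1) \<sigma>])
  finally show ?thesis .
qed

lemma FArr_eq_term_incl_iff:
  assumes X: "X \<in> Ob VS" and B: "B \<in> Ob VS" "FOb US B = Trm X" and e: "e \<in> Hom VS X B"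
  shows "FArr US e = term_incl S usig (FOb US X) \<longleftrightarrow>
    (\<forall>s \<in> S. \<forall>x \<in> FOb U (X s). val (e s) x = tvar x)"
proof -
  have "FArr U (e s) = setmap (FOb U (X s)) tvar (Trm X s) \<longleftrightarrow> (\<forall>x \<in> FOb U (X s). val (e s) x = tvar x)"
    if s: "s \<in> S" for s
  proof -
    have "FOb U (B s) = Trm X s"
      using fun_cong[OF B(2), of s] s by simp
    then have e': "FArr U (e s) \<in> Hom SetC (FOb U (X s)) (Trm X s)"
      using U_hom[OF Hom_power_catD[OF e s]] by simp
    have incl: "setmap (FOb U (X s)) tvar (Trm X s) \<in> Hom SetC (FOb U (X s)) (Trm X s)"
      using X s small_U small_Trm[OF X s] trm_var by (auto simp: Ob_power_cat intro: setmap_in_Hom)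
    show ?thesis
      using Hom_SetC_eqI[OF e' incl] by auto
  qed
  moreover have "FArr US e = term_incl S usig (FOb US X) \<longleftrightarrow>
      (\<forall>s \<in> S. FArr U (e s) = setmap (FOb U (X s)) tvar (Trm X s))"
  proof
    assume eq: "FArr US e = term_incl S usig (FOb US X)"
    show "\<forall>s \<in> S. FArr U (e s) = setmap (FOb U (X s)) tvar (Trm X s)"
    proof
      fix s assume "s \<in> S"
      then show "FArr U (e s) = setmap (FOb U (X s)) tvar (Trm X s)"
        using fun_cong[OF eq, of s] by (simp add: term_incl_def)
    qed
  next
    assume "\<forall>s \<in> S. FArr U (e s) = setmap (FOb U (X s)) tvar (Trm X s)"
    then show "FArr US e = term_incl S usig (FOb US X)"
      by (intro extensionalityI[of _ S]) (auto simp: term_incl_def)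
  qed
  ultimately show ?thesis by blast
qed

text \<open>The algebras that lie strictly over the classical term algebra, described on elements;
  \<open>und_alg_eq_term_alg_iff\<close> relates the two descriptions.\<close>

definition term_algebra :: "('s \<Rightarrow> 'v) \<Rightarrow> ('s, 'v, 'm, 'u) algebra \<Rightarrow> bool" where
  "term_algebra X A \<longleftrightarrow> is_algebra V U S Sg A \<and> FOb US (Car A) = Trm X \<and>
    (\<forall>\<sigma> \<in> Syms Sg. \<forall>p \<in> FOb U (Par Sg \<sigma>). \<forall>ts. list_all2 (trm X) (Ins Sg \<sigma>) ts \<longrightarrow>
      val (Opn A \<sigma>) (upair p (utuple ts)) = tapp (upair \<sigma> p) (utuple ts))"

definition is_inclusion :: "('s \<Rightarrow> 'v) \<Rightarrow> ('s \<Rightarrow> 'v) \<Rightarrow> ('s \<Rightarrow> 'm) \<Rightarrow> bool" where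
  "is_inclusion X B e \<longleftrightarrow> e \<in> Hom VS X B \<and> (\<forall>s \<in> S. \<forall>x \<in> FOb U (X s). val (e s) x = tvar x)"

text \<open>Strict lifting demands equality of algebra records. Outside the symbols both families of
  operations are \<open>undefined\<close>; at a symbol both maps are restricted to the same set of
  tuples, so agreement there is enough.\<close>

lemma und_alg_eq_term_alg_iff:
  assumes A: "is_algebra V U S Sg A"
  shows "und_alg U S Sg A = term_alg S usig (FOb US X) \<longleftrightarrow> term_algebra X A"
proof
  assume eq: "und_alg U S Sg A = term_alg S usig (FOb US X)"
  have Car: "FOb US (Car A) = Trm X"
    using arg_cong[OF eq, of Car] by (simp add: term_alg_def)
  have "val (Opn A \<sigma>) (upair p (utuple ts)) = tapp (upair \<sigma> p) (utuple ts)"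
    if \<sigma>: "\<sigma> \<in> Syms Sg" and p: "p \<in> FOb U (Par Sg \<sigma>)" and ts: "list_all2 (trm X) (Ins Sg \<sigma>) ts" for \<sigma> p ts
  proof -
    have "args (Car A) \<sigma> ts"
      using args_trm[OF Car \<sigma>] ts by blast
    then have "val (Opn A \<sigma>) (upair p (utuple ts))
        = mapfun (Opn (term_alg S usig (FOb US X)) (upair \<sigma> p)) (upair unil (utuple ts))"
      using Opn_und_alg[OF \<sigma> p] unfolding eq[symmetric] by simp
    also have "\<dots> = tapp (upair \<sigma> p) (utuple ts)"
      using \<sigma> p ts by (simp add: term_alg_def list_all2_mem_map list_all2_in_Terms[OF sorts(1)[OF \<sigma>]])
    finally show ?thesis .
  qed
  then show "term_algebra X A"
    using A Car by (simp add: term_algebra_def)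
next
  assume ta: "term_algebra X A"
  then have Car: "FOb US (Car A) = Trm X"
    by (simp add: term_algebra_def)
  have "Opn (und_alg U S Sg A) \<tau> = Opn (term_alg S usig (FOb US X)) \<tau>" for \<tau>
  proof (cases "\<tau> \<in> Syms usig")
    case True
    then obtain \<sigma> p where \<sigma>: "\<tau> = upair \<sigma> p" "\<sigma> \<in> Syms Sg" "p \<in> FOb U (Par Sg \<sigma>)"
      by (rule und_sig_cases)
    have fibre: "FOb U (Car A s) = Trm X s" if "s \<in> S" for s
      using fun_cong[OF Car, of s] that by simp
    have ins: "map (\<lambda>s. FOb U (Car A s)) (Ins Sg \<sigma>) = map (Trm X) (Ins Sg \<sigma>)"
      using fibre sorts(1)[OF \<sigma>(2)] by auto
    have "val (Opn A \<sigma>) (upair p (usnd z)) = tapp \<tau> (usnd z)"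
      if "z \<in> uprod {unil} (utuples (map (Trm X) (Ins Sg \<sigma>)))" for z
      using that ta \<sigma>
      by (auto simp: term_algebra_def list_all2_mem_map list_all2_in_Terms[OF sorts(1)[OF \<sigma>(2)]]
        elim!: uprodE utuplesE)
    then show ?thesis
      using True \<sigma> fibre[OF sorts(2)[OF \<sigma>(2)]]
      by (simp add: und_alg_def term_alg_def setmap_def ins cong: restrict_cong)
  next
    case False
    then show ?thesis
      by (simp add: und_alg_def term_alg_def)
  qed
  then have "Opn (und_alg U S Sg A) = Opn (term_alg S usig (FOb US X))" ..
  then show "und_alg U S Sg A = term_alg S usig (FOb US X)"
    using Car by (simp add: term_alg_def algebra.equality)
qed

text \<open>Admissibility asserts that lifts exist. From left to right a lift of each
  \<open>op_hat\<close> is chosen, and the choices, restricted to the symbols, are the operations of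
  an algebra with carrier \<open>B\<close>.\<close>

lemma compatible_iff:
  assumes X: "X \<in> Ob VS"
  shows "compatible V U S Sg X B \<longleftrightarrow>
    (\<exists>A e. term_algebra X A \<and> Car A = B \<and> is_inclusion X B e)"
proof
  assume comp: "compatible V U S Sg X B"
  then have B: "B \<in> Ob VS" "FOb US B = Trm X"
    by (auto simp: compatible_def Term_Fib_def Fib_def)
  obtain e where "e \<in> Hom VS X B" "FArr US e = term_incl S usig (FOb US X)"
    using comp by (auto simp: compatible_def admissible_def)
  then have e: "is_inclusion X B e"
    using FArr_eq_term_incl_iff[OF X B] by (simp add: is_inclusion_def)
  have "\<forall>\<sigma> \<in> Syms Sg. \<exists>m. m \<in> Hom V (op_dom V U Sg B \<sigma>) (B (Out Sg \<sigma>)) \<and>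
      FArr U m = op_hat U S Sg (FOb US X) \<sigma>"
    using comp by (auto simp: compatible_def admissible_def)
  then obtain m where m: "\<And>\<sigma>. \<sigma> \<in> Syms Sg \<Longrightarrow> m \<sigma> \<in> Hom V (op_dom V U Sg B \<sigma>) (B (Out Sg \<sigma>))"
      "\<And>\<sigma>. \<sigma> \<in> Syms Sg \<Longrightarrow> FArr U (m \<sigma>) = op_hat U S Sg (FOb US X) \<sigma>"
    by metis
  define A where "A = \<lparr>Car = B, Opn = restrict m (Syms Sg)\<rparr>"
  have "is_algebra V U S Sg A"
    using B m(1) by (simp add: is_algebra_def A_def)
  then have "term_algebra X A"
    using B m FArr_eq_op_hat_iff[OF X B _ m(1)] by (auto simp: term_algebra_def A_def)
  then show "\<exists>A e. term_algebra X A \<and> Car A = B \<and> is_inclusion X B e"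
    using e by (intro exI[of _ A] exI[of _ e]) (simp add: A_def)
next
  assume "\<exists>A e. term_algebra X A \<and> Car A = B \<and> is_inclusion X B e"
  then obtain A e where A: "term_algebra X A" "Car A = B" and e: "is_inclusion X B e"
    by blast
  have alg: "is_algebra V U S Sg A"
    using A(1) by (simp add: term_algebra_def)
  have B: "B \<in> Ob VS" "FOb US B = Trm X"
    using A is_algebraD(1)[OF alg] by (auto simp: term_algebra_def)
  have "admissible VS US X B (term_incl S usig (FOb US X))"
    using e FArr_eq_term_incl_iff[OF X B] by (auto simp: admissible_def is_inclusion_def)
  moreover have "admissible V U (op_dom V U Sg B \<sigma>) (B (Out Sg \<sigma>)) (op_hat U S Sg (FOb US X) \<sigma>)"
    if \<sigma>: "\<sigma> \<in> Syms Sg" for \<sigma>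
  proof -
    have m: "Opn A \<sigma> \<in> Hom V (op_dom V U Sg B \<sigma>) (B (Out Sg \<sigma>))"
      using is_algebraD(2)[OF alg \<sigma>] A(2) by simp
    moreover have "FArr U (Opn A \<sigma>) = op_hat U S Sg (FOb US X) \<sigma>"
      using A(1) \<sigma> by (simp add: FArr_eq_op_hat_iff[OF X B \<sigma> m] term_algebra_def)
    ultimately show ?thesis
      by (auto simp: admissible_def)
  qed
  ultimately show "compatible V U S Sg X B"
    using B by (simp add: compatible_def Term_Fib_def Fib_def)
qed


section \<open>Free algebras\<close>

text \<open>Variables generate the term algebra, so a homomorphism out of it is determined by its
  values on them.\<close>

lemma classical_hom_unique:
  assumes T: "is_algebra SetC id_func S usig (term_alg S usig Y)" and B: "is_algebra SetC id_func S usig B"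
    and f: "is_algebra_hom SetC id_func S usig (term_alg S usig Y) f B"
    and g: "is_algebra_hom SetC id_func S usig (term_alg S usig Y) g B"
    and eq: "\<And>s x. \<lbrakk>s \<in> S; x \<in> Y s\<rbrakk> \<Longrightarrow> mapfun (f s) (tvar x) = mapfun (g s) (tvar x)"
  shows "f = g"
proof -
  let ?T = "Terms S usig Y"
  have Car: "Car (term_alg S usig Y) = ?T"
    by (simp add: term_alg_def)
  \<comment> \<open>The operations of \<open>term_alg\<close> form compound terms. Being a
    homomorphism therefore means satisfying the recursion whose step is given by the operations of
    \<open>B\<close> at the point \<open>unil\<close>.\<close>
  have hom: "mapfun (k (Out usig \<tau>)) (tapp \<tau> (utuple ts))
      = mapfun (Opn B \<tau>) (upair unil (utuple (map2 (\<lambda>s. mapfun (k s)) (Ins usig \<tau>) ts)))"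
    if k: "is_algebra_hom SetC id_func S usig (term_alg S usig Y) k B"
      and \<tau>: "\<tau> \<in> Syms usig" and ts: "list_all2 (is_term usig Y) (Ins usig \<tau>) ts" for k \<tau> ts
  proof -
    have ts': "list_all2 (\<lambda>s t. t \<in> ?T s) (Ins usig \<tau>) ts"
      using ts list_all2_in_Terms[OF C.sorts(1)[OF \<tau>]] by blast
    then have "mapfun (Opn (term_alg S usig Y) \<tau>) (upair unil (utuple ts)) = tapp \<tau> (utuple ts)"
      using \<tau> by (simp add: term_alg_def list_all2_mem_map)
    moreover have "mapfun (k (Out usig \<tau>)) (mapfun (Opn (term_alg S usig Y) \<tau>) (upair unil (utuple ts)))
        = mapfun (Opn B \<tau>) (upair unil (utuple (map2 (\<lambda>s. mapfun (k s)) (Ins usig \<tau>) ts)))"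
      using k \<tau> ts' unfolding C.is_algebra_hom_iff[OF T B] Car by simp
    ultimately show ?thesis by simp
  qed
  have f': "f \<in> Hom (power_cat S SetC) ?T (Car B)" and g': "g \<in> Hom (power_cat S SetC) ?T (Car B)"
    using f g Car by (simp_all add: is_algebra_hom_def)
  have "f s = g s" if s: "s \<in> S" for s
  proof (rule Hom_SetC_eqI[OF Hom_power_catD[OF f' s] Hom_power_catD[OF g' s]])
    fix t assume "t \<in> ?T s"
    then have "is_term usig Y s t" using s by simp
    then show "mapfun (f s) t = mapfun (g s) t"
      by (rule term_eval_unique[where h = "\<lambda>s. mapfun (f s)" and h' = "\<lambda>s. mapfun (g s)" and S = S
            and opn = "\<lambda>\<tau> vs. mapfun (Opn B \<tau>) (upair unil (utuple vs))"])
        (use eq s hom[OF f] hom[OF g] C.sorts(1) in \<open>simp_all del: und_sig_simps\<close>)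
  qed
  then show ?thesis
    using Hom_power_cat_extensional[OF f'] Hom_power_cat_extensional[OF g']
    by (auto intro: extensionalityI[of _ S])
qed

text \<open>Faithfulness passes from \<open>U\<close> to its power, one sort at a time.\<close>

lemma US_eqD:
  assumes f: "f \<in> Hom VS A B" and g: "g \<in> Hom VS A B" and eq: "FArr US f = FArr US g"
  shows "f = g"
proof (rule extensionalityI[of _ S])
  show "f \<in> extensional S" "g \<in> extensional S"
    using Hom_power_cat_extensional[OF f] Hom_power_cat_extensional[OF g] by blast+
  fix s assume s: "s \<in> S"
  then have "FArr U (f s) = FArr U (g s)"
    using fun_cong[OF eq, of s] by simp
  then show "f s = g s"
    by (intro hom_eqI[OF Hom_power_catD[OF f s] Hom_power_catD[OF g s]]) simp
qed

text \<open>The underlying classical homomorphisms start from a classical term algebra and so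
  coincide; faithfulness lifts the equality back to \<open>V\<close>.\<close>

lemma term_algebra_hom_unique:
  assumes A: "term_algebra X A" and B: "is_algebra V U S Sg B"
    and f: "is_algebra_hom V U S Sg A f B" and g: "is_algebra_hom V U S Sg A g B"
    and eq: "\<And>s x. \<lbrakk>s \<in> S; x \<in> FOb U (X s)\<rbrakk> \<Longrightarrow> val (f s) (tvar x) = val (g s) (tvar x)"
  shows "f = g"
proof -
  have A': "is_algebra V U S Sg A"
    using A by (simp add: term_algebra_def)
  then have und: "und_alg U S Sg A = term_alg S usig (FOb US X)"
    using A und_alg_eq_term_alg_iff by blast
  have "FArr US f = FArr US g"
  proof (rule classical_hom_unique)
    show "is_algebra SetC id_func S usig (term_alg S usig (FOb US X))"
      using is_algebra_und_alg[OF A'] und by simp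
    show "is_algebra SetC id_func S usig (und_alg U S Sg B)"
      using is_algebra_und_alg[OF B] .
    show "is_algebra_hom SetC id_func S usig (term_alg S usig (FOb US X)) (FArr US f) (und_alg U S Sg B)"
      "is_algebra_hom SetC id_func S usig (term_alg S usig (FOb US X)) (FArr US g) (und_alg U S Sg B)"
      using is_algebra_hom_und_alg[OF A' B] f g und by simp_all
  qed (use eq in simp)
  then show ?thesis
    using f g by (intro US_eqD) (auto simp: is_algebra_hom_def)
qed

section \<open>Existence of free algebras\<close>

text \<open>The underlying function of the homomorphism that is to extend \<open>f\<close>. It is a
  plain function because no object of \<open>V\<close> over the set of terms is available yet to
  serve as its domain.\<close>

definition evaluation ::
    "('s \<Rightarrow> 'v) \<Rightarrow> ('s, 'v, 'm, 'u) algebra \<Rightarrow> ('s \<Rightarrow> 'm) \<Rightarrow> ('s \<Rightarrow> 'u \<Rightarrow> 'u) \<Rightarrow> bool" where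
  "evaluation X A f h \<longleftrightarrow> is_algebra V U S Sg A \<and> f \<in> Hom VS X (Car A) \<and>
    (\<forall>s \<in> S. \<forall>x \<in> FOb U (X s). h s (tvar x) = val (f s) x) \<and>
    (\<forall>\<sigma> \<in> Syms Sg. \<forall>p \<in> FOb U (Par Sg \<sigma>). \<forall>ts. list_all2 (trm X) (Ins Sg \<sigma>) ts \<longrightarrow>
      h (Out Sg \<sigma>) (tapp (upair \<sigma> p) (utuple ts))
        = val (Opn A \<sigma>) (upair p (utuple (map2 h (Ins Sg \<sigma>) ts))))"

lemma evaluation_exists:
  assumes "is_algebra V U S Sg A" "f \<in> Hom VS X (Car A)"
  shows "\<exists>h. evaluation X A f h"
proof -
  obtain h where h: "\<And>s x. x \<in> FOb US X s \<Longrightarrow> h s (tvar x) = val (f s) x"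
      "\<And>\<tau> ts. \<lbrakk>\<tau> \<in> Syms usig; list_all2 (trm X) (Ins usig \<tau>) ts\<rbrakk>
        \<Longrightarrow> h (Out usig \<tau>) (tapp \<tau> (utuple ts))
          = val (Opn A (ufst \<tau>)) (upair (usnd \<tau>) (utuple (map2 h (Ins usig \<tau>) ts)))"
    \<comment> \<open>A symbol of \<open>usig\<close> is a pair, from which \<open>ufst\<close>
      recovers the enriched symbol and \<open>usnd\<close> the parameter.\<close>
    by (rule term_eval_exists[of usig "FOb US X" "\<lambda>s. val (f s)"
        "\<lambda>\<tau> vs. val (Opn A (ufst \<tau>)) (upair (usnd \<tau>) (utuple vs))", OF und_sig_simps(5)]) blast
  have "h (Out Sg \<sigma>) (tapp (upair \<sigma> p) (utuple ts))
      = val (Opn A \<sigma>) (upair p (utuple (map2 h (Ins Sg \<sigma>) ts)))"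
    if "\<sigma> \<in> Syms Sg" "p \<in> FOb U (Par Sg \<sigma>)" "list_all2 (trm X) (Ins Sg \<sigma>) ts" for \<sigma> p ts
    using h(2)[of "upair \<sigma> p" ts] that by simp
  then have "evaluation X A f h"
    using assms h(1) by (simp add: evaluation_def)
  then show ?thesis by blast
qed

lemma evaluation_in:
  assumes h: "evaluation X A f h" and t: "trm X s t" "s \<in> S"
  shows "h s t \<in> FOb U (Car A s)"
proof (rule term_eval_in[OF t(1), where B = "\<lambda>s. FOb U (Car A s)" and S = S])
  fix s x assume "x \<in> FOb US X s" "s \<in> S"
  then show "h s (tvar x) \<in> FOb U (Car A s)"
    using h val_in[OF Hom_power_catD[of f S V X "Car A" s]] by (simp add: evaluation_def)
next
  fix \<tau> ts
  assume \<tau>: "\<tau> \<in> Syms usig" and ts: "list_all2 (trm X) (Ins usig \<tau>) ts"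
    "list_all2 (\<lambda>s v. v \<in> FOb U (Car A s)) (Ins usig \<tau>) (map2 h (Ins usig \<tau>) ts)"
  obtain \<sigma> p where \<sigma>: "\<tau> = upair \<sigma> p" "\<sigma> \<in> Syms Sg" "p \<in> FOb U (Par Sg \<sigma>)"
    using \<tau> by (rule und_sig_cases)
  then have "h (Out Sg \<sigma>) (tapp \<tau> (utuple ts)) = val (Opn A \<sigma>) (upair p (utuple (map2 h (Ins Sg \<sigma>) ts)))"
    using h ts(1) by (simp add: evaluation_def)
  then show "h (Out usig \<tau>) (tapp \<tau> (utuple ts)) \<in> FOb U (Car A (Out usig \<tau>))"
    using h Opn_in[OF _ \<sigma>(2,3), of A] ts(2) \<sigma>(1) by (simp add: evaluation_def)
qed (use t C.sorts(1) in blast)+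

text \<open>Only existence of an extension is recorded; its uniqueness follows from
  \<open>term_algebra\<close>.\<close>

definition is_free :: "('s \<Rightarrow> 'v) \<Rightarrow> ('s, 'v, 'm, 'u) algebra \<Rightarrow> ('s \<Rightarrow> 'm) \<Rightarrow> bool" where
  "is_free X A e \<longleftrightarrow> term_algebra X A \<and> is_inclusion X (Car A) e \<and>
    (\<forall>B f. is_algebra V U S Sg B \<and> f \<in> Hom VS X (Car B) \<longrightarrow>
      (\<exists>g. is_algebra_hom V U S Sg A g B \<and> g \<cdot>\<^bsub>VS\<^esub> e = f))"

text \<open>The carrier of the free algebra is the initial lift of the (large) source of all
  evaluation maps of terms in algebras.\<close>

lemma free_carrier_exists:
  assumes X: "X \<in> Ob VS"
  obtains B where "B \<in> Ob VS" "FOb US B = Trm X"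
    and "\<forall>A f h. evaluation X A f h \<longrightarrow>
      (\<exists>g \<in> Hom VS B (Car A). \<forall>s \<in> S. \<forall>t \<in> Trm X s. val (g s) t = h s t)"
    and "\<forall>s \<in> S. \<forall>Z \<in> Ob V. \<forall>\<phi> \<in> Hom SetC (FOb U Z) (Trm X s).
      (\<forall>A f h. evaluation X A f h
        \<longrightarrow> (\<exists>m \<in> Hom V Z (Car A s). \<forall>z \<in> FOb U Z. val m z = h s (mapfun \<phi> z)))
      \<longrightarrow> (\<exists>m \<in> Hom V Z (B s). FArr U m = \<phi>)"
proof -
  define hmap where "hmap s A h = setmap (Trm X s) (h s) (FOb U (Car A s))"
    for s and A :: "('s, 'v, 'm, 'u) algebra" and h :: "'s \<Rightarrow> 'u \<Rightarrow> 'u"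
  \<comment> \<open>A leg depends on the algebra and on the evaluation map alone, so the map
    \<open>f\<close> behind it is merely required to exist.\<close>
  define G where "G s = {(Car A s, hmap s A h) | A h. \<exists>f. evaluation X A f h}" for s
  define lift where "lift s W \<longleftrightarrow> W \<in> Ob V \<and> FOb U W = Trm X s \<and>
      (\<forall>(W', f) \<in> G s. \<exists>m \<in> Hom V W W'. FArr U m = f) \<and>
      (\<forall>Z \<in> Ob V. \<forall>f \<in> Hom SetC (FOb U Z) (Trm X s).
        (\<forall>(W', g) \<in> G s. \<exists>m \<in> Hom V Z W'. \<forall>z \<in> FOb U Z. val m z = mapfun g (mapfun f z))
        \<longrightarrow> (\<exists>m \<in> Hom V Z W. FArr U m = f))" for s W
  have hmap: "Car A s \<in> Ob V" "hmap s A h \<in> Hom SetC (Trm X s) (FOb U (Car A s))"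
    if "evaluation X A f h" "s \<in> S" for s A f h
  proof -
    show Ob: "Car A s \<in> Ob V"
      using that is_algebraD(1) by (auto simp: evaluation_def Ob_power_cat)
    show "hmap s A h \<in> Hom SetC (Trm X s) (FOb U (Car A s))"
      unfolding hmap_def
      by (rule setmap_in_Hom) (use that small_Trm[OF X] small_U[OF Ob] evaluation_in in auto)
  qed
  \<comment> \<open>The lift is formed separately in each sort: initial lifts in a power of
    \<open>V\<close> are computed componentwise.\<close>
  have "\<exists>W. lift s W" if s: "s \<in> S" for s
  proof -
    have "W \<in> Ob V \<and> f \<in> Hom SetC (Trm X s) (FOb U W)" if "(W, f) \<in> G s" for W f
      using that hmap[OF _ s] unfolding G_def by blast
    with small_Trm[OF X s] obtain W where "W \<in> Ob V" "FOb U W = Trm X s"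
      "\<forall>(W', f) \<in> G s. \<exists>m \<in> Hom V W W'. FArr U m = f"
      "\<forall>Z \<in> Ob V. \<forall>f \<in> Hom SetC (FOb U Z) (Trm X s).
        (\<forall>(W', g) \<in> G s. \<exists>m \<in> Hom V Z W'. \<forall>z \<in> FOb U Z. val m z = mapfun g (mapfun f z))
        \<longrightarrow> (\<exists>m \<in> Hom V Z W. FArr U m = f)"
      by (rule initial_lift_exists)
    then have "lift s W"
      unfolding lift_def by (intro conjI)
    then show ?thesis ..
  qed
  then obtain B' where B': "\<And>s. s \<in> S \<Longrightarrow> lift s (B' s)"
    by metis
  define B where "B = restrict B' S"
  have lift: "lift s (B s)" if "s \<in> S" for s
    using B' that by (simp add: B_def)
  have B: "B \<in> Ob VS"
    using lift by (auto simp: Ob_power_cat lift_def B_def)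
  have fibre: "FOb US B = Trm X"
    using lift by (intro extensionalityI[of _ S]) (auto simp: lift_def Terms_def)
  have legs: "\<exists>g \<in> Hom VS B (Car A). \<forall>s \<in> S. \<forall>t \<in> Trm X s. val (g s) t = h s t"
    if h: "evaluation X A f h" for A f h
  proof -
    have "\<forall>s \<in> S. \<exists>m. m \<in> Hom V (B s) (Car A s) \<and> FArr U m = hmap s A h"
    proof
      fix s assume s: "s \<in> S"
      have "(Car A s, hmap s A h) \<in> G s"
        using h by (auto simp: G_def)
      moreover have "\<forall>(W', f) \<in> G s. \<exists>m \<in> Hom V (B s) W'. FArr U m = f"
        using lift[OF s] by (simp add: lift_def)
      ultimately show "\<exists>m. m \<in> Hom V (B s) (Car A s) \<and> FArr U m = hmap s A h"
        by (auto dest!: bspec)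
    qed
    then obtain m where m: "\<forall>s \<in> S. m s \<in> Hom V (B s) (Car A s) \<and> FArr U (m s) = hmap s A h"
      by metis
    have "Car A \<in> Ob VS"
      using h is_algebraD(1) by (simp add: evaluation_def)
    then have "restrict m S \<in> Hom VS B (Car A)"
      using m B by (simp add: Hom_power_cat Ob_power_cat)
    moreover have "\<forall>s \<in> S. \<forall>t \<in> Trm X s. val (restrict m S s) t = h s t"
      using m by (simp add: hmap_def del: in_Terms)
    ultimately show ?thesis by blast
  qed
  have factor: "\<exists>m \<in> Hom V Z (B s). FArr U m = \<phi>"
    if s: "s \<in> S" and Z: "Z \<in> Ob V" and \<phi>: "\<phi> \<in> Hom SetC (FOb U Z) (Trm X s)"
      and ex: "\<forall>A f h. evaluation X A f h
        \<longrightarrow> (\<exists>m \<in> Hom V Z (Car A s). \<forall>z \<in> FOb U Z. val m z = h s (mapfun \<phi> z))"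
    for s Z \<phi>
  proof -
    have "\<exists>m \<in> Hom V Z W. \<forall>z \<in> FOb U Z. val m z = mapfun g (mapfun \<phi> z)" if g: "(W, g) \<in> G s" for W g
    proof -
      obtain A f h where "evaluation X A f h" and g: "W = Car A s" "g = hmap s A h"
        using g by (auto simp: G_def)
      with ex obtain m where "m \<in> Hom V Z (Car A s)" "\<forall>z \<in> FOb U Z. val m z = h s (mapfun \<phi> z)"
        by blast
      then show ?thesis
        using mapfun_in[OF \<phi>] unfolding g hmap_def by (intro bexI[of _ m]) (simp_all del: in_Terms)
    qed
    then have "\<forall>(W, g) \<in> G s. \<exists>m \<in> Hom V Z W. \<forall>z \<in> FOb U Z. val m z = mapfun g (mapfun \<phi> z)"
      by blast
    then show ?thesis
      using lift[OF s] Z \<phi> unfolding lift_def by blast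
  qed
  show ?thesis
    by (rule that[OF B fibre]) (use legs factor in blast)+
qed

text \<open>A map into \<open>B\<close> is admissible as soon as its composites with all evaluations
  are. Composed with an evaluation, the inclusion of variables becomes the arrow \<open>f\<close>,
  and a term-forming map becomes an operation of \<open>A\<close> applied to evaluated arguments;
  both are admissible. Freeness comes at no further cost, because each evaluation is a leg of the
  source and thus an arrow out of \<open>B\<close>.\<close>

lemma free_algebra_exists:
  assumes X: "X \<in> Ob VS"
  shows "\<exists>A e. is_free X A e"
proof -
  obtain B where B: "B \<in> Ob VS" "FOb US B = Trm X"
    and legs: "\<forall>A f h. evaluation X A f h \<longrightarrow>
      (\<exists>g \<in> Hom VS B (Car A). \<forall>s \<in> S. \<forall>t \<in> Trm X s. val (g s) t = h s t)"
    and factor': "\<forall>s \<in> S. \<forall>Z \<in> Ob V. \<forall>\<phi> \<in> Hom SetC (FOb U Z) (Trm X s).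
      (\<forall>A f h. evaluation X A f h
        \<longrightarrow> (\<exists>m \<in> Hom V Z (Car A s). \<forall>z \<in> FOb U Z. val m z = h s (mapfun \<phi> z)))
      \<longrightarrow> (\<exists>m \<in> Hom V Z (B s). FArr U m = \<phi>)"
    by (rule free_carrier_exists[OF X])
  have factor: "\<exists>m \<in> Hom V Z (B s). FArr U m = \<phi>"
    if "s \<in> S" "Z \<in> Ob V" "\<phi> \<in> Hom SetC (FOb U Z) (Trm X s)"
      "\<And>A f h. evaluation X A f h
        \<Longrightarrow> \<exists>m \<in> Hom V Z (Car A s). \<forall>z \<in> FOb U Z. val m z = h s (mapfun \<phi> z)" for s Z \<phi>
    using factor' that by blast
  have fibre: "FOb U (B s) = Trm X s" if "s \<in> S" for s
    using fun_cong[OF B(2), of s] that by simp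
  have "\<exists>m \<in> Hom V (X s) (B s). FArr U m = setmap (FOb U (X s)) tvar (Trm X s)" if s: "s \<in> S" for s
  proof (rule factor[OF s])
    show Xs: "X s \<in> Ob V"
      using X s by (simp add: Ob_power_cat)
    show "setmap (FOb U (X s)) tvar (Trm X s) \<in> Hom SetC (FOb U (X s)) (Trm X s)"
      using small_U[OF Xs] small_Trm[OF X s] trm_var s by (auto intro: setmap_in_Hom)
    fix A f h assume h: "evaluation X A f h"
    then have "f \<in> Hom VS X (Car A)"
      by (simp add: evaluation_def)
    then have "f s \<in> Hom V (X s) (Car A s)"
      using s by (rule Hom_power_catD)
    moreover have "\<forall>x \<in> FOb U (X s). val (f s) x = h s (mapfun (setmap (FOb U (X s)) tvar (Trm X s)) x)"
      using h s by (simp add: evaluation_def)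
    ultimately show "\<exists>m \<in> Hom V (X s) (Car A s). \<forall>x \<in> FOb U (X s).
        val m x = h s (mapfun (setmap (FOb U (X s)) tvar (Trm X s)) x)" by blast
  qed
  then obtain e' where e': "\<forall>s \<in> S. e' s \<in> Hom V (X s) (B s) \<and>
      FArr U (e' s) = setmap (FOb U (X s)) tvar (Trm X s)"
    by metis
  define e where "e = restrict e' S"
  have e: "is_inclusion X B e"
    using e' X B(1) by (simp add: is_inclusion_def e_def Hom_power_cat Ob_power_cat)
  define hat where "hat \<sigma> = setmap (FOb U (op_dom V U Sg B \<sigma>))
      (\<lambda>z. tapp (upair \<sigma> (ufst z)) (usnd z)) (Trm X (Out Sg \<sigma>))" for \<sigma>
  have ex_opn: "\<exists>m \<in> Hom V (op_dom V U Sg B \<sigma>) (B (Out Sg \<sigma>)). FArr U m = hat \<sigma>"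
    if \<sigma>: "\<sigma> \<in> Syms Sg" for \<sigma>
    unfolding hat_def
  proof (rule factor[OF sorts(2)[OF \<sigma>] op_dom(1)[OF B(1) \<sigma>]])
    let ?t = "\<lambda>z. tapp (upair \<sigma> (ufst z)) (usnd z)" and ?Z = "op_dom V U Sg B \<sigma>"
    show "setmap (FOb U ?Z) ?t (Trm X (Out Sg \<sigma>)) \<in> Hom SetC (FOb U ?Z) (Trm X (Out Sg \<sigma>))"
    proof (rule setmap_in_Hom)
      show "small (FOb U ?Z)" "small (Trm X (Out Sg \<sigma>))"
        using small_U op_dom(1)[OF B(1) \<sigma>] small_Trm[OF X sorts(2)[OF \<sigma>]] by blast+
      fix z assume "z \<in> FOb U ?Z"
      then show "?t z \<in> Trm X (Out Sg \<sigma>)"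
        using trm_app[OF \<sigma>] sorts(2)[OF \<sigma>] args_trm[OF B(2) \<sigma>]
        by (auto elim!: op_dom_cases[OF B(1) \<sigma>])
    qed
    fix A f h assume h: "evaluation X A f h"
    then have A: "is_algebra V U S Sg A"
      by (simp add: evaluation_def)
    obtain g where g: "g \<in> Hom VS B (Car A)" "\<forall>s \<in> S. \<forall>t \<in> Trm X s. val (g s) t = h s t"
      using legs h by blast
    \<comment> \<open>\<open>?m\<close> keeps the parameter and evaluates the arguments by the leg
      \<open>g\<close>. The arrow \<open>Opn A \<sigma>\<close> after \<open>?m\<close> lifts the
      composite of term formation with evaluation, by the recursive clause of
      \<open>evaluation\<close>.\<close>
    let ?m = "Ident V (Par Sg \<sigma>) \<otimes>\<^bsub>V\<^esub> prod_arr V U (map g (Ins Sg \<sigma>))"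
    note m = op_dom_map[OF g(1) B(1) is_algebraD(1)[OF A] \<sigma>]
    have "val (Opn A \<sigma> \<cdot>\<^bsub>V\<^esub> ?m) z = h (Out Sg \<sigma>) (mapfun (setmap (FOb U ?Z) ?t (Trm X (Out Sg \<sigma>))) z)"
      if z: "z \<in> FOb U ?Z" for z
    proof -
      obtain p ts where p: "z = upair p (utuple ts)" "p \<in> FOb U (Par Sg \<sigma>)" "args B \<sigma> ts"
        using z by (rule op_dom_cases[OF B(1) \<sigma>])
      have ts: "list_all2 (trm X) (Ins Sg \<sigma>) ts"
        using p(3) args_trm[OF B(2) \<sigma>] by blast
      have "val (Opn A \<sigma> \<cdot>\<^bsub>V\<^esub> ?m) z
          = val (Opn A \<sigma>) (upair p (utuple (map2 (\<lambda>s. val (g s)) (Ins Sg \<sigma>) ts)))"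
        using val_comp[OF m(1) is_algebraD(2)[OF A \<sigma>] z] m(2)[OF p(2,3)] p(1) by simp
      also have "map2 (\<lambda>s. val (g s)) (Ins Sg \<sigma>) ts = map2 h (Ins Sg \<sigma>) ts"
        using sorts(1)[OF \<sigma>] g(2) by (intro map2_cong_list_all2[OF ts]) (auto simp: subset_iff)
      also have "val (Opn A \<sigma>) (upair p (utuple (map2 h (Ins Sg \<sigma>) ts)))
          = h (Out Sg \<sigma>) (tapp (upair \<sigma> p) (utuple ts))"
        using h \<sigma> p(2) ts by (simp add: evaluation_def)
      finally show ?thesis
        using z p(1) by simp
    qed
    then show "\<exists>m \<in> Hom V ?Z (Car A (Out Sg \<sigma>)). \<forall>z \<in> FOb U ?Z.
        val m z = h (Out Sg \<sigma>) (mapfun (setmap (FOb U ?Z) ?t (Trm X (Out Sg \<sigma>))) z)"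
      using comp_hom[OF m(1) is_algebraD(2)[OF A \<sigma>]] by blast
  qed
  have "\<forall>\<sigma> \<in> Syms Sg. \<exists>m. m \<in> Hom V (op_dom V U Sg B \<sigma>) (B (Out Sg \<sigma>)) \<and> FArr U m = hat \<sigma>"
    using ex_opn by blast
  from bchoice[OF this] obtain opn where opn: "\<forall>\<sigma> \<in> Syms Sg.
      opn \<sigma> \<in> Hom V (op_dom V U Sg B \<sigma>) (B (Out Sg \<sigma>)) \<and> FArr U (opn \<sigma>) = hat \<sigma>" ..
  define F where "F = \<lparr>Car = B, Opn = restrict opn (Syms Sg)\<rparr>"
  have Car_F: "Car F = B"
    by (simp add: F_def)
  have F_alg: "is_algebra V U S Sg F"
    using B(1) opn by (simp add: is_algebra_def F_def)
  have opn_val: "val (Opn F \<sigma>) (upair p (utuple ts)) = tapp (upair \<sigma> p) (utuple ts)"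
    if "\<sigma> \<in> Syms Sg" "p \<in> FOb U (Par Sg \<sigma>)" "list_all2 (trm X) (Ins Sg \<sigma>) ts" for \<sigma> p ts
    using that opn upair_in_op_dom[OF B(1) that(1)] args_trm[OF B(2) that(1)] by (simp add: F_def hat_def)
  then have F: "term_algebra X F"
    using F_alg B(2) unfolding term_algebra_def Car_F by blast
  have "\<exists>g. is_algebra_hom V U S Sg F g A \<and> g \<cdot>\<^bsub>VS\<^esub> e = f"
    if A: "is_algebra V U S Sg A" and f: "f \<in> Hom VS X (Car A)" for A f
  proof -
    obtain h where h: "evaluation X A f h"
      using evaluation_exists[OF A f] by blast
    \<comment> \<open>The leg belonging to \<open>h\<close> is the required extension: the clause of
      \<open>evaluation\<close> for compound terms makes it a homomorphism, the clause for variables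
      makes it restrict to \<open>f\<close>.\<close>
    obtain g where g: "g \<in> Hom VS B (Car A)" "\<forall>s \<in> S. \<forall>t \<in> Trm X s. val (g s) t = h s t"
      using legs h by blast
    have "val (g (Out Sg \<sigma>)) (val (Opn F \<sigma>) (upair p (utuple ts)))
        = val (Opn A \<sigma>) (upair p (utuple (map2 (\<lambda>s. val (g s)) (Ins Sg \<sigma>) ts)))"
      if \<sigma>: "\<sigma> \<in> Syms Sg" and p: "p \<in> FOb U (Par Sg \<sigma>)" and "args B \<sigma> ts" for \<sigma> p ts
    proof -
      have ts: "list_all2 (trm X) (Ins Sg \<sigma>) ts"
        using that args_trm[OF B(2) \<sigma>] by blast
      have "val (g (Out Sg \<sigma>)) (val (Opn F \<sigma>) (upair p (utuple ts)))
          = h (Out Sg \<sigma>) (tapp (upair \<sigma> p) (utuple ts))"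
        using g(2) opn_val[OF \<sigma> p ts] trm_app[OF \<sigma> p ts] sorts(2)[OF \<sigma>] by simp
      also have "\<dots> = val (Opn A \<sigma>) (upair p (utuple (map2 h (Ins Sg \<sigma>) ts)))"
        using h \<sigma> p ts by (simp add: evaluation_def)
      also have "map2 h (Ins Sg \<sigma>) ts = map2 (\<lambda>s. val (g s)) (Ins Sg \<sigma>) ts"
        using sorts(1)[OF \<sigma>] g(2) by (intro map2_cong_list_all2[OF ts]) (auto simp: subset_iff)
      finally show ?thesis .
    qed
    then have "is_algebra_hom V U S Sg F g A"
      using g(1) unfolding is_algebra_hom_iff[OF F_alg A] Car_F by blast
    moreover have "g \<cdot>\<^bsub>VS\<^esub> e = f"
    proof (rule extensionalityI[of _ S])
      fix s assume s: "s \<in> S"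
      have e's: "e s \<in> Hom V (X s) (B s)"
        using e s Hom_power_catD[of e S V X B s] by (simp add: is_inclusion_def)
      have "g s \<cdot>\<^bsub>V\<^esub> e s = f s"
      proof (rule hom_eqI)
        fix x assume x: "x \<in> FOb U (X s)"
        have "val (g s) (tvar x) = val (f s) x"
          using g(2) s x trm_var[of s x X] h by (simp add: evaluation_def)
        then show "val (g s \<cdot>\<^bsub>V\<^esub> e s) x = val (f s) x"
          using val_comp[OF e's Hom_power_catD[OF g(1) s] x] e s x by (simp add: is_inclusion_def)
      qed (use comp_hom[OF e's Hom_power_catD[OF g(1) s]] Hom_power_catD[OF f s] in blast)+
      then show "(g \<cdot>\<^bsub>VS\<^esub> e) s = f s"
        using s by simp
    qed (use Hom_power_cat_extensional[OF f] in simp_all)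
    ultimately show ?thesis by blast
  qed
  then have "is_free X F e"
    using F e unfolding is_free_def Car_F by blast
  then show ?thesis by blast
qed

section \<open>From free algebras to a strictly lifted adjunction\<close>

lemma is_freeD:
  assumes X: "X \<in> Ob VS" and free: "is_free X A e"
  shows "term_algebra X A" "is_algebra V U S Sg A" "is_inclusion X (Car A) e" "e \<in> Hom VS X (Car A)"
    and "und_alg U S Sg A = term_alg S usig (FOb US X)"
    and "FArr US e = term_incl S usig (FOb US X)"
proof -
  show A: "term_algebra X A" "is_inclusion X (Car A) e"
    using free by (simp_all add: is_free_def)
  show alg: "is_algebra V U S Sg A" and e: "e \<in> Hom VS X (Car A)"
    using A by (simp_all add: term_algebra_def is_inclusion_def)
  show "und_alg U S Sg A = term_alg S usig (FOb US X)"
    using und_alg_eq_term_alg_iff[OF alg] A(1) by blast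
  have "FOb US (Car A) = Trm X"
    using A(1) by (simp add: term_algebra_def)
  then show "FArr US e = term_incl S usig (FOb US X)"
    using FArr_eq_term_incl_iff[OF X is_algebraD(1)[OF alg] _ e] A(2) by (simp add: is_inclusion_def)
qed

text \<open>For uniqueness, the equation with \<open>e\<close> prescribes the values of a
  homomorphism on the variables, and these determine it.\<close>

lemma is_free_universal:
  assumes X: "X \<in> Ob VS" and free: "is_free X A e" and B: "is_algebra V U S Sg B" and f: "f \<in> Hom VS X (Car B)"
  shows "\<exists>!h. h \<in> Hom (alg_cat V U S Sg) A B \<and> FArr alg_forget h \<cdot>\<^bsub>VS\<^esub> e = f"
proof (rule ex_ex1I)
  obtain g where "is_algebra_hom V U S Sg A g B" "g \<cdot>\<^bsub>VS\<^esub> e = f"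
    using free B f unfolding is_free_def by blast
  then show "\<exists>h. h \<in> Hom (alg_cat V U S Sg) A B \<and> FArr alg_forget h \<cdot>\<^bsub>VS\<^esub> e = f"
    using B is_freeD(2)[OF X free] by (intro exI[of _ "(A, g, B)"]) (simp add: Hom_alg_cat)
next
  fix h h'
  assume h: "h \<in> Hom (alg_cat V U S Sg) A B \<and> FArr alg_forget h \<cdot>\<^bsub>VS\<^esub> e = f"
    and h': "h' \<in> Hom (alg_cat V U S Sg) A B \<and> FArr alg_forget h' \<cdot>\<^bsub>VS\<^esub> e = f"
  obtain g g' where g: "h = (A, g, B)" "is_algebra_hom V U S Sg A g B"
      and g': "h' = (A, g', B)" "is_algebra_hom V U S Sg A g' B"
    using h h' unfolding Hom_alg_cat by blast
  have e: "e \<in> Hom VS X (Car A)" and incl: "is_inclusion X (Car A) e"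
    using is_freeD[OF X free] by blast+
  have vals: "val (k s) (tvar x) = val (f s) x"
    if k: "is_algebra_hom V U S Sg A k B" "k \<cdot>\<^bsub>VS\<^esub> e = f" and s: "s \<in> S" and x: "x \<in> FOb U (X s)"
    for k s x
  proof -
    have "k \<in> Hom VS (Car A) (Car B)"
      using k(1) by (simp add: is_algebra_hom_def)
    from val_comp[OF Hom_power_catD[OF e s] Hom_power_catD[OF this s] x]
    show ?thesis
      using fun_cong[OF k(2), of s] incl s x by (simp add: is_inclusion_def)
  qed
  have "g = g'"
    by (rule term_algebra_hom_unique[OF is_freeD(1)[OF X free] B g(2) g'(2)])
      (use vals g g' h h' in simp)
  then show "h = h'"
    using g(1) g'(1) by simp
qed

text \<open>\<open>term_func\<close> is given on arrows by a definite description. The map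
  underlying \<open>h\<close> satisfies it, and \<open>classical_hom_unique\<close> leaves no other
  solution, so this computes the description for arrows that come from \<open>V\<close>.\<close>

lemma term_func_arr:
  assumes X: "X \<in> Ob VS" and Y: "Y \<in> Ob VS" and f: "f \<in> Hom VS X Y"
    and free: "is_free X A e" "is_free Y B e'"
    and h: "is_algebra_hom V U S Sg A h B" and nat: "h \<cdot>\<^bsub>VS\<^esub> e = e' \<cdot>\<^bsub>VS\<^esub> f"
  shows "FArr (term_func S usig) (FArr US f)
    = (term_alg S usig (FOb US X), FArr US h, term_alg S usig (FOb US Y))"
proof -
  let ?TX = "term_alg S usig (FOb US X)" and ?TY = "term_alg S usig (FOb US Y)"
  let ?iX = "term_incl S usig (FOb US X)" and ?iY = "term_incl S usig (FOb US Y)"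
  note A = is_freeD[OF X free(1)] and B = is_freeD[OF Y free(2)]
  have h': "h \<in> Hom VS (Car A) (Car B)"
    using h by (simp add: is_algebra_hom_def)
  have Uf: "FArr US f \<in> Hom (power_cat S SetC) (FOb US X) (FOb US Y)"
    using US_hom[OF f] .
  have alg: "is_algebra SetC id_func S usig ?TX" "is_algebra SetC id_func S usig ?TY"
    using is_algebra_und_alg[OF A(2)] is_algebra_und_alg[OF B(2)] A(5) B(5) by simp_all
  have Uh: "is_algebra_hom SetC id_func S usig ?TX (FArr US h) ?TY"
    using is_algebra_hom_und_alg[OF A(2) B(2) h] A(5) B(5) by simp
  have tri: "FArr US h \<cdot>\<^bsub>power_cat S SetC\<^esub> ?iX = ?iY \<cdot>\<^bsub>power_cat S SetC\<^esub> FArr US f"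
    using US_comp[OF A(4) h'] US_comp[OF f B(4)] nat A(6) B(6) by simp
  have iX: "?iX s \<in> Hom SetC (FOb US X s) (Trm X s)" if "s \<in> S" for s
  proof -
    have "FOb US (Car A) = Trm X"
      using A(1) by (simp add: term_algebra_def)
    then have "?iX \<in> Hom (power_cat S SetC) (FOb US X) (Trm X)"
      using US_hom[OF A(4)] A(6) by simp
    then show ?thesis
      using that by (rule Hom_power_catD)
  qed
  have vals: "mapfun (k s) (tvar x) = mapfun ((?iY \<cdot>\<^bsub>power_cat S SetC\<^esub> FArr US f) s) x"
    if k: "k \<cdot>\<^bsub>power_cat S SetC\<^esub> ?iX = ?iY \<cdot>\<^bsub>power_cat S SetC\<^esub> FArr US f"
      and s: "s \<in> S" and x: "x \<in> FOb US X s" for k s x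
  proof -
    have "mapfun (?iX s) x = tvar x"
      using s x by (simp add: term_incl_def)
    then show ?thesis
      using mapfun_Comp[OF iX[OF s] x, of "k s"] fun_cong[OF k, of s] s by simp
  qed
  have dom: "Dom (power_cat S SetC) (FArr US f) = FOb US X" "Cod (power_cat S SetC) (FArr US f) = FOb US Y"
    using HomD[OF Uf] by simp_all
  show ?thesis
    unfolding term_func_def func.simps dom
  proof (rule the_equality)
    show "(?TX, FArr US h, ?TY) \<in> Hom (classical_alg_cat S usig) ?TX ?TY \<and>
        FArr alg_forget (?TX, FArr US h, ?TY) \<cdot>\<^bsub>power_cat S SetC\<^esub> ?iX
          = ?iY \<cdot>\<^bsub>power_cat S SetC\<^esub> FArr US f"
      using alg Uh tri by (simp add: C.Hom_alg_cat)
  next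
    fix k
    assume k: "k \<in> Hom (classical_alg_cat S usig) ?TX ?TY \<and>
        FArr alg_forget k \<cdot>\<^bsub>power_cat S SetC\<^esub> ?iX = ?iY \<cdot>\<^bsub>power_cat S SetC\<^esub> FArr US f"
    then obtain k' where k': "k = (?TX, k', ?TY)" "is_algebra_hom SetC id_func S usig ?TX k' ?TY"
      unfolding C.Hom_alg_cat by blast
    have ktri: "k' \<cdot>\<^bsub>power_cat S SetC\<^esub> ?iX = ?iY \<cdot>\<^bsub>power_cat S SetC\<^esub> FArr US f"
      using k unfolding k'(1) by simp
    have "k' = FArr US h"
      by (rule classical_hom_unique[OF alg k'(2) Uh]) (simp only: vals[OF ktri] vals[OF tri])
    then show "k = (?TX, FArr US h, ?TY)"
      using k'(1) by simp
  qed
qed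

text \<open>Strictness on objects and units holds because the chosen algebras lie literally over
  term algebras, strictness on arrows is \<open>term_func_arr\<close>, and the forgetful functors
  commute by definition.\<close>

lemma free_adjunction_exists: "\<exists>F \<eta>. is_free_adjunction V U S Sg F \<eta>"
proof -
  \<comment> \<open>Algebra and unit are chosen together as a pair, since freeness ties them to each
    other.\<close>
  have "\<forall>X. \<exists>Ae. X \<in> Ob VS \<longrightarrow> is_free X (fst Ae) (snd Ae)"
    using free_algebra_exists by simp
  from choice[OF this] obtain Ae where Ae: "\<forall>X. X \<in> Ob VS \<longrightarrow> is_free X (fst (Ae X)) (snd (Ae X))" ..
  define Fo \<eta> where "Fo X = fst (Ae X)" and "\<eta> X = snd (Ae X)" for X
  have free: "is_free X (Fo X) (\<eta> X)" if "X \<in> Ob VS" for X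
    using Ae that by (simp add: Fo_def \<eta>_def)
  note free' = is_freeD[OF _ free]
  obtain F where F: "FOb F = Fo" "left_adjoint VS (alg_cat V U S Sg) F alg_forget \<eta>"
    using left_adjoint_from_universal[OF category_VS category_alg_cat is_functor_alg_forget, of Fo \<eta>]
      free'(2,4) is_free_universal[OF _ free] by auto
  have "FArr (und_alg_func U S Sg) (FArr F f) = FArr (term_func S usig) (FArr US f)"
    if "f \<in> Arr VS" for f
  proof -
    define X Y where "X = Dom VS f" and "Y = Cod VS f"
    have f: "f \<in> Hom VS X Y"
      using that by (simp add: Hom_def X_def Y_def)
    note XY = VS.Hom_ob[OF f]
    have "FArr F f \<in> Hom (alg_cat V U S Sg) (Fo X) (Fo Y)"
      using is_functorD(2)[OF _ category_VS f, of "alg_cat V U S Sg" F] F by (simp add: left_adjoint_def)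
    then obtain h where h: "FArr F f = (Fo X, h, Fo Y)" "is_algebra_hom V U S Sg (Fo X) h (Fo Y)"
      unfolding Hom_alg_cat by blast
    have "FArr alg_forget (FArr F f) \<cdot>\<^bsub>VS\<^esub> \<eta> X = \<eta> Y \<cdot>\<^bsub>VS\<^esub> f"
      using F(2) f XY unfolding left_adjoint_def by blast
    then have "h \<cdot>\<^bsub>VS\<^esub> \<eta> X = \<eta> Y \<cdot>\<^bsub>VS\<^esub> f"
      by (simp add: h(1))
    then show ?thesis
      using term_func_arr[OF XY f free[OF XY(1)] free[OF XY(2)] h(2)] free'(5)[OF XY(1) XY(1)] free'(5)[OF XY(2) XY(2)]
      by (simp add: und_alg_func_def h(1))
  qed
  then have "strictly_lifts VS (alg_cat V U S Sg) US (und_alg_func U S Sg) F alg_forget \<eta>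
      (term_func S usig) alg_forget (term_incl S usig)"
    using F(1) free'(5,6)
    by (auto simp: strictly_lifts_def und_alg_func_def term_func_def alg_cat_def)
  then show ?thesis
    using F(2) by (auto simp: is_free_adjunction_def)
qed

section \<open>The free carrier as an infimum\<close>

text \<open>Proved for every strictly lifted adjunction, so that it covers whichever one the choice
  operator selects.\<close>

lemma free_adjunction_glb:
  assumes F: "is_free_adjunction V U S Sg F \<eta>" and X: "X \<in> Ob VS"
  shows "is_glb (Term_Fib V U S Sg X) (FOb alg_forget (FOb F X))
    {B \<in> carrier (Term_Fib V U S Sg X). compatible V U S Sg X B}"
proof -
  let ?A = "FOb F X"
  have adj: "left_adjoint VS (alg_cat V U S Sg) F alg_forget \<eta>"
    and lifts: "strictly_lifts VS (alg_cat V U S Sg) US (und_alg_func U S Sg) F alg_forget \<eta>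
      (term_func S usig) alg_forget (term_incl S usig)"
    using F by (simp_all add: is_free_adjunction_def)
  have "is_functor VS (alg_cat V U S Sg) F"
    using adj unfolding left_adjoint_def by blast
  from is_functorD(1)[OF this X] have alg: "is_algebra V U S Sg ?A"
    by simp
  have und: "und_alg U S Sg ?A = term_alg S usig (FOb US X)"
  proof -
    have "FOb (und_alg_func U S Sg) ?A = FOb (term_func S usig) (FOb US X)"
      using lifts X unfolding strictly_lifts_def by blast
    then show ?thesis
      by (simp add: und_alg_func_def term_func_def)
  qed
  have ta: "term_algebra X ?A"
    using und und_alg_eq_term_alg_iff[OF alg] by blast
  then have fibre: "FOb US (Car ?A) = Trm X"
    by (simp add: term_algebra_def)
  have unit: "\<eta> X \<in> Hom VS X (Car ?A)"
    using adj X unfolding left_adjoint_def alg_forget_simps by blast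
  have "FArr US (\<eta> X) = term_incl S usig (FOb US X)"
    using lifts X unfolding strictly_lifts_def by blast
  then have incl: "is_inclusion X (Car ?A) (\<eta> X)"
    using FArr_eq_term_incl_iff[OF X is_algebraD(1)[OF alg] fibre unit] unit unfolding is_inclusion_def by blast
  then have comp: "compatible V U S Sg X (Car ?A)"
    using ta compatible_iff[OF X] by blast
  have carrier: "Car ?A \<in> carrier (Term_Fib V U S Sg X)"
    using comp by (simp add: compatible_def)
  have universal: "\<forall>X \<in> Ob VS. \<forall>A \<in> Ob (alg_cat V U S Sg). \<forall>f \<in> Hom VS X (FOb alg_forget A).
      \<exists>!h. h \<in> Hom (alg_cat V U S Sg) (FOb F X) A \<and> FArr alg_forget h \<cdot>\<^bsub>VS\<^esub> \<eta> X = f"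
    using adj unfolding left_adjoint_def by (elim conjE)
  have least: "le (Term_Fib V U S Sg X) (Car ?A) B" if B: "compatible V U S Sg X B" for B
  proof -
    obtain A e where A: "term_algebra X A" "Car A = B" "is_inclusion X B e"
      using compatible_iff[OF X] B by blast
    have A_alg: "is_algebra V U S Sg A" and e: "e \<in> Hom VS X B"
      using A(1,3) unfolding term_algebra_def is_inclusion_def by blast+
    have "A \<in> Ob (alg_cat V U S Sg)" "e \<in> Hom VS X (FOb alg_forget A)"
      using A_alg e A(2) by simp_all
    from universal[rule_format, OF X this] obtain h where h: "h \<in> Hom (alg_cat V U S Sg) ?A A" "FArr alg_forget h \<cdot>\<^bsub>VS\<^esub> \<eta> X = e"
      by blast
    obtain g where g: "h = (?A, g, A)" "is_algebra_hom V U S Sg ?A g A"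
      using h(1) unfolding Hom_alg_cat by blast
    have g': "g \<in> Hom VS (Car ?A) B"
      using g(2) A(2) by (simp add: is_algebra_hom_def)
    have tri: "g \<cdot>\<^bsub>VS\<^esub> \<eta> X = e"
      using h(2) g(1) by simp
    have und_A: "und_alg U S Sg A = term_alg S usig (FOb US X)"
      using und_alg_eq_term_alg_iff[OF A_alg] A(1) by blast
    have T: "is_algebra SetC id_func S usig (term_alg S usig (FOb US X))"
      using is_algebra_und_alg[OF alg] und by simp
    have Car_T: "Car (term_alg S usig (FOb US X)) = Trm X"
      by (simp add: term_alg_def)
    \<comment> \<open>Both sides are endomorphisms of the classical term algebra that fix the
      variables. On the left this comes from \<open>tri\<close>, since the unit and \<open>e\<close>
      both lie over the inclusion.\<close>
    have "FArr US g = Ident (power_cat S SetC) (Trm X)"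
    proof (rule classical_hom_unique[OF T T])
      show "is_algebra_hom SetC id_func S usig (term_alg S usig (FOb US X)) (FArr US g)
          (term_alg S usig (FOb US X))"
        using is_algebra_hom_und_alg[OF alg A_alg g(2)] und und_A by simp
      show "is_algebra_hom SetC id_func S usig (term_alg S usig (FOb US X))
          (Ident (power_cat S SetC) (Trm X)) (term_alg S usig (FOb US X))"
        using C.is_algebra_hom_ident[OF T] Car_T by simp
      fix s x assume s: "s \<in> S" and x: "x \<in> FOb US X s"
      then have "val ((g \<cdot>\<^bsub>VS\<^esub> \<eta> X) s) x = val (g s) (tvar x)"
        using val_comp[OF Hom_power_catD[OF unit s] Hom_power_catD[OF g' s]] incl
        by (simp add: is_inclusion_def)
      then show "mapfun (FArr US g s) (tvar x) = mapfun (Ident (power_cat S SetC) (Trm X) s) (tvar x)"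
        using s x A(3) trm_var[of s x X] by (simp add: tri is_inclusion_def)
    qed
    then show ?thesis
      using g' by (auto simp: Term_Fib_def Fib_def admissible_def)
  qed
  \<comment> \<open>The free carrier is itself compatible, so every lower bound of the compatible
    objects lies below it.\<close>
  show ?thesis
    unfolding greatest_def Lower_def using carrier comp least by auto
qed

end

theorem theorem3p2p5:
  fixes V :: "('v, 'm) moncat"
    and U :: "('v, 'm, 'u::set_universe set, 'u setmap) func"
    and S :: "'s set"
    and Sg :: "('s, 'v, 'u) signature"
    and X :: "'s \<Rightarrow> 'v"
  assumes "topological V SetC U"
    and "symmetric_monoidal V"
    and "strict_symmetric_monoidal_func V SetC U"
    and "is_signature V S Sg"
    and "X \<in> Ob (power_cat S V)"
  shows "is_glb (Term_Fib V U S Sg X)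
           (FOb alg_forget (FOb (free_func V U S Sg) X))
           {B \<in> carrier (Term_Fib V U S Sg X). compatible V U S Sg X B}"
proof -
  interpret symmetric_monoidal V by fact
  interpret enriched_signature V U S Sg
  proof
    show "topological V SetC U" "is_signature V S Sg" by fact+
  qed (use assms(3) tens_ob tens_hom in \<open>auto simp: strict_symmetric_monoidal_func_def\<close>)
  \<comment> \<open>Existence of one strictly lifted adjunction guarantees that the functor selected
    by \<open>SOME\<close> belongs to such an adjunction.\<close>
  obtain \<eta> where "is_free_adjunction V U S Sg (free_func V U S Sg) \<eta>"
    unfolding free_func_def using someI_ex[OF free_adjunction_exists] by blast
  then show ?thesis
    using assms(5) by (rule free_adjunction_glb)
qed

end
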